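(* Let $\mathfrak g$ be a basic Lie superalgebra over $\mathbb C$ and $e\in\mathfrak g_{\bar0}$ a nilpotent element. There is an isomorphism of Kazhdan filtered algebras $$W'_\chi\cong W^{\mathrm{fin}}(\mathfrak g,e)$$ between the refined $W$-superalgebra $W'_\chi=(U(\mathfrak g)/I_\chi)^{\mathrm{ad}\,\mathfrak m'}$ and the quantum finite $W$-superalgebra $W^{\mathrm{fin}}(\mathfrak g,e)=(U(\mathfrak g)/I^{\mathrm{fin}})^{\mathrm{ad}\,\mathfrak n}$.
   Context: Everything is in the super sense. A basic Lie superalgebra over $\mathbb C$ is one of $\mathfrak{gl}(m|n)$, $\mathfrak{sl}(m|n)$ ($m\ne n$), $\mathfrak{sl}(n|n)/\mathbb CI$, $\mathfrak{osp}(m|n)$, $D(2,1;a)$, $F(4)$, $G(3)$, with an even nondegenerate supersymmetric invariant bilinear form $(\cdot,\cdot)$. Let $(e,h,f)$ be an $\mathfrak{sl}_2$-triple in $\mathfrak g_{\bar0}$ with $(e,f)=1$, $\chi=(e,\cdot)$, $\mathfrak g(i)=\{x:[h,x]=ix\}$. On $\mathfrak g(-1)$ put $\langle x,y\rangle=(e,[x,y])$ (symplectic on the even part, symmetric on the odd part, both nondegenerate). Let $s=\dim\mathfrak g(-1)_{\bar0}$, $\mathsf r=\dim\mathfrak g(-1)_{\bar1}$, and choose bases $u_1,\dots,u_s$ of $\mathfrak g(-1)_{\bar0}$ and $v_1,\dots,v_{\mathsf r}$ of $\mathfrak g(-1)_{\bar1}$ with $\langle u_i,u_j\rangle=i^*\delta_{i+j,s+1}$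 ($i^*=-1$ for $i\le s/2$, $i^*=1$ for $i>s/2$) and $\langle v_i,v_j\rangle=\delta_{i+j,\mathsf r+1}$. Let $\mathfrak m=\bigoplus_{i\le-2}\mathfrak g(i)\oplus\mathfrak g(-1)'$, where $\mathfrak g(-1)'$ is spanned by $u_{s/2+1},\dots,u_s$ and by $v_{\mathsf r/2+1},\dots,v_{\mathsf r}$ if $\mathsf r$ is even, $v_{(\mathsf r+3)/2},\dots,v_{\mathsf r}$ if $\mathsf r$ is odd; $\mathfrak m'=\mathfrak m$ if $\mathsf r$ is even, $\mathfrak m'=\mathfrak m\oplus\mathbb Cv_{(\mathsf r+1)/2}$ if $\mathsf r$ is odd. $I_\chi$ is the left ideal of $U(\mathfrak g)$ generated by $x-\chi(x)$, $x\in\mathfrak m$, and $W'_\chi=\{y+I_\chi: [a,y]\in I_\chi\ \forall a\in\mathfrak m'\}$ with product induced from $U(\mathfrak g)$. $\mathfrak n=\bigoplus_{i\le-1}\mathfrak g(i)$, $I^{\mathrm{fin}}$ is the left ideal of $U(\mathfrak g)$ generated by $x-\chi(x)$, $x\in\bigoplus_{i\le-2}\mathfrak g(i)$, and $W^{\mathrm{fin}}(\mathfrak g,e)=\{y+I^{\mathrm{fin}}:[a,y]\in I^{\mathrm{fin}}\ \forall a\in\mathfrak n\}$ with product induced from $U(\mathfrak g)$. Kazhdan filtration: $\mathrm F_iU(\mathfrak g)$ is spanned by products $x_1\cdots x_k$ with $x_t\in\mathfrak g(j_t)$ and $\sum_t(j_t+2)\le i$; it induces filtrations on the quotients of $U(\mathfrak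 g)$ and on $W'_\chi$, $W^{\mathrm{fin}}(\mathfrak g,e)$. *)

theory Defs
  imports
    Complex_Main
    "HOL-Library.Z2"
    "HOL-Library.Poly_Mapping"
    "HOL-Library.Set_Algebras"
    "HOL-Algebra.QuotRing"
    "HOL-Algebra.Module"
    "Jordan_Normal_Form.Matrix"
begin

section \<open>Complex super vector spaces and Lie superalgebras\<close>

class cvector = ab_group_add +
  fixes scaleC :: "complex \<Rightarrow> 'a \<Rightarrow> 'a"  (infixr \<open>*\<^sub>C\<close> 75)
  assumes scaleC_add_right: "c *\<^sub>C (x + y) = c *\<^sub>C x + c *\<^sub>C y"
    and scaleC_add_left: "(c + d) *\<^sub>C x = c *\<^sub>C x + d *\<^sub>C x"
    and scaleC_scaleC: "c *\<^sub>C (d *\<^sub>C x) = (c * d) *\<^sub>C x"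
    and scaleC_one: "1 *\<^sub>C x = x"

interpretation cvec: vector_space "scaleC :: complex \<Rightarrow> 'a::cvector \<Rightarrow> 'a"
  by standard (simp_all add: scaleC_add_right scaleC_add_left scaleC_scaleC scaleC_one)

abbreviation csubspace :: "'a::cvector set \<Rightarrow> bool"
  where "csubspace \<equiv> module.subspace scaleC"

abbreviation cspan :: "'a::cvector set \<Rightarrow> 'a set"
  where "cspan \<equiv> module.span scaleC"

abbreviation cindependent :: "'a::cvector set \<Rightarrow> bool"
  where "cindependent S \<equiv> \<not> module.dependent scaleC S"

abbreviation cdim :: "'a::cvector set \<Rightarrow> nat"
  where "cdim \<equiv> vector_space.dim scaleC"

text \<open>Bases are families indexed by \<open>1, \<dots>, n\<close>; values outside this range are irrelevant.\<close>

definition basis_family :: "(nat \<Rightarrow> 'a::cvector) \<Rightarrow> nat \<Rightarrow> 'a set \<Rightarrow> bool"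
  where "basis_family b n V \<longleftrightarrow>
    inj_on b {1..n} \<and> cindependent (b ` {1..n}) \<and> cspan (b ` {1..n}) = V"

text \<open>The parities form the two-element field \<^typ>\<open>bit\<close>; \<open>gr 0\<close> and \<open>gr 1\<close> are the even and the
  odd part.\<close>

class superspace = cvector +
  fixes gr :: "bit \<Rightarrow> 'a set"
  assumes gr_zero: "0 \<in> gr p"
    and gr_add: "x \<in> gr p \<Longrightarrow> y \<in> gr p \<Longrightarrow> x + y \<in> gr p"
    and gr_scaleC: "x \<in> gr p \<Longrightarrow> c *\<^sub>C x \<in> gr p"
    and gr_direct: "gr 0 \<inter> gr 1 = {0}"
    and gr_decompose: "\<exists>y\<in>gr 0. \<exists>z\<in>gr 1. x = y + z"

text \<open>The Koszul sign $(-1)^{pq}$.\<close>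

definition ksign :: "bit \<Rightarrow> bit \<Rightarrow> complex"
  where "ksign p q = (if p = 1 \<and> q = 1 then - 1 else 1)"

class lie_superalgebra = superspace +
  fixes bracket :: "'a \<Rightarrow> 'a \<Rightarrow> 'a"
  assumes bracket_add_left: "bracket (x + y) z = bracket x z + bracket y z"
    and bracket_add_right: "bracket x (y + z) = bracket x y + bracket x z"
    and bracket_scaleC_left: "bracket (c *\<^sub>C x) y = c *\<^sub>C bracket x y"
    and bracket_scaleC_right: "bracket x (c *\<^sub>C y) = c *\<^sub>C bracket x y"
    and bracket_gr: "x \<in> gr p \<Longrightarrow> y \<in> gr q \<Longrightarrow> bracket x y \<in> gr (p + q)"
    and bracket_super_skew:
      "x \<in> gr p \<Longrightarrow> y \<in> gr q \<Longrightarrow> bracket x y = - (ksign p q *\<^sub>C bracket y x)"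
    and bracket_super_Jacobi:
      "x \<in> gr p \<Longrightarrow> y \<in> gr q \<Longrightarrow>
        bracket x (bracket y z) = bracket (bracket x y) z + ksign p q *\<^sub>C bracket y (bracket x z)"

definition homogeneous_part :: "bit \<Rightarrow> 'a::superspace \<Rightarrow> 'a"
  where "homogeneous_part p x = (THE y. y \<in> gr p \<and> x - y \<in> gr (p + 1))"

text \<open>The bilinear extension of $[x,y] = xy - (-1)^{|x||y|}yx$ to inhomogeneous elements.\<close>

definition supercommutator :: "'a::{ring_1,superspace} \<Rightarrow> 'a \<Rightarrow> 'a"
  where "supercommutator x y = (\<Sum>p\<in>{0,1}. \<Sum>q\<in>{0,1}.
    homogeneous_part p x * homogeneous_part q y
      - ksign p q *\<^sub>C (homogeneous_part q y * homogeneous_part p x))"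

lemma homogeneous_part_unique:
  fixes x :: "'a::superspace"
  shows "\<exists>!y. y \<in> gr p \<and> x - y \<in> gr (p + 1)"
proof (rule ex_ex1I)
  obtain y z where yz: "y \<in> gr 0" "z \<in> gr 1" "x = y + z"
    using gr_decompose by blast
  show "\<exists>y. y \<in> gr p \<and> x - y \<in> gr (p + 1)"
  proof (cases p)
    assume "p = 0"
    then show ?thesis using yz by (intro exI[of _ y]) simp
  next
    assume "p = 1"
    then show ?thesis using yz by (intro exI[of _ z]) simp
  qed
next
  fix y z :: 'a
  assume y: "y \<in> gr p \<and> x - y \<in> gr (p + 1)" and z: "z \<in> gr p \<and> x - z \<in> gr (p + 1)"
  have diff: "a - b \<in> gr q" if "a \<in> gr q" "b \<in> gr q" for a b :: 'a and q
    using gr_add[OF that(1) gr_scaleC[OF that(2), of "-1"]] by simp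
  have "y - z \<in> gr p"
    using y z diff by blast
  moreover have "(x - z) - (x - y) \<in> gr (p + 1)"
    using y z diff by blast
  ultimately have "y - z \<in> gr 0 \<inter> gr 1"
    by (cases p) auto
  then show "y = z"
    unfolding gr_direct by simp
qed


section \<open>Basic Lie superalgebras\<close>

subsection \<open>Matrix Lie superalgebras\<close>

text \<open>The first \<open>m\<close> rows and columns of an \<open>(m + n) \<times> (m + n)\<close> matrix are even, the others odd.
  A graded space of matrices is given by its even and odd parts.\<close>

definition index_parity :: "nat \<Rightarrow> nat \<Rightarrow> bit"
  where "index_parity m i = (if i < m then 0 else 1)"

definition gl_part :: "nat \<Rightarrow> nat \<Rightarrow> bit \<Rightarrow> complex mat set"
  where "gl_part m n p = {A \<in> carrier_mat (m + n) (m + n).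
    \<forall>i<m + n. \<forall>j<m + n. index_parity m i + index_parity m j \<noteq> p \<longrightarrow> A $$ (i, j) = 0}"

definition supertrace :: "nat \<Rightarrow> nat \<Rightarrow> complex mat \<Rightarrow> complex"
  where "supertrace m n A = (\<Sum>i<m. A $$ (i, i)) - (\<Sum>i=m..<m + n. A $$ (i, i))"

definition sl_part :: "nat \<Rightarrow> nat \<Rightarrow> bit \<Rightarrow> complex mat set"
  where "sl_part m n p = {A \<in> gl_part m n p. supertrace m n A = 0}"

text \<open>Gram matrix of the even supersymmetric form on $\mathbb C^{m|2k}$: the identity on the even
  part and the standard symplectic matrix on the odd part.\<close>

definition osp_form :: "nat \<Rightarrow> nat \<Rightarrow> complex mat"
  where "osp_form m k = mat (m + 2 * k) (m + 2 * k) (\<lambda>(i, j).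
    if i < m \<and> j = i then 1
    else if m \<le> i \<and> i < m + k \<and> j = i + k then 1
    else if m + k \<le> i \<and> i = j + k then - 1
    else 0)"

text \<open>$B(Ax,y) + (-1)^{|A||x|}B(x,Ay) = 0$ for \<open>x\<close>, \<open>y\<close> the \<open>i\<close>-th and \<open>j\<close>-th standard vectors.\<close>

definition osp_part :: "nat \<Rightarrow> nat \<Rightarrow> bit \<Rightarrow> complex mat set"
  where "osp_part m k p = {A \<in> gl_part m (2 * k) p.
    \<forall>i<m + 2 * k. \<forall>j<m + 2 * k.
      (transpose_mat A * osp_form m k) $$ (i, j)
        + ksign p (index_parity m i) * (osp_form m k * A) $$ (i, j) = 0}"

definition matrix_superspace :: "(bit \<Rightarrow> complex mat set) \<Rightarrow> complex mat set"
  where "matrix_superspace M = {X + Y |X Y. X \<in> M 0 \<and> Y \<in> M 1}"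

text \<open>\<open>'g\<close> is isomorphic to the quotient of the Lie superalgebra of matrices with even and odd
  parts \<open>M 0\<close>, \<open>M 1\<close> by its ideal \<open>K\<close>; by bilinearity the bracket need only be compared on
  homogeneous elements.\<close>

definition is_matrix_quotient ::
    "(bit \<Rightarrow> complex mat set) \<Rightarrow> complex mat set \<Rightarrow> 'g::lie_superalgebra itself \<Rightarrow> bool"
  where "is_matrix_quotient M K G \<longleftrightarrow> (\<exists>\<psi> :: complex mat \<Rightarrow> 'g.
    (\<forall>A\<in>matrix_superspace M. \<forall>B\<in>matrix_superspace M. \<psi> (A + B) = \<psi> A + \<psi> B) \<and>
    (\<forall>A\<in>matrix_superspace M. \<forall>c. \<psi> (c \<cdot>\<^sub>m A) = c *\<^sub>C \<psi> A) \<and>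
    (\<forall>A\<in>matrix_superspace M. \<psi> A = 0 \<longleftrightarrow> A \<in> K) \<and>
    (\<forall>p. \<psi> ` M p = gr p) \<and>
    (\<forall>p q. \<forall>A\<in>M p. \<forall>B\<in>M q. bracket (\<psi> A) (\<psi> B) = \<psi> (A * B - ksign p q \<cdot>\<^sub>m (B * A))))"

definition is_gl :: "nat \<Rightarrow> nat \<Rightarrow> 'g::lie_superalgebra itself \<Rightarrow> bool"
  where "is_gl m n G \<longleftrightarrow> is_matrix_quotient (gl_part m n) {0\<^sub>m (m + n) (m + n)} G"

definition is_sl :: "nat \<Rightarrow> nat \<Rightarrow> 'g::lie_superalgebra itself \<Rightarrow> bool"
  where "is_sl m n G \<longleftrightarrow> is_matrix_quotient (sl_part m n) {0\<^sub>m (m + n) (m + n)} G"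

definition is_psl :: "nat \<Rightarrow> 'g::lie_superalgebra itself \<Rightarrow> bool"
  where "is_psl n G \<longleftrightarrow>
    is_matrix_quotient (sl_part n n) {c \<cdot>\<^sub>m 1\<^sub>m (n + n) |c. True} G"

definition is_osp :: "nat \<Rightarrow> nat \<Rightarrow> 'g::lie_superalgebra itself \<Rightarrow> bool"
  where "is_osp m n G \<longleftrightarrow> (\<exists>k. n = 2 * k \<and>
    is_matrix_quotient (osp_part m k) {0\<^sub>m (m + n) (m + n)} G)"


subsection \<open>Exceptional Lie superalgebras\<close>

definition lie_subalgebra :: "'g::lie_superalgebra set \<Rightarrow> bool"
  where "lie_subalgebra S \<longleftrightarrow> csubspace S \<and> (\<forall>x\<in>S. \<forall>y\<in>S. bracket x y \<in> S)"

definition lie_ideal :: "'g::lie_superalgebra set \<Rightarrow> bool"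
  where "lie_ideal S \<longleftrightarrow> csubspace S \<and> (\<forall>x. \<forall>y\<in>S. bracket x y \<in> S \<and> bracket y x \<in> S)"

text \<open>\<open>'g\<close> is Kac's contragredient Lie superalgebra with Cartan matrix \<open>A\<close> (a list of rows,
  nonsingular in all uses below, so that the Cartan subalgebra is spanned by the \<open>H i\<close>) and set
  \<open>\<tau>\<close> of odd simple roots: it is generated by \<open>E i\<close>, \<open>F i\<close>, \<open>H i\<close> subject to
  the Chevalley relations, and the maximal ideal meeting the Cartan subalgebra trivially has been
  factored out.  Indices start at 0.\<close>

definition is_contragredient :: "complex list list \<Rightarrow> nat set \<Rightarrow> 'g::lie_superalgebra itself \<Rightarrow> bool"
  where "is_contragredient A \<tau> G \<longleftrightarrow> (\<exists>E F H :: nat \<Rightarrow> 'g.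
    (let N = {..<length A} in
      (\<forall>i\<in>N. H i \<in> gr 0 \<and> E i \<in> gr (if i \<in> \<tau> then 1 else 0)
                     \<and> F i \<in> gr (if i \<in> \<tau> then 1 else 0)) \<and>
      (\<forall>i\<in>N. \<forall>j\<in>N.
         bracket (H i) (H j) = 0 \<and>
         bracket (E i) (F j) = (if i = j then H i else 0) \<and>
         bracket (H i) (E j) = (A ! i ! j) *\<^sub>C E j \<and>
         bracket (H i) (F j) = - ((A ! i ! j) *\<^sub>C F j)) \<and>
      inj_on H N \<and> cindependent (H ` N) \<and>
      lie_subalgebra hull (E ` N \<union> F ` N \<union> H ` N) = UNIV \<and>
      (\<forall>I. lie_ideal I \<and> I \<inter> cspan (H ` N) = {0} \<longrightarrow> I = {0})))"

definition is_D21 :: "complex \<Rightarrow> 'g::lie_superalgebra itself \<Rightarrow> bool"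
  where "is_D21 a G \<longleftrightarrow> is_contragredient
    [[ 0, 1, a],
     [-1, 2, 0],
     [-1, 0, 2]] {0} G"

definition is_F4 :: "'g::lie_superalgebra itself \<Rightarrow> bool"
  where "is_F4 G \<longleftrightarrow> is_contragredient
    [[ 0,  1,  0,  0],
     [-1,  2, -2,  0],
     [ 0, -1,  2, -1],
     [ 0,  0, -1,  2]] {0} G"

definition is_G3 :: "'g::lie_superalgebra itself \<Rightarrow> bool"
  where "is_G3 G \<longleftrightarrow> is_contragredient
    [[ 0,  1,  0],
     [-1,  2, -3],
     [ 0, -1,  2]] {0} G"

text \<open>Finite-dimensionality is automatic for every algebra in the list.  The exclusions
  \<open>a \<noteq> 0, -1\<close> are the usual ones in the definition of $D(2,1;a)$.\<close>

definition basic_lie_superalgebra :: "'g::lie_superalgebra itself \<Rightarrow> bool"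
  where "basic_lie_superalgebra G \<longleftrightarrow>
    (\<exists>B :: 'g set. finite B \<and> cspan B = UNIV) \<and>
    ((\<exists>m n. is_gl m n G) \<or>
     (\<exists>m n. m \<noteq> n \<and> is_sl m n G) \<or>
     (\<exists>n\<ge>1. is_psl n G) \<or>
     (\<exists>m n. is_osp m n G) \<or>
     (\<exists>a. a \<noteq> 0 \<and> a \<noteq> - 1 \<and> is_D21 a G) \<or>
     is_F4 G \<or>
     is_G3 G)"


subsection \<open>Invariant forms, nilpotent elements and triples\<close>

definition basic_form :: "('g::lie_superalgebra \<Rightarrow> 'g \<Rightarrow> complex) \<Rightarrow> bool"
  where "basic_form B \<longleftrightarrow>
    (\<forall>x y z. B (x + y) z = B x z + B y z \<and> B x (y + z) = B x y + B x z) \<and>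
    (\<forall>c x y. B (c *\<^sub>C x) y = c * B x y \<and> B x (c *\<^sub>C y) = c * B x y) \<and>
    (\<forall>p q. \<forall>x\<in>gr p. \<forall>y\<in>gr q. p \<noteq> q \<longrightarrow> B x y = 0) \<and>
    (\<forall>p q. \<forall>x\<in>gr p. \<forall>y\<in>gr q. B x y = ksign p q * B y x) \<and>
    (\<forall>x y z. B (bracket x y) z = B x (bracket y z)) \<and>
    (\<forall>x. (\<forall>y. B x y = 0) \<longrightarrow> x = 0)"

definition ad_nilpotent :: "'g::lie_superalgebra \<Rightarrow> bool"
  where "ad_nilpotent x \<longleftrightarrow> (\<exists>k. \<forall>y. (bracket x ^^ k) y = 0)"

definition even_sl2_triple :: "'g::lie_superalgebra \<Rightarrow> 'g \<Rightarrow> 'g \<Rightarrow> bool"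
  where "even_sl2_triple e h f \<longleftrightarrow> e \<in> gr 0 \<and> h \<in> gr 0 \<and> f \<in> gr 0 \<and>
    bracket h e = 2 *\<^sub>C e \<and> bracket h f = - (2 *\<^sub>C f) \<and> bracket e f = h"

definition eigenspace :: "'g::lie_superalgebra \<Rightarrow> int \<Rightarrow> 'g set"
  where "eigenspace h i = {x. bracket h x = of_int i *\<^sub>C x}"


section \<open>The universal enveloping superalgebra\<close>

text \<open>Noncommutative monomials.  They are a copy of lists, made into a monoid under concatenation, so
  that \<open>'a ncmon \<Rightarrow>\<^sub>0 complex\<close> is the free associative algebra on the set \<open>'a\<close>.\<close>

datatype 'a ncmon = NCMon (letters: "'a list")

instantiation ncmon :: (type) monoid_add
begin

definition zero_ncmon :: "'a ncmon" where "0 = NCMon []"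

definition plus_ncmon :: "'a ncmon \<Rightarrow> 'a ncmon \<Rightarrow> 'a ncmon"
  where "v + w = NCMon (letters v @ letters w)"

instance
  by standard (auto simp: zero_ncmon_def plus_ncmon_def)

end

type_synonym 'a free_algebra = "'a ncmon \<Rightarrow>\<^sub>0 complex"

definition gen :: "'a \<Rightarrow> 'a free_algebra"
  where "gen x = Poly_Mapping.single (NCMon [x]) 1"

definition const :: "complex \<Rightarrow> 'a free_algebra"
  where "const c = Poly_Mapping.single 0 c"

definition two_sided_ideal :: "'r::ring_1 set \<Rightarrow> bool"
  where "two_sided_ideal J \<longleftrightarrow>
    0 \<in> J \<and> (\<forall>x\<in>J. \<forall>y\<in>J. x + y \<in> J) \<and> (\<forall>x\<in>J. \<forall>r. r * x \<in> J \<and> x * r \<in> J)"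

text \<open>The generators of the free algebra are \<^emph>\<open>all\<close> elements of \<open>'g\<close>, hence the
  linearity relations.\<close>

definition uea_relations :: "'g::lie_superalgebra free_algebra set"
  where "uea_relations =
    {gen (x + y) - gen x - gen y |x y. True} \<union>
    {gen (c *\<^sub>C x) - const c * gen x |c x. True} \<union>
    {gen x * gen y - const (ksign p q) * (gen y * gen x) - gen (bracket x y) |p q x y.
       x \<in> gr p \<and> y \<in> gr q}"

definition uea_ideal :: "'g::lie_superalgebra free_algebra set"
  where "uea_ideal = two_sided_ideal hull uea_relations"

lemma two_sided_ideal_uea_ideal: "two_sided_ideal uea_ideal"
  unfolding uea_ideal_def by (rule hull_in) (auto simp: two_sided_ideal_def)

lemma uea_ideal_zero: "0 \<in> uea_ideal"
  and uea_ideal_add: "p \<in> uea_ideal \<Longrightarrow> q \<in> uea_ideal \<Longrightarrow> p + q \<in> uea_ideal"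
  and uea_ideal_mult_left: "p \<in> uea_ideal \<Longrightarrow> r * p \<in> uea_ideal"
  and uea_ideal_mult_right: "p \<in> uea_ideal \<Longrightarrow> p * r \<in> uea_ideal"
  using two_sided_ideal_uea_ideal unfolding two_sided_ideal_def by blast+

lemma uea_ideal_uminus: "p \<in> uea_ideal \<Longrightarrow> - p \<in> uea_ideal"
  using uea_ideal_mult_left[of p "-1"] by simp

lemma uea_ideal_diff: "p \<in> uea_ideal \<Longrightarrow> q \<in> uea_ideal \<Longrightarrow> p - q \<in> uea_ideal"
  using uea_ideal_add[of p "- q"] uea_ideal_uminus[of q] by simp

lemma lookup_mult_0:
  fixes p q :: "'a free_algebra"
  shows "Poly_Mapping.lookup (p * q) 0 = Poly_Mapping.lookup p 0 * Poly_Mapping.lookup q 0"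
proof -
  have *: "l + k = 0 \<longleftrightarrow> l = 0 \<and> k = 0" for l k :: "'a ncmon"
    by (cases l; cases k) (auto simp: zero_ncmon_def plus_ncmon_def)
  have inner: "(\<Sum>k. Poly_Mapping.lookup q k when l + k = 0) = (Poly_Mapping.lookup q 0 when l = 0)" for l
    by (cases "l = 0") (simp_all add: *)
  show ?thesis
    by (simp add: lookup_mult inner mult_when eq_commute[of 0])
qed

lemma lookup_gen_0: "Poly_Mapping.lookup (gen x) 0 = 0"
  by (simp add: gen_def lookup_single zero_ncmon_def)

lemma one_notin_uea_ideal: "1 \<notin> (uea_ideal :: 'g::lie_superalgebra free_algebra set)"
proof -
  have "uea_ideal \<subseteq> {p :: 'g free_algebra. Poly_Mapping.lookup p 0 = 0}"
    unfolding uea_ideal_def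
    by (rule hull_minimal)
       (auto simp: two_sided_ideal_def uea_relations_def lookup_mult_0 lookup_add lookup_minus
          lookup_gen_0)
  then show ?thesis
    by (auto simp: lookup_one)
qed

quotient_type (overloaded) 'g uea = "'g::lie_superalgebra free_algebra" / "\<lambda>p q. p - q \<in> uea_ideal"
proof (rule equivpI)
  show "reflp (\<lambda>p q :: 'g free_algebra. p - q \<in> uea_ideal)"
    by (rule reflpI) (simp add: uea_ideal_zero)
  show "symp (\<lambda>p q :: 'g free_algebra. p - q \<in> uea_ideal)"
    using uea_ideal_uminus by (intro sympI) force
  show "transp (\<lambda>p q :: 'g free_algebra. p - q \<in> uea_ideal)"
    using uea_ideal_add by (intro transpI) force
qed

instantiation uea :: (lie_superalgebra) ring_1
begin

lift_definition zero_uea :: "'a uea" is 0 .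
lift_definition one_uea :: "'a uea" is 1 .
lift_definition plus_uea :: "'a uea \<Rightarrow> 'a uea \<Rightarrow> 'a uea" is "(+)"
  using uea_ideal_add by (simp add: add_diff_add)
lift_definition uminus_uea :: "'a uea \<Rightarrow> 'a uea" is uminus
proof -
  fix p p' :: "'a free_algebra"
  assume "p - p' \<in> uea_ideal"
  then show "- p - - p' \<in> uea_ideal"
    using uea_ideal_uminus[of "p - p'"] by simp
qed
lift_definition minus_uea :: "'a uea \<Rightarrow> 'a uea \<Rightarrow> 'a uea" is "(-)"
proof -
  fix p p' q q' :: "'a free_algebra"
  assume "p - p' \<in> uea_ideal" "q - q' \<in> uea_ideal"
  then show "p - q - (p' - q') \<in> uea_ideal"
    using uea_ideal_diff[of "p - p'" "q - q'"] by (simp add: algebra_simps)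
qed
lift_definition times_uea :: "'a uea \<Rightarrow> 'a uea \<Rightarrow> 'a uea" is "(*)"
proof -
  fix p p' q q' :: "'a free_algebra"
  assume "p - p' \<in> uea_ideal" "q - q' \<in> uea_ideal"
  then have "(p - p') * q + p' * (q - q') \<in> uea_ideal"
    by (intro uea_ideal_add uea_ideal_mult_left uea_ideal_mult_right)
  then show "p * q - p' * q' \<in> uea_ideal"
    by (simp add: algebra_simps)
qed

instance
proof
  show "(0 :: 'a uea) \<noteq> 1"
  proof transfer
    show "(0 :: 'a free_algebra) - 1 \<notin> uea_ideal"
      using one_notin_uea_ideal uea_ideal_uminus[of "0 - 1 :: 'a free_algebra"] by auto
  qed
qed (transfer, simp add: algebra_simps uea_ideal_zero)+

end

text \<open>Scalars act through the constants of the free algebra.\<close>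

instantiation uea :: (lie_superalgebra) cvector
begin

lift_definition scaleC_uea :: "complex \<Rightarrow> 'a uea \<Rightarrow> 'a uea" is "\<lambda>c p. const c * p"
  using uea_ideal_mult_left by (metis right_diff_distrib)

instance
proof
  fix c d :: complex and x y :: "'a uea"
  show "c *\<^sub>C (x + y) = c *\<^sub>C x + c *\<^sub>C y"
    by transfer (simp add: algebra_simps uea_ideal_zero)
  show "(c + d) *\<^sub>C x = c *\<^sub>C x + d *\<^sub>C x"
    by transfer (simp add: const_def single_add algebra_simps uea_ideal_zero)
  show "c *\<^sub>C d *\<^sub>C x = (c * d) *\<^sub>C x"
    by transfer (simp add: const_def mult_single uea_ideal_zero flip: mult.assoc)
  show "1 *\<^sub>C x = x"
    by transfer (simp add: const_def uea_ideal_zero)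
qed

end

lift_definition emb :: "'g::lie_superalgebra \<Rightarrow> 'g uea" is gen .

lemma free_algebra_induct:
  assumes single: "\<And>w c. P (Poly_Mapping.single w c)"
    and add: "\<And>p q. P p \<Longrightarrow> P q \<Longrightarrow> P (p + q)"
  shows "P (p :: 'a free_algebra)"
proof -
  have "P (\<Sum>w\<in>K. Poly_Mapping.single w (Poly_Mapping.lookup p w))" if "finite K" for K
    using that
  proof induction
    case empty
    show ?case using single[of 0 0] by simp
  next
    case (insert w K)
    then show ?case by (simp add: single add)
  qed
  from this[OF finite_keys]
  have "P (\<Sum>w\<in>Poly_Mapping.keys p. Poly_Mapping.single w (Poly_Mapping.lookup p w))" .
  also have "(\<Sum>w\<in>Poly_Mapping.keys p. Poly_Mapping.single w (Poly_Mapping.lookup p w)) = p"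
    by (rule poly_mapping_eqI) (auto simp: lookup_sum lookup_single when_def in_keys_iff)
  finally show ?thesis .
qed

lemma gr_decomposeE:
  fixes x :: "'a::superspace"
  obtains y z where "y \<in> gr 0" "z \<in> gr 1" "x = y + z"
  using gr_decompose[of x] by blast

definition parity_inv :: "'a::superspace \<Rightarrow> 'a"
  where "parity_inv x = homogeneous_part 0 x - homogeneous_part 1 x"

lemma homogeneous_part_eq:
  "y \<in> gr p \<Longrightarrow> x - y \<in> gr (p + 1) \<Longrightarrow> homogeneous_part p x = y"
  unfolding homogeneous_part_def using homogeneous_part_unique[of p x] by (intro the_equality) auto

lemma parity_inv_eq:
  assumes "y \<in> gr 0" "z \<in> gr 1"
  shows "parity_inv (y + z) = y - z"
  unfolding parity_inv_def
  using homogeneous_part_eq[of y 0 "y + z"] homogeneous_part_eq[of z 1 "y + z"] assms by simp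

lemma parity_inv_homogeneous: "x \<in> gr p \<Longrightarrow> parity_inv x = ksign p p *\<^sub>C x"
  using parity_inv_eq[of x 0] parity_inv_eq[of 0 x]
  by (cases p) (simp_all add: gr_zero ksign_def)

lemma parity_inv_gr: "x \<in> gr p \<Longrightarrow> parity_inv x \<in> gr p"
  by (simp add: parity_inv_homogeneous gr_scaleC)

lemma parity_inv_add: "parity_inv (x + y) = parity_inv x + parity_inv y"
proof -
  obtain x0 x1 y0 y1 where *: "x0 \<in> gr 0" "x1 \<in> gr 1" "x = x0 + x1" "y0 \<in> gr 0" "y1 \<in> gr 1" "y = y0 + y1"
    using gr_decompose by metis
  have eq: "x + y = (x0 + y0) + (x1 + y1)"
    using * by simp
  have "parity_inv (x + y) = (x0 + y0) - (x1 + y1)"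
    unfolding eq by (rule parity_inv_eq) (simp_all add: * gr_add)
  moreover have "parity_inv x = x0 - x1" "parity_inv y = y0 - y1"
    using * by (simp_all add: parity_inv_eq)
  ultimately show ?thesis
    by simp
qed

lemma parity_inv_scaleC: "parity_inv (c *\<^sub>C x) = c *\<^sub>C parity_inv x"
proof -
  obtain x0 x1 where *: "x0 \<in> gr 0" "x1 \<in> gr 1" "x = x0 + x1"
    by (rule gr_decomposeE)
  have "parity_inv (c *\<^sub>C x) = c *\<^sub>C x0 - c *\<^sub>C x1"
    unfolding *(3) scaleC_add_right by (intro parity_inv_eq gr_scaleC *)
  also have "\<dots> = c *\<^sub>C parity_inv x"
    unfolding *(3) parity_inv_eq[OF *(1,2)] by (rule cvec.scale_right_diff_distrib[symmetric])
  finally show ?thesis .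
qed

lemma parity_inv_parity_inv: "parity_inv (parity_inv x) = x"
proof -
  obtain x0 x1 where *: "x0 \<in> gr 0" "x1 \<in> gr 1" "x = x0 + x1"
    by (rule gr_decomposeE)
  have "- x1 \<in> gr 1"
    using gr_scaleC[OF *(2), of "-1"] by (simp only: cvec.scale_minus_left scaleC_one)
  then have "parity_inv (x0 + - x1) = x0 - - x1"
    by (rule parity_inv_eq[OF *(1)])
  then have "parity_inv (x0 - x1) = x0 + x1"
    by (simp only: diff_conv_add_uminus minus_minus)
  then show ?thesis
    by (simp only: *(3) parity_inv_eq[OF *(1,2)])
qed

lemma parity_inv_bracket:
  assumes "x \<in> gr p" "y \<in> gr q"
  shows "parity_inv (bracket x y) = bracket (parity_inv x) (parity_inv y)"
proof -
  have sign: "ksign (p + q) (p + q) = ksign p p * ksign q q"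
    by (cases p; cases q) (simp_all add: ksign_def)
  show ?thesis
    unfolding parity_inv_homogeneous[OF assms(1)] parity_inv_homogeneous[OF assms(2)]
      parity_inv_homogeneous[OF bracket_gr[OF assms]] sign bracket_scaleC_left bracket_scaleC_right
      scaleC_scaleC by (simp only: mult.commute)
qed

text \<open>The parity automorphism of the free algebra, and its descent to the enveloping algebra.\<close>

definition free_parity_inv :: "'g::superspace free_algebra \<Rightarrow> 'g free_algebra"
  where "free_parity_inv = Poly_Mapping.map_key (map_ncmon parity_inv)"

lemma map_ncmon_parity_inv: "map_ncmon parity_inv (map_ncmon parity_inv w) = w"
  by (cases w) (simp add: parity_inv_parity_inv o_def)

lemma inj_map_ncmon_parity_inv: "inj (map_ncmon (parity_inv :: 'a \<Rightarrow> 'a::superspace))"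
  by (rule inj_on_inverseI[of _ "map_ncmon parity_inv"]) (rule map_ncmon_parity_inv)

lemma free_parity_inv_single:
  "free_parity_inv (Poly_Mapping.single w c) = Poly_Mapping.single (map_ncmon parity_inv w) c"
  using map_key_single[OF inj_map_ncmon_parity_inv, of "map_ncmon parity_inv w" c]
  by (simp add: free_parity_inv_def map_ncmon_parity_inv)

lemma free_parity_inv_add: "free_parity_inv (p + q) = free_parity_inv p + free_parity_inv q"
  unfolding free_parity_inv_def by (rule map_key_plus[OF inj_map_ncmon_parity_inv])

lemma free_parity_inv_zero: "free_parity_inv 0 = 0"
  using free_parity_inv_single[of 0 0] by simp

lemma free_parity_inv_diff: "free_parity_inv (p - q) = free_parity_inv p - free_parity_inv q"
  using free_parity_inv_add[of "p - q" q] by simp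

lemma free_parity_inv_gen: "free_parity_inv (gen x) = gen (parity_inv x)"
  by (simp add: gen_def free_parity_inv_single)

lemma free_parity_inv_const: "free_parity_inv (const c) = const c"
  by (simp add: const_def free_parity_inv_single zero_ncmon_def)

lemma free_parity_inv_one: "free_parity_inv 1 = 1"
  using free_parity_inv_const[of 1] by (simp add: const_def)

lemma map_ncmon_plus: "map_ncmon f (v + w) = map_ncmon f v + map_ncmon f w"
  by (cases v; cases w) (simp add: plus_ncmon_def)

lemma free_parity_inv_mult: "free_parity_inv (p * q) = free_parity_inv p * free_parity_inv q"
proof (induction p rule: free_algebra_induct)
  case (1 v c)
  show ?case
    by (induction q rule: free_algebra_induct)
       (simp_all add: mult_single free_parity_inv_single free_parity_inv_add map_ncmon_plus
          distrib_left)
qed (simp add: free_parity_inv_add distrib_right)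

lemma free_parity_inv_uea_ideal:
  assumes "p \<in> uea_ideal"
  shows "free_parity_inv p \<in> uea_ideal"
proof -
  have rel: "uea_relations \<subseteq> (uea_ideal :: 'a free_algebra set)"
    unfolding uea_ideal_def by (rule hull_subset)
  have "free_parity_inv r \<in> uea_relations" if "r \<in> uea_relations" for r :: "'a free_algebra"
    using that unfolding uea_relations_def
    by (auto simp: free_parity_inv_diff free_parity_inv_gen free_parity_inv_mult
          free_parity_inv_const parity_inv_add parity_inv_scaleC parity_inv_bracket)
       (use parity_inv_gr in blast)+
  then have "uea_ideal \<subseteq> {p :: 'a free_algebra. free_parity_inv p \<in> uea_ideal}"
    unfolding uea_ideal_def
    by (intro hull_minimal) (use rel in \<open>auto simp: two_sided_ideal_def free_parity_inv_zero
      free_parity_inv_add free_parity_inv_mult uea_ideal_zero uea_ideal_add uea_ideal_mult_left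
      uea_ideal_mult_right simp flip: uea_ideal_def\<close>)
  then show ?thesis
    using assms by blast
qed

lift_definition uea_parity_inv :: "'g::lie_superalgebra uea \<Rightarrow> 'g uea" is free_parity_inv
  using free_parity_inv_uea_ideal by (metis free_parity_inv_diff)

lemma uea_parity_inv_add: "uea_parity_inv (x + y) = uea_parity_inv x + uea_parity_inv y"
  by transfer (simp add: free_parity_inv_add uea_ideal_zero)

lemma uea_parity_inv_mult: "uea_parity_inv (x * y) = uea_parity_inv x * uea_parity_inv y"
  by transfer (simp add: free_parity_inv_mult uea_ideal_zero)

lemma uea_parity_inv_one: "uea_parity_inv 1 = 1"
  by transfer (simp add: free_parity_inv_one uea_ideal_zero)

lemma uea_parity_inv_zero: "uea_parity_inv 0 = 0"
  by transfer (simp add: free_parity_inv_zero uea_ideal_zero)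

lemma uea_parity_inv_scaleC: "uea_parity_inv (c *\<^sub>C x) = c *\<^sub>C uea_parity_inv x"
  by transfer (simp add: free_parity_inv_mult free_parity_inv_const uea_ideal_zero)

lemma uea_parity_inv_emb: "uea_parity_inv (emb x) = emb (parity_inv x)"
  by transfer (simp add: free_parity_inv_gen uea_ideal_zero)

lemma emb_add: "emb (x + y) = emb x + emb y"
proof transfer
  fix x y :: 'a
  have "gen (x + y) - gen x - gen y \<in> uea_relations"
    unfolding uea_relations_def by blast
  then show "gen (x + y) - (gen x + gen y) \<in> uea_ideal"
    unfolding uea_ideal_def by (metis diff_diff_eq hull_inc)
qed

lemma emb_scaleC: "emb (c *\<^sub>C x) = c *\<^sub>C emb x"
proof transfer
  fix x :: 'a and c
  have "gen (c *\<^sub>C x) - const c * gen x \<in> uea_relations"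
    unfolding uea_relations_def by blast
  then show "gen (c *\<^sub>C x) - const c * gen x \<in> uea_ideal"
    unfolding uea_ideal_def by (metis hull_inc)
qed

lemma const_commute: "const c * p = p * const c"
  by (induction p rule: free_algebra_induct)
     (simp_all add: const_def mult_single distrib_left distrib_right mult.commute)

lemma scaleC_mult_left: "(c *\<^sub>C x) * y = c *\<^sub>C (x * y)" for x y :: "'g::lie_superalgebra uea"
  by transfer (simp add: mult.assoc uea_ideal_zero)

lemma scaleC_mult_right: "x * (c *\<^sub>C y) = c *\<^sub>C (x * y)" for x y :: "'g::lie_superalgebra uea"
  by transfer (simp add: const_commute mult.assoc uea_ideal_zero)

lemma emb_supercommutes:
  assumes "x \<in> gr p" "y \<in> gr q"
  shows "emb x * emb y - ksign p q *\<^sub>C (emb y * emb x) = emb (bracket x y)"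
  using assms
proof transfer
  fix x y :: 'a and p q
  assume "x \<in> gr p" "y \<in> gr q"
  then have "gen x * gen y - const (ksign p q) * (gen y * gen x) - gen (bracket x y) \<in> uea_relations"
    unfolding uea_relations_def by blast
  then show "gen x * gen y - const (ksign p q) * (gen y * gen x) - gen (bracket x y) \<in> uea_ideal"
    unfolding uea_ideal_def by (metis hull_inc)
qed

lemma uea_induct:
  assumes scale: "\<And>c xs. P (c *\<^sub>C prod_list (map emb xs))"
    and add: "\<And>x y. P x \<Longrightarrow> P y \<Longrightarrow> P (x + y)"
  shows "P (x :: 'g::lie_superalgebra uea)"
proof -
  have gens: "prod_list (map gen xs) = (Poly_Mapping.single (NCMon xs) 1 :: 'g free_algebra)" for xs
  proof (induction xs)
    case Nil
    show ?case by (simp add: single_one flip: zero_ncmon_def)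
  next
    case (Cons x xs)
    then show ?case by (simp add: gen_def mult_single plus_ncmon_def)
  qed
  have abs: "abs_uea (prod_list (map gen xs)) = prod_list (map emb xs)" for xs :: "'g list"
    by (induction xs) (simp_all add: one_uea.abs_eq times_uea.abs_eq[symmetric] emb.abs_eq)
  have "P (abs_uea p)" for p
  proof (induction p rule: free_algebra_induct)
    case (1 w c)
    have "Poly_Mapping.single w c = const c * prod_list (map gen (letters w))"
      by (simp add: gens const_def mult_single)
    then show ?case
      using scale[of c "letters w"] by (simp add: scaleC_uea.abs_eq flip: abs)
  next
    case (2 p q)
    then show ?case using add by (simp flip: plus_uea.abs_eq)
  qed
  then show ?thesis
    by (metis Quotient_uea Quotient_abs_rep)
qed

instantiation uea :: (lie_superalgebra) superspace
begin

definition gr_uea :: "bit \<Rightarrow> 'a uea set"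
  where "gr_uea p = cspan {prod_list (map emb xs) |xs ps.
    list_all2 (\<lambda>x q. x \<in> gr q) xs ps \<and> sum_list ps = p}"

instance
proof
  fix p and x y :: "'a uea" and c
  show "0 \<in> (gr p :: 'a uea set)"
    unfolding gr_uea_def by (rule cvec.span_zero)
  show "x + y \<in> gr p" if "x \<in> gr p" "y \<in> gr p"
    using that unfolding gr_uea_def by (rule cvec.span_add)
  show "c *\<^sub>C x \<in> gr p" if "x \<in> gr p"
    using that unfolding gr_uea_def by (rule cvec.span_scale)
next
  have prod: "uea_parity_inv (prod_list (map emb xs)) =
      ksign (sum_list ps) (sum_list ps) *\<^sub>C prod_list (map emb xs)"
    if "list_all2 (\<lambda>x q. x \<in> gr q) xs ps" for xs :: "'a list" and ps
    using that
  proof (induction rule: list_all2_induct)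
    case Nil
    show ?case by (simp add: uea_parity_inv_one ksign_def)
  next
    case (Cons x xs q ps)
    have "ksign (q + r) (q + r) = ksign q q * ksign r r" for r
      by (cases q; cases r) (simp_all add: ksign_def)
    then show ?case
      using Cons by (simp add: uea_parity_inv_mult uea_parity_inv_emb parity_inv_homogeneous
          emb_scaleC scaleC_mult_left scaleC_mult_right)
  qed
  have sign: "uea_parity_inv x = ksign p p *\<^sub>C x" if "x \<in> gr p" for p and x :: "'a uea"
    using that unfolding gr_uea_def
  proof (induction rule: cvec.span_induct)
    case base
    show ?case unfolding cvec.subspace_def
      by (auto simp: uea_parity_inv_zero uea_parity_inv_add uea_parity_inv_scaleC
          scaleC_add_right mult.commute)
  next
    case (step x)
    then show ?case using prod by blast
  qed
  show "gr 0 \<inter> gr 1 = {0 :: 'a uea}"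
  proof (intro equalityI subsetI)
    fix x :: "'a uea" assume "x \<in> gr 0 \<inter> gr 1"
    then have "x = - x"
      using sign[of x 0] sign[of x 1] by (simp add: ksign_def)
    then have "(2::complex) *\<^sub>C x = 0"
      using scaleC_add_left[of 1 1 x] by (metis add.right_inverse one_add_one scaleC_one)
    then show "x \<in> {0}"
      by simp
  next
    fix x :: "'a uea" assume "x \<in> {0}"
    then show "x \<in> gr 0 \<inter> gr 1"
      by (simp add: gr_uea_def cvec.span_zero)
  qed
next
  fix x :: "'a uea"
  have add: "a + b \<in> gr p" if "a \<in> gr p" "b \<in> gr p" for a b :: "'a uea" and p
    using that unfolding gr_uea_def by (rule cvec.span_add)
  have scale: "c *\<^sub>C a \<in> gr p" if "a \<in> gr p" for a :: "'a uea" and p c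
    using that unfolding gr_uea_def by (rule cvec.span_scale)
  have mult: "emb a * b \<in> gr (p + q)" if a: "a \<in> gr p" and b: "b \<in> gr q" for a and b :: "'a uea" and p q
    using b unfolding gr_uea_def
  proof (induction rule: cvec.span_induct)
    case base
    show ?case unfolding cvec.subspace_def
      by (auto simp: distrib_left scaleC_mult_right intro: cvec.span_zero cvec.span_add cvec.span_scale)
  next
    case (step b)
    then obtain xs ps where "b = prod_list (map emb xs)" "list_all2 (\<lambda>x q. x \<in> gr q) xs ps" "sum_list ps = q"
      by blast
    then show ?case using a
      by (intro cvec.span_base CollectI exI[of _ "a # xs"] exI[of _ "p # ps"]) auto
  qed
  have "\<exists>y\<in>gr 0. \<exists>z\<in>gr 1. prod_list (map emb xs) = y + z" for xs :: "'a list"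
  proof (induction xs)
    case Nil
    have "1 \<in> (gr 0 :: 'a uea set)" unfolding gr_uea_def
      by (intro cvec.span_base CollectI exI[of _ "[]"]) auto
    moreover have "0 \<in> (gr 1 :: 'a uea set)"
      unfolding gr_uea_def by (rule cvec.span_zero)
    ultimately show ?case by force
  next
    case (Cons x xs)
    then obtain y z where yz: "y \<in> gr 0" "z \<in> gr 1" "prod_list (map emb xs) = y + z"
      by blast
    obtain x0 x1 where x: "x0 \<in> gr 0" "x1 \<in> gr 1" "x = x0 + x1"
      by (rule gr_decomposeE)
    have "emb x0 * y + emb x1 * z \<in> gr 0"
      using add mult[OF x(1) yz(1)] mult[OF x(2) yz(2)] by simp
    moreover have "emb x1 * y + emb x0 * z \<in> gr 1"
      using add mult[OF x(2) yz(1)] mult[OF x(1) yz(2)] by simp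
    moreover have "prod_list (map emb (x # xs)) =
        (emb x0 * y + emb x1 * z) + (emb x1 * y + emb x0 * z)"
      using x yz by (simp add: emb_add algebra_simps)
    ultimately show ?case by blast
  qed
  then show "\<exists>y\<in>gr 0. \<exists>z\<in>gr 1. x = y + z"
  proof (induction x rule: uea_induct)
    case (1 c xs)
    then show ?case using scale scaleC_add_right by metis
  next
    case (2 x y)
    obtain x0 x1 y0 y1 where "x0 \<in> gr 0" "x1 \<in> gr 1" "x = x0 + x1" "y0 \<in> gr 0" "y1 \<in> gr 1" "y = y0 + y1"
      using 2 by blast
    then have "x0 + y0 \<in> gr 0" "x1 + y1 \<in> gr 1" "x + y = (x0 + y0) + (x1 + y1)"
      using add by simp_all
    then show ?case by blast
  qed
qed

end


section \<open>Finite W-superalgebras\<close>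

definition left_ideal :: "'r::ring_1 set \<Rightarrow> bool"
  where "left_ideal L \<longleftrightarrow> 0 \<in> L \<and> (\<forall>x\<in>L. \<forall>y\<in>L. x + y \<in> L) \<and> (\<forall>r. \<forall>x\<in>L. r * x \<in> L)"

text \<open>The left ideal of the enveloping algebra generated by \<open>x - \<chi>(x)\<close>, \<open>x \<in> S\<close>.\<close>

definition character_ideal :: "('g::lie_superalgebra \<Rightarrow> complex) \<Rightarrow> 'g set \<Rightarrow> 'g uea set"
  where "character_ideal \<chi> S = left_ideal hull {emb x - \<chi> x *\<^sub>C 1 |x. x \<in> S}"

text \<open>The algebra of \<open>ad S\<close>-invariant cosets of the left ideal \<open>I\<close>.  As for \<^const>\<open>FactRing\<close>, the
  operations on cosets are defined by a union over all representatives; on the carrier the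
  cosets in these unions coincide, for the ideals \<open>I\<close> and subspaces \<open>S\<close> considered below.\<close>

definition invariant_algebra :: "'g::lie_superalgebra uea set \<Rightarrow> 'g set \<Rightarrow> (complex, 'g uea set) module"
  where "invariant_algebra I S =
    \<lparr>carrier = {y +o I |y. \<forall>a\<in>S. supercommutator (emb a) y \<in> I},
     monoid.mult = (\<lambda>X Y. \<Union>x\<in>X. \<Union>y\<in>Y. (x * y) +o I),
     one = 1 +o I,
     zero = 0 +o I,
     add = (\<lambda>X Y. \<Union>x\<in>X. \<Union>y\<in>Y. (x + y) +o I),
     smult = (\<lambda>c X. \<Union>x\<in>X. (c *\<^sub>C x) +o I)\<rparr>"

definition kazhdan :: "'g::lie_superalgebra \<Rightarrow> int \<Rightarrow> 'g uea set"
  where "kazhdan h i = cspan {prod_list (map emb xs) |xs js.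
    list_all2 (\<lambda>x j. x \<in> eigenspace h j) xs js \<and> sum_list (map (\<lambda>j. j + 2) js) \<le> i}"

definition coset_part :: "'g::lie_superalgebra uea set \<Rightarrow> 'g set \<Rightarrow> 'g uea set \<Rightarrow> 'g uea set set"
  where "coset_part I S V = {y +o I |y. y \<in> V} \<inter> carrier (invariant_algebra I S)"

text \<open>Isomorphisms, in the super sense, of Kazhdan filtered algebras.\<close>

definition kazhdan_isomorphism ::
    "'g::lie_superalgebra \<Rightarrow> 'g uea set \<Rightarrow> 'g set \<Rightarrow> 'g uea set \<Rightarrow> 'g set
      \<Rightarrow> ('g uea set \<Rightarrow> 'g uea set) \<Rightarrow> bool"
  where "kazhdan_isomorphism h I S I' S' \<phi> \<longleftrightarrow>
    \<phi> \<in> ring_iso (invariant_algebra I S) (invariant_algebra I' S') \<and>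
    (\<forall>c. \<forall>X\<in>carrier (invariant_algebra I S).
       \<phi> (c \<odot>\<^bsub>invariant_algebra I S\<^esub> X) = c \<odot>\<^bsub>invariant_algebra I' S'\<^esub> \<phi> X) \<and>
    (\<forall>p. \<phi> ` coset_part I S (gr p) = coset_part I' S' (gr p)) \<and>
    (\<forall>i. \<phi> ` coset_part I S (kazhdan h i) = coset_part I' S' (kazhdan h i))"

text \<open>The subspaces $\mathfrak m$, $\mathfrak m'$, $\bigoplus_{i\le-2}\mathfrak g(i)$ and
  $\mathfrak n$ of $\mathfrak g$.\<close>

definition eigenspaces_upto :: "'g::lie_superalgebra \<Rightarrow> int \<Rightarrow> 'g set"
  where "eigenspaces_upto h k = cspan (\<Union>i\<in>{..k}. eigenspace h i)"

definition m_space ::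
    "'g::lie_superalgebra \<Rightarrow> (nat \<Rightarrow> 'g) \<Rightarrow> nat \<Rightarrow> (nat \<Rightarrow> 'g) \<Rightarrow> nat \<Rightarrow> 'g set"
  where "m_space h u s v r = cspan (eigenspaces_upto h (- 2)
    \<union> u ` {s div 2 + 1..s}
    \<union> v ` (if even r then {r div 2 + 1..r} else {(r + 3) div 2..r}))"

definition m'_space ::
    "'g::lie_superalgebra \<Rightarrow> (nat \<Rightarrow> 'g) \<Rightarrow> nat \<Rightarrow> (nat \<Rightarrow> 'g) \<Rightarrow> nat \<Rightarrow> 'g set"
  where "m'_space h u s v r =
    (if even r then m_space h u s v r
     else cspan (m_space h u s v r \<union> {v ((r + 1) div 2)}))"

definition n_space :: "'g::lie_superalgebra \<Rightarrow> 'g set"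
  where "n_space h = eigenspaces_upto h (- 1)"

end

(* Let I be the left ideal generated by x - chi(x) for x of degree at most -2.  The ideal I_chi
   contains I, and J = I_chi / I is spanned by right multiples of a Lagrangian subspace l of g(-1).
   The natural map from the n-invariants modulo I to the m'-invariants modulo I_chi is inverted as
   follows.

   Each basis vector x_k of m' has a partner y_k, homogeneous of opposite degree minus 2, with
   chi([x_j, y_k]) = delta_jk.  Up to lower terms of the Kazhdan filtration, multiplication by y_k
   is a coordinate for which ad x_k is the derivative, so a Poincare lemma, proved one coordinate at
   a time starting with the lowest degrees, kills the cocycle x |-> ad x (q) in J.  No PBW basis is
   needed: it suffices that the induced filtration vanishes in negative degrees.  The vectors of
   g(-1) dual to l are then treated in the same way, now with right multiplication by l as exact
   coordinates; these coordinates also show that an n-invariant element of J vanishes. *)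

theory Submission
  imports Defs "HOL-Computational_Algebra.Fundamental_Theorem_Algebra"
begin

text \<open>The two stages of the inversion cannot be merged. J is stable under ad x for x in m',
  because chi([x, l]) = 0, and this makes the Poincare lemma available inside J. It is not stable
  under the vectors dual to l, which pair nontrivially with l. For these the primitive is sought in
  all of U(g)/I, and it falls into J because a product with an element of l as its right factor
  always does. The middle odd vector pairs to zero with l and so belongs to the first stage.

  The order of the coordinates in the first stage is forced. Commuting ad x_j with ad x_k produces
  ad [x_j, x_k], which has lower degree and must be under control already; and multiplication by
  [x_j, y_k] is the scalar chi plus a derivative modulo I only when its degree is at most -2.

  Quotients appear only at the end: until then everything is a congruence modulo a left ideal of
  U(g), and the parity automorphism carries the signs of inhomogeneous elements. The sl2-triple
  enters through three facts on ad h and ad e, obtained from the nilpotency of e by highest weight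
  arguments.\<close>

declare add_bit_eq_xor [simp del]

abbreviation clinear :: "('a::cvector \<Rightarrow> 'b::cvector) \<Rightarrow> bool"
  where "clinear \<equiv> module_hom scaleC scaleC"

lemma clinearI:
  assumes "\<And>x y. T (x + y) = T x + T y" and "\<And>c x. T (c *\<^sub>C x) = c *\<^sub>C T x"
  shows "clinear T"
  using assms by unfold_locales simp_all

section \<open>Polynomials in an operator\<close>

definition polyop :: "('a::cvector \<Rightarrow> 'a) \<Rightarrow> complex poly \<Rightarrow> 'a \<Rightarrow> 'a"
  where "polyop T p v = (\<Sum>i\<le>degree p. coeff p i *\<^sub>C (T ^^ i) v)"

lemma polyop_bound:
  assumes "degree p \<le> n"
  shows "polyop T p v = (\<Sum>i\<le>n. coeff p i *\<^sub>C (T ^^ i) v)"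
  unfolding polyop_def
  by (rule sum.mono_neutral_left) (use assms in \<open>auto simp: coeff_eq_0\<close>)

lemma polyop_0 [simp]: "polyop T 0 v = 0"
  by (simp add: polyop_def)

lemma polyop_add: "polyop T (p + q) v = polyop T p v + polyop T q v"
proof -
  define n where "n = max (degree p) (degree q)"
  have "degree p \<le> n" "degree q \<le> n" "degree (p + q) \<le> n"
    by (auto simp: n_def degree_add_le)
  then show ?thesis
    by (simp add: polyop_bound[of _ n] scaleC_add_left sum.distrib)
qed

lemma polyop_pCons:
  assumes "clinear T"
  shows "polyop T (pCons a p) v = a *\<^sub>C v + T (polyop T p v)"
proof -
  have "polyop T (pCons a p) v = (\<Sum>i\<le>Suc (degree p). coeff (pCons a p) i *\<^sub>C (T ^^ i) v)"
    by (rule polyop_bound) (simp add: degree_pCons_le)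
  also have "\<dots> = a *\<^sub>C v + (\<Sum>i\<le>degree p. coeff p i *\<^sub>C T ((T ^^ i) v))"
    by (subst sum.atMost_Suc_shift) simp
  finally show ?thesis
    by (simp add: polyop_def module_hom.sum[OF assms] module_hom.scale[OF assms])
qed

lemma clinear_polyop: "clinear T \<Longrightarrow> clinear (polyop T p)"
proof (induction p)
  case (pCons a p)
  then show ?case
    by (intro clinearI) (simp_all add: polyop_pCons module_hom.add[of _ _ T] module_hom.scale[of _ _ T]
      module_hom.add[of _ _ "polyop T p"] module_hom.scale[of _ _ "polyop T p"] scaleC_add_right mult.commute)
qed (simp add: clinearI)

lemma polyop_smult: "clinear T \<Longrightarrow> polyop T (smult c p) v = c *\<^sub>C polyop T p v"
  by (induction p) (simp_all add: polyop_pCons module_hom.scale[of _ _ T] scaleC_add_right)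

lemma polyop_mult:
  "clinear T \<Longrightarrow> polyop T (p * q) v = polyop T p (polyop T q v)"
  by (induction p) (simp_all add: polyop_pCons polyop_add polyop_smult)

lemma polyop_eigenvector:
  "clinear T \<Longrightarrow> T v = a *\<^sub>C v \<Longrightarrow> polyop T p v = poly p a *\<^sub>C v"
  by (induction p) (simp_all add: polyop_pCons module_hom.scale[of _ _ T] scaleC_add_left mult.commute)

text \<open>The \<open>card B + 1\<close> vectors \<open>(T ^^ i) v\<close> with
  \<open>i \<le> card B\<close> cannot be independent, and a linear relation between them is a
  polynomial annihilating \<open>v\<close>.\<close>

lemma exists_annihilating_poly_at:
  fixes T :: "'a::cvector \<Rightarrow> 'a" and B :: "'a set"
  assumes T: "clinear T" and B: "finite B" "cspan B = UNIV"
  shows "\<exists>p. p \<noteq> 0 \<and> polyop T p v = 0"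
proof (rule ccontr)
  assume "\<not> ?thesis"
  then have nz: "polyop T p v \<noteq> 0" if "p \<noteq> 0" for p
    using that by blast
  define N where "N = card B"
  have monom: "polyop T (monom c i) v = c *\<^sub>C (T ^^ i) v" for c i
    by (subst polyop_bound[of _ i]) (simp_all add: degree_monom_le if_distrib[of "\<lambda>c. c *\<^sub>C _"] cong: if_cong)
  \<comment> \<open>Independence concerns the set of powers, so repetitions are excluded first: two
    equal powers would give an annihilating polynomial with two terms.\<close>
  have inj: "inj_on (\<lambda>i. (T ^^ i) v) {..N}"
  proof (rule inj_onI, rule ccontr)
    fix i j assume "(T ^^ i) v = (T ^^ j) v" and ij: "i \<noteq> j"
    then have "polyop T (monom 1 i + monom (- 1) j) v = 0"
      by (simp add: polyop_add monom)
    moreover have "coeff (monom 1 i + monom (- 1) j :: complex poly) i \<noteq> 0"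
      using ij by simp
    then have "monom 1 i + monom (- 1) j \<noteq> (0 :: complex poly)"
      by (metis coeff_0)
    ultimately show False
      using nz by blast
  qed
  have "cindependent ((\<lambda>i. (T ^^ i) v) ` {..N})"
  proof (rule cvec.independent_if_scalars_zero)
    fix g x assume 0: "(\<Sum>x\<in>(\<lambda>i. (T ^^ i) v) ` {..N}. g x *\<^sub>C x) = 0"
      and x: "x \<in> (\<lambda>i. (T ^^ i) v) ` {..N}"
    define p where "p = (\<Sum>i\<le>N. monom (g ((T ^^ i) v)) i)"
    have "polyop T (\<Sum>i\<in>A. monom (g ((T ^^ i) v)) i) v = (\<Sum>i\<in>A. g ((T ^^ i) v) *\<^sub>C (T ^^ i) v)"
      if "finite A" for A
      using that by induction (simp_all add: polyop_add monom)
    then have "polyop T p v = 0"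
      using 0 by (simp add: p_def sum.reindex[OF inj] o_def)
    then have "p = 0"
      using nz by blast
    obtain i where i: "i \<le> N" "x = (T ^^ i) v"
      using x by auto
    have "coeff p i = g x"
      using i by (simp add: p_def coeff_sum)
    then show "g x = 0"
      using \<open>p = 0\<close> by simp
  qed simp
  then have "card ((\<lambda>i. (T ^^ i) v) ` {..N}) \<le> card B"
    using cvec.independent_span_bound[OF B(1)] B(2) by blast
  then show False
    unfolding card_image[OF inj] by (simp add: N_def)
qed

text \<open>Polynomials in \<open>T\<close> commute, so the product of polynomials annihilating the
  single vectors of \<open>B\<close> annihilates all of them.\<close>

lemma exists_annihilating_poly:
  fixes T :: "'a::cvector \<Rightarrow> 'a" and B :: "'a set"
  assumes T: "clinear T" and B: "finite B" "cspan B = UNIV"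
  shows "\<exists>p. p \<noteq> 0 \<and> (\<forall>v. polyop T p v = 0)"
proof -
  have "\<exists>p. p \<noteq> 0 \<and> (\<forall>v\<in>C. polyop T p v = 0)" if "finite C" for C
    using that
  proof induction
    case empty
    show ?case by (auto intro: exI[of _ 1])
  next
    case (insert w C)
    then obtain p where p: "p \<noteq> 0" "\<forall>v\<in>C. polyop T p v = 0"
      by blast
    obtain q where q: "q \<noteq> 0" "polyop T q w = 0"
      using exists_annihilating_poly_at[OF assms] by blast
    have "polyop T (p * q) w = 0"
      by (simp add: polyop_mult[OF T] q module_hom.zero[OF clinear_polyop[OF T]])
    moreover have "polyop T (p * q) v = 0" if "v \<in> C" for v
      by (subst mult.commute) (simp add: that p polyop_mult[OF T] module_hom.zero[OF clinear_polyop[OF T]])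
    ultimately show ?case
      using p(1) q(1) by (intro exI[of _ "p * q"]) auto
  qed
  then obtain p where p: "p \<noteq> 0" "\<forall>v\<in>B. polyop T p v = 0"
    using B(1) by blast
  have "polyop T p v = 0" for v
  proof -
    have "v \<in> cspan B" using B by simp
    then show ?thesis
      by (induction rule: cvec.span_induct)
         (auto simp: p cvec.subspace_def module_hom.zero[OF clinear_polyop[OF T]]
           module_hom.add[OF clinear_polyop[OF T]] module_hom.scale[OF clinear_polyop[OF T]])
  qed
  with p(1) show ?thesis by blast
qed

section \<open>Representations of the three-dimensional simple Lie algebra\<close>

text \<open>An abstract form of the adjoint action of the triple. It yields the facts assumed in
  \<open>graded_form\<close>: integral weights spanning the space, injectivity of \<open>E\<close>
  on negative weights, and a lower bound for the weights.\<close>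

locale sl2_rep =
  fixes E H F :: "'a::cvector \<Rightarrow> 'a" and B :: "'a set"
  assumes E: "clinear E" and H: "clinear H" and F: "clinear F"
    and HE: "H (E x) = E (H x) + 2 *\<^sub>C E x"
    and HF: "H (F x) = F (H x) - 2 *\<^sub>C F x"
    and EF: "E (F x) = F (E x) + H x"
    and E_nilpotent: "\<exists>k. \<forall>x. (E ^^ k) x = 0"
    and B: "finite B" "cspan B = UNIV"
begin

lemmas lin_simps = module_hom.add[OF E] module_hom.add[OF F] module_hom.add[OF H]
  module_hom.scale[OF E] module_hom.scale[OF F] module_hom.scale[OF H]
  module_hom.diff[OF E] module_hom.diff[OF F] module_hom.diff[OF H]
  module_hom.zero[OF E] module_hom.zero[OF F] module_hom.zero[OF H]

lemma funpow_zero: "(F ^^ n) 0 = 0" "(E ^^ n) 0 = 0"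
  by (induction n) (simp_all add: lin_simps)

lemma H_funpow_F:
  assumes "H x = a *\<^sub>C x + w"
  shows "H ((F ^^ n) x) = (a - 2 * of_nat n) *\<^sub>C (F ^^ n) x + (F ^^ n) w"
proof (induction n)
  case (Suc n)
  show ?case
    by (simp add: HF Suc lin_simps cvec.scale_left_distrib cvec.scale_left_diff_distrib)
qed (use assms in simp)

lemma scaleC_regroup:
  fixes X :: "'a"
  shows "\<alpha> *\<^sub>C X + \<beta> *\<^sub>C W + (\<gamma> *\<^sub>C X + W) = (\<alpha> + \<gamma>) *\<^sub>C X + (\<beta> + 1) *\<^sub>C W"
  by (simp add: scaleC_add_left)

text \<open>Moving \<open>E\<close> past each \<open>F\<close> leaves one \<open>H\<close>; the
  weights \<open>a - 2 * i\<close> for \<open>i \<le> n\<close> add up to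
  \<open>(n + 1) * (a - n)\<close>. The term \<open>w\<close> admits generalized eigenvectors, so
  that Jordan blocks of \<open>H\<close> can be ruled out.\<close>

lemma E_funpow_F:
  assumes "H x = a *\<^sub>C x + w" "E x = 0"
  shows "E ((F ^^ Suc n) x) = ((of_nat n + 1) * (a - of_nat n)) *\<^sub>C (F ^^ n) x
    + (of_nat n + 1) *\<^sub>C (F ^^ n) w"
proof (induction n)
  case 0
  show ?case using assms EF[of x] by (simp add: lin_simps)
next
  case (Suc n)
  have "E ((F ^^ Suc (Suc n)) x) = F (E ((F ^^ Suc n) x)) + H ((F ^^ Suc n) x)"
    using EF[of "(F ^^ Suc n) x"] by simp
  also have "\<dots> = ((of_nat n + 1) * (a - of_nat n) + (a - 2 * (of_nat n + 1))) *\<^sub>C (F ^^ Suc n) x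
      + ((of_nat n + 1) + 1) *\<^sub>C (F ^^ Suc n) w"
    unfolding Suc H_funpow_F[OF assms(1)] by (simp add: lin_simps scaleC_regroup)
  also have "(of_nat n + 1) * (a - of_nat n) + (a - 2 * (of_nat n + 1))
      = (of_nat (Suc n) + 1) * (a - of_nat (Suc n))"
    by (simp add: algebra_simps)
  finally show ?case by (simp add: add.commute)
qed

text \<open>An annihilating polynomial of \<open>H\<close> has finitely many roots, while a nonzero
  \<open>(F ^^ n) x\<close> is an eigenvector for \<open>a - 2 * n\<close>.\<close>

lemma funpow_F_eventually_zero:
  assumes "H x = a *\<^sub>C x"
  shows "\<exists>n. (F ^^ n) x = 0"
proof -
  obtain p where p: "p \<noteq> 0" "\<And>v. polyop H p v = 0"
    using exists_annihilating_poly[OF H B] by blast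
  have "finite {z. poly p z = 0}"
    by (rule poly_roots_finite[OF p(1)])
  moreover have "infinite (range (\<lambda>n. a - 2 * of_nat n :: complex))"
    by (rule range_inj_infinite) (auto simp: inj_on_def)
  ultimately obtain n where n: "poly p (a - 2 * of_nat n) \<noteq> 0"
    by (metis (mono_tags, lifting) finite_subset image_subsetI mem_Collect_eq)
  have "H ((F ^^ n) x) = (a - 2 * of_nat n) *\<^sub>C (F ^^ n) x"
    using H_funpow_F[of x a 0 n] assms by (simp add: funpow_zero)
  from polyop_eigenvector[OF H this, of p] p(2) n show ?thesis
    by (metis cvec.scale_eq_0_iff)
qed

text \<open>At the last nonzero power \<open>(F ^^ n) x\<close>, the formula for
  \<open>E ((F ^^ Suc n) x) = 0\<close> leaves \<open>(n + 1) * (a - n)\<close> times a nonzero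
  vector.\<close>

lemma highest_weight_nat:
  assumes "H x = a *\<^sub>C x" "E x = 0" "x \<noteq> 0"
  shows "\<exists>n. a = of_nat n \<and> (F ^^ Suc n) x = 0 \<and> (F ^^ n) x \<noteq> 0"
proof -
  define m where "m = (LEAST n. (F ^^ n) x = 0)"
  have m: "(F ^^ m) x = 0"
    unfolding m_def using funpow_F_eventually_zero[OF assms(1)] by (rule LeastI_ex)
  have less: "(F ^^ k) x \<noteq> 0" if "k < m" for k
    using not_less_Least[of k "\<lambda>n. (F ^^ n) x = 0"] that m_def by blast
  obtain n where n: "m = Suc n"
    using m assms(3) by (cases m) auto
  have "((of_nat n + 1) * (a - of_nat n)) *\<^sub>C (F ^^ n) x = 0"
    using E_funpow_F[of x a 0 n] assms m n by (simp add: funpow_zero lin_simps)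
  moreover have "of_nat n + (1::complex) \<noteq> 0"
    by (metis of_nat_Suc of_nat_eq_0_iff add.commute nat.distinct(1))
  ultimately have "a = of_nat n"
    using less[of n] n by simp
  then show ?thesis
    using m n less[of n] by auto
qed

text \<open>A nonzero \<open>w\<close> is itself a highest weight vector, of some weight
  \<open>n\<close>. Then \<open>E\<close> maps \<open>(F ^^ Suc n) x\<close> to a nonzero multiple
  of \<open>(F ^^ n) w\<close>, and beyond that the coefficient \<open>(m + 1) * (n - m)\<close>
  never vanishes, so no power of \<open>F\<close> kills \<open>x\<close>. But
  \<open>(F ^^ Suc n) x\<close> is an eigenvector, on which \<open>F\<close> is nilpotent.\<close>

lemma semisimple_on_ker_E:
  assumes x: "H x = a *\<^sub>C x + w" and w: "H w = a *\<^sub>C w" and E: "E x = 0"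
  shows "w = 0"
proof (rule ccontr)
  assume nz: "w \<noteq> 0"
  have "w = H x - a *\<^sub>C x" using x by simp
  then have "E w = 0"
    using HE[of x] E by (simp add: lin_simps)
  note E0 = module_hom.zero[OF sl2_rep.E[OF sl2_rep_axioms]]
  obtain n where n: "a = of_nat n" "(F ^^ Suc n) w = 0" "(F ^^ n) w \<noteq> 0"
    using highest_weight_nat[OF w \<open>E w = 0\<close> nz] by blast
  have c: "of_nat m + (1::complex) \<noteq> 0" for m
    by (metis of_nat_Suc of_nat_eq_0_iff add.commute nat.distinct(1))
  have "E ((F ^^ Suc n) x) = (of_nat n + 1) *\<^sub>C (F ^^ n) w"
    using E_funpow_F[OF x E, of n] n by simp
  then have start: "(F ^^ Suc n) x \<noteq> 0"
    using n(3) c[of n] E0 by (metis cvec.scale_eq_0_iff)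
  have "(F ^^ m) x \<noteq> 0" if "m \<ge> Suc n" for m
    using that
  proof (induction m rule: dec_induct)
    case (step m)
    then have "(F ^^ m) w = (F ^^ (m - Suc n)) ((F ^^ Suc n) w)"
      using funpow_add[of "m - Suc n" "Suc n" F] by simp
    also have "\<dots> = 0" by (subst n(2)) (rule funpow_zero)
    finally have "(F ^^ m) w = 0" .
    then have "E ((F ^^ Suc m) x) = ((of_nat m + 1) * (of_nat n - of_nat m)) *\<^sub>C (F ^^ m) x"
      using E_funpow_F[OF x E, of m] n by simp
    moreover have "(of_nat m + 1) * (of_nat n - of_nat m) \<noteq> (0::complex)"
      using c[of m] step(1) by simp
    ultimately show ?case
      using step E0 by (metis cvec.scale_eq_0_iff)
  qed (rule start)
  moreover have "H ((F ^^ Suc n) x) = (a - 2 * of_nat (Suc n)) *\<^sub>C (F ^^ Suc n) x"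
    using H_funpow_F[OF x, of "Suc n"] n by simp
  then obtain k where "(F ^^ k) ((F ^^ Suc n) x) = 0"
    using funpow_F_eventually_zero by blast
  then have "(F ^^ (k + Suc n)) x = 0"
    unfolding funpow_add comp_apply .
  ultimately show False
    by (metis le_add2)
qed

text \<open>The parameter \<open>c\<close> makes the induction on the nilpotency order of \<open>z\<close> work; only \<open>c = 0\<close> is
  of interest.\<close>

lemma EF_surj:
  assumes "H z = of_nat b *\<^sub>C z" "(E ^^ k) z = 0" "b > 0"
  shows "\<exists>y. H y = of_nat b *\<^sub>C y \<and> E (F y) + of_nat c *\<^sub>C y = z"
  using assms
proof (induction k arbitrary: z b c)
  case 0
  then show ?case by (intro exI[of _ 0]) (simp add: lin_simps)
next
  case (Suc k)
  have "H (E z) = of_nat (b + 2) *\<^sub>C E z"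
    using HE[of z] Suc.prems by (simp add: lin_simps scaleC_add_left)
  moreover have "(E ^^ k) (E z) = 0"
    using Suc.prems(2) by (simp add: funpow_swap1)
  ultimately obtain y where y: "H y = of_nat (b + 2) *\<^sub>C y" "E (F y) + of_nat (b + c) *\<^sub>C y = E z"
    using Suc.IH[of "E z" "b + 2" "b + c"] by auto
  \<comment> \<open>Here \<open>E t = (b + c) y\<close>, hence
    \<open>E (F t) + c t = F (E t) + (b + c) t = (b + c) z\<close>; it remains to divide by
    \<open>b + c\<close>, which is positive.\<close>
  define t where "t = z - F y"
  have Ht: "H t = of_nat b *\<^sub>C t"
    using HF[of y] y(1) Suc.prems(1)
    by (simp add: t_def lin_simps scaleC_add_left cvec.scale_right_diff_distrib)
  have nz: "(of_nat (b + c) :: complex) \<noteq> 0"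
    using Suc.prems(3) of_nat_eq_0_iff[of "b + c"] by (metis add_is_0 less_numeral_extra(3))
  define m :: complex where "m = of_nat (b + c)"
  have "E t = E z - E (F y)" by (simp add: t_def lin_simps)
  also have "\<dots> = m *\<^sub>C y"
    unfolding y(2)[symmetric] m_def by (rule add_diff_cancel_left')
  finally have Et: "E t = m *\<^sub>C y" .
  have "E (F t) + of_nat c *\<^sub>C t = m *\<^sub>C F y + (of_nat b *\<^sub>C t + of_nat c *\<^sub>C t)"
    unfolding EF Et Ht module_hom.scale[OF F] by (rule add.assoc)
  also have "\<dots> = m *\<^sub>C (F y + t)"
    unfolding scaleC_add_right scaleC_add_left[symmetric] m_def of_nat_add ..
  also have "F y + t = z" by (simp add: t_def)
  finally have sum: "E (F t) + of_nat c *\<^sub>C t = m *\<^sub>C z" .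
  define y' where "y' = inverse m *\<^sub>C t"
  have "E (F y') + of_nat c *\<^sub>C y' = inverse m *\<^sub>C (E (F t) + of_nat c *\<^sub>C t)"
    by (simp add: y'_def lin_simps scaleC_add_right mult.commute)
  also have "\<dots> = z" unfolding sum scaleC_scaleC using nz by (simp add: m_def)
  finally have "E (F y') + of_nat c *\<^sub>C y' = z" .
  moreover have "H y' = of_nat b *\<^sub>C y'"
    by (simp add: y'_def lin_simps Ht mult.commute)
  ultimately show ?case by blast
qed

text \<open>Induction applied to \<open>E x\<close> gives \<open>E w = 0\<close>. If
  \<open>w\<close> were nonzero, \<open>a\<close> would be a natural number \<open>n\<close>, so
  \<open>E x\<close> has weight \<open>n + 2\<close> and equals some \<open>E (F y)\<close> by
  \<open>EF_surj\<close>. Subtracting \<open>F y\<close> moves \<open>x\<close> into the kernel of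
  \<open>E\<close> without changing \<open>w\<close>.\<close>

lemma semisimple:
  assumes "H x = a *\<^sub>C x + w" "H w = a *\<^sub>C w" "(E ^^ k) x = 0"
  shows "w = 0"
  using assms
proof (induction k arbitrary: x a w)
  case 0
  then show ?case by (simp add: lin_simps)
next
  case (Suc k)
  have HEx: "H (E x) = (a + 2) *\<^sub>C E x + E w"
    using HE[of x] Suc.prems by (simp add: lin_simps scaleC_add_left)
  moreover have "H (E w) = (a + 2) *\<^sub>C E w"
    using HE[of w] Suc.prems by (simp add: lin_simps scaleC_add_left)
  moreover have k: "(E ^^ k) (E x) = 0"
    using Suc.prems(3) by (simp add: funpow_swap1)
  ultimately have Ew: "E w = 0"
    by (rule Suc.IH)
  show ?case
  proof (rule ccontr)
    assume "w \<noteq> 0"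
    then obtain n where n: "a = of_nat n"
      using highest_weight_nat[OF Suc.prems(2) Ew] by blast
    have "H (E x) = of_nat (n + 2) *\<^sub>C E x"
      using HEx Ew n by simp
    from EF_surj[OF this k, of 0] obtain y
      where y: "H y = of_nat (n + 2) *\<^sub>C y" "E (F y) = E x"
      by auto
    have "H (F y) = a *\<^sub>C F y"
      using HF[of y] y n by (simp add: lin_simps scaleC_add_left)
    then have "H (x - F y) = a *\<^sub>C (x - F y) + w"
      using Suc.prems(1) by (simp add: lin_simps cvec.scale_right_diff_distrib)
    moreover have "E (x - F y) = 0"
      using y by (simp add: lin_simps)
    ultimately show False
      using semisimple_on_ker_E Suc.prems(2) \<open>w \<noteq> 0\<close> by blast
  qed
qed

lemma eigenvalue_int:
  assumes "H x = a *\<^sub>C x" "x \<noteq> 0"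
  shows "a \<in> \<int>"
proof -
  obtain k where "(E ^^ k) x = 0" using E_nilpotent by blast
  then show ?thesis
    using assms
  proof (induction k arbitrary: x a)
    case (Suc k)
    show ?case
    proof (cases "E x = 0")
      case True
      then show ?thesis using highest_weight_nat[OF Suc.prems(2) True Suc.prems(3)] by auto
    next
      case False
      have "H (E x) = (a + 2) *\<^sub>C E x"
        using HE[of x] Suc.prems by (simp add: lin_simps scaleC_add_left)
      moreover have "(E ^^ k) (E x) = 0"
        using Suc.prems(1) by (simp add: funpow_swap1)
      ultimately have "a + 2 \<in> \<int>"
        using Suc.IH False by blast
      then have "a + 2 - 2 \<in> \<int>"
        by (rule Ints_diff) simp
      then show ?thesis by simp
    qed
  qed simp
qed

lemma E_injective_negative:
  assumes "H x = of_int i *\<^sub>C x" "i < 0" "E x = 0"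
  shows "x = 0"
proof (rule ccontr)
  assume "x \<noteq> 0"
  from highest_weight_nat[OF assms(1,3) this] obtain n where "(of_int i :: complex) = of_nat n"
    by blast
  then have "i = int n"
    by (metis of_int_eq_iff of_int_of_nat_eq)
  then show False using assms(2) by simp
qed

text \<open>On negative weights \<open>E\<close> is injective and raises the weight by 2, so a
  nonzero vector of weight below \<open>- 2 * k\<close> would survive \<open>k\<close>
  applications.\<close>

lemma negative_weights_bounded: "\<exists>D::nat. \<forall>i x. i < - int D \<longrightarrow> H x = of_int i *\<^sub>C x \<longrightarrow> x = 0"
proof -
  obtain k where k: "\<And>x. (E ^^ k) x = 0" using E_nilpotent by blast
  have "x = 0" if "(E ^^ n) x = 0" "i < - 2 * int n" "H x = of_int i *\<^sub>C x" for i x n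
    using that
  proof (induction n arbitrary: x i)
    case (Suc n)
    have "H (E x) = of_int (i + 2) *\<^sub>C E x"
      using HE[of x] Suc.prems by (simp add: lin_simps scaleC_add_left)
    moreover have "(E ^^ n) (E x) = 0"
      using Suc.prems(1) by (simp add: funpow_swap1)
    ultimately have "E x = 0"
      using Suc.IH[of "E x" "i + 2"] Suc.prems(2) by simp
    then show ?case
      using E_injective_negative[OF Suc.prems(3)] Suc.prems(2) by simp
  qed simp
  then show ?thesis
    using k by (intro exI[of _ "2 * k"]) auto
qed

text \<open>The span \<open>S\<close> of the integral eigenvectors contains \<open>v\<close> as soon
  as it contains \<open>H v - a v\<close>. Splitting an annihilating polynomial of \<open>H\<close>
  into linear factors then leads from 0 back to any vector.\<close>

lemma weight_decomposition: "cspan (\<Union>i. {x. H x = of_int i *\<^sub>C x}) = UNIV"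
proof -
  define S where "S = cspan (\<Union>i. {x. H x = of_int i *\<^sub>C x})"
  have eigen: "x \<in> S" if "H x = a *\<^sub>C x" for x a
  proof (cases "x = 0")
    case False
    have "a \<in> \<int>"
      using eigenvalue_int that False by blast
    then obtain i where "a = of_int i"
      by (rule Ints_cases)
    then show ?thesis
      using that unfolding S_def by (intro cvec.span_base) auto
  qed (simp add: S_def cvec.span_zero)
  \<comment> \<open>Solves \<open>(H - a) y = w\<close> in \<open>S\<close> up to an eigenvector for
    \<open>a\<close>: components of \<open>w\<close> of any other weight are divided by the
    difference of the weights.\<close>
  have shift: "\<exists>y\<in>S. H (H y - a *\<^sub>C y - w) = a *\<^sub>C (H y - a *\<^sub>C y - w)" if "w \<in> S" for a w
    using that unfolding S_def
  proof (induction rule: cvec.span_induct_alt)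
    case base
    show ?case by (intro bexI[of _ 0]) (simp_all add: lin_simps cvec.span_zero)
  next
    case (step c x z)
    then obtain i y where x: "H x = of_int i *\<^sub>C x" and yS: "y \<in> S"
      and y: "H (H y - a *\<^sub>C y - z) = a *\<^sub>C (H y - a *\<^sub>C y - z)"
      unfolding S_def by blast
    show ?case
    proof (cases "of_int i = a")
      case True
      have "H (H y - a *\<^sub>C y - (c *\<^sub>C x + z)) = a *\<^sub>C (H y - a *\<^sub>C y - (c *\<^sub>C x + z))"
        using y x True by (simp add: lin_simps cvec.scale_right_diff_distrib scaleC_add_right mult.commute)
      then show ?thesis using yS by (auto simp: S_def)
    next
      case False
      define k where "k = c / (of_int i - a)"
      define t where "t = k *\<^sub>C x"
      have "H t - a *\<^sub>C t = ((of_int i - a) * k) *\<^sub>C x"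
        using x by (simp add: t_def lin_simps cvec.scale_left_diff_distrib algebra_simps)
      also have "(of_int i - a) * k = c" using False by (simp add: k_def)
      finally have t: "H t - a *\<^sub>C t = c *\<^sub>C x" .
      have "H (y + t) - a *\<^sub>C (y + t) - (c *\<^sub>C x + z)
          = (H y - a *\<^sub>C y - z) + ((H t - a *\<^sub>C t) - c *\<^sub>C x)"
        by (simp add: lin_simps scaleC_add_right)
      then have "H (y + t) - a *\<^sub>C (y + t) - (c *\<^sub>C x + z) = H y - a *\<^sub>C y - z"
        using t by simp
      moreover have "t \<in> S"
        using eigen[OF x] unfolding t_def S_def by (rule cvec.span_scale)
      then have "y + t \<in> S" using yS unfolding S_def by (simp add: cvec.span_add)
      ultimately show ?thesis using y unfolding S_def by (intro bexI[of _ "y + t"]) (simp_all only:)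
    qed
  qed
  have step: "v \<in> S" if "H v - a *\<^sub>C v \<in> S" for v a
  proof -
    obtain y where y: "y \<in> S"
      and *: "H (H y - a *\<^sub>C y - (H v - a *\<^sub>C v)) = a *\<^sub>C (H y - a *\<^sub>C y - (H v - a *\<^sub>C v))"
      using shift \<open>H v - a *\<^sub>C v \<in> S\<close> by blast
    define w where "w = H y - a *\<^sub>C y - (H v - a *\<^sub>C v)"
    obtain k where k: "(E ^^ k) (y - v) = 0" using E_nilpotent by blast
    have "H (y - v) = a *\<^sub>C (y - v) + w"
      by (simp add: w_def lin_simps cvec.scale_right_diff_distrib)
    moreover have "H w = a *\<^sub>C w" using * by (simp add: w_def)
    ultimately have "w = 0" using semisimple k by blast
    then have "H (y - v) = a *\<^sub>C (y - v)"
      using \<open>H (y - v) = a *\<^sub>C (y - v) + w\<close> by simp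
    then have "y - v \<in> S" by (rule eigen)
    then have "y - (y - v) \<in> S" using y unfolding S_def by (rule cvec.span_diff[rotated])
    then show ?thesis by simp
  qed
  have split: "v \<in> S" if "p \<noteq> 0" "polyop H p v \<in> S" for p v
    using that
  proof (induction "degree p" arbitrary: p v)
    case 0
    then obtain c where "p = [:c:]" "c \<noteq> 0"
      by (metis degree_eq_zeroE pCons_0_0)
    then have "c *\<^sub>C v \<in> S" using 0 by (simp add: polyop_def)
    then have "(1 / c) *\<^sub>C c *\<^sub>C v \<in> S" unfolding S_def by (rule cvec.span_scale)
    then show ?case using \<open>c \<noteq> 0\<close> by simp
  next
    case (Suc n)
    have "\<not> constant (poly p)"
      using Suc.hyps(2) by (simp add: constant_degree)
    then obtain a where "poly p a = 0"
      using fundamental_theorem_of_algebra by blast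
    then obtain q where q: "p = [:- a, 1:] * q"
      unfolding poly_eq_0_iff_dvd by (rule dvdE)
    then have "q \<noteq> 0" using Suc.prems by auto
    then have "degree p = Suc (degree q)" unfolding q by (subst degree_mult_eq) auto
    then have n: "n = degree q" using Suc.hyps(2) by simp
    have "polyop H p v = H (polyop H q v) - a *\<^sub>C polyop H q v"
      unfolding q polyop_mult[OF H] by (simp add: polyop_pCons[OF H] lin_simps)
    then have "H (polyop H q v) - a *\<^sub>C polyop H q v \<in> S"
      using Suc.prems(2) by simp
    then have "polyop H q v \<in> S" by (rule step)
    from Suc.hyps(1)[OF n \<open>q \<noteq> 0\<close> this] show ?case .
  qed
  obtain p where p: "p \<noteq> 0" "\<And>v. polyop H p v = 0"
    using exists_annihilating_poly[OF H B] by blast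
  then show ?thesis
    using split[OF p(1)] by (auto simp: S_def cvec.span_zero)
qed

end

section \<open>A filtered Poincare lemma\<close>

text \<open>Modulo the small spaces \<open>H\<close>, the operator \<open>D\<close> behaves like the derivative with respect to the
  coordinate \<open>Y\<close>, which is even for \<open>\<epsilon> = 1\<close> and odd otherwise, and the \<open>T j\<close> like derivatives with
  respect to further coordinates.  Then \<open>v\<close> has an antiderivative \<open>Y w\<close> on which the \<open>T j\<close> vanish.\<close>

lemma antiderivative:
  fixes D Y :: "'a::cvector \<Rightarrow> 'a" and T :: "'i \<Rightarrow> 'a \<Rightarrow> 'a" and G H :: "int \<Rightarrow> 'a set"
  assumes D: "clinear D" and Y: "clinear Y" and T: "\<And>j. j \<in> K \<Longrightarrow> clinear (T j)"
    and G: "\<And>i. csubspace (G i)" and H: "\<And>i. csubspace (H i)"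
    and DG: "\<And>i z. z \<in> G i \<Longrightarrow> D z \<in> G (i - d)"
    and YG: "\<And>i z. z \<in> G i \<Longrightarrow> Y z \<in> G (i + d)"
    and YH: "\<And>i z. z \<in> H i \<Longrightarrow> Y z \<in> H (i + d)"
    and DY: "\<And>i z. z \<in> G i \<Longrightarrow> D (Y z) - \<epsilon> *\<^sub>C Y (D z) - z \<in> H i"
    and TY: "\<And>i j z. z \<in> G i \<Longrightarrow> j \<in> K \<Longrightarrow> T j (Y z) - \<eta> j *\<^sub>C Y (T j z) \<in> H (i + d - \<delta> j)"
    and v: "v \<in> G i"
    and Tv: "\<And>n j. j \<in> K \<Longrightarrow> T j ((D ^^ n) v) \<in> H (i - int n * d - \<delta> j)"
    and fin: "(\<epsilon> = 1 \<and> (D ^^ N) v \<in> H (i - int N * d)) \<or> D v \<in> H (i - d)"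
  shows "\<exists>w\<in>G i. D (Y w) - v \<in> H i \<and> (\<forall>j\<in>K. T j (Y w) \<in> H (i + d - \<delta> j))"
proof -
  note lin = module_hom.add[OF D] module_hom.add[OF Y] module_hom.scale[OF D] module_hom.scale[OF Y]
    module_hom.diff[OF D] module_hom.diff[OF Y] module_hom.zero[OF D] module_hom.zero[OF Y]
  note Hadd = cvec.subspace_add[OF H] and Hscale = cvec.subspace_scale[OF H]
    and Hdiff = cvec.subspace_diff[OF H] and H0 = cvec.subspace_0[OF H]
  have YnG: "(Y ^^ n) z \<in> G (i + int n * d)" if "z \<in> G i" for n z i
  proof (induction n)
    case (Suc n)
    from YG[OF Suc] show ?case by (simp add: algebra_simps)
  qed (use that in simp)
  have YnH: "(Y ^^ n) z \<in> H (i + int n * d)" if "z \<in> H i" for n z i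
  proof (induction n)
    case (Suc n)
    from YH[OF Suc] show ?case by (simp add: algebra_simps)
  qed (use that in simp)
  have TY': "T j (Y z) \<in> H (i + d - \<delta> j)" if "z \<in> G i" "j \<in> K" "T j z \<in> H (i - \<delta> j)" for i j z
  proof -
    have "Y (T j z) \<in> H (i + d - \<delta> j)"
      using YH[OF that(3)] by (simp add: algebra_simps)
    from Hadd[OF TY[OF that(1,2)] Hscale[OF this, of "\<eta> j"]] show ?thesis by simp
  qed
  have TYn: "T j ((Y ^^ n) z) \<in> H (i + int n * d - \<delta> j)"
    if "z \<in> G i" "j \<in> K" "T j z \<in> H (i - \<delta> j)" for i j z n
  proof (induction n)
    case (Suc n)
    from TY'[OF YnG[OF that(1)] that(2) Suc] show ?case by (simp add: algebra_simps)
  qed (use that in simp)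
  show ?thesis
  proof (cases "D v \<in> H (i - d)")
    case True
    have "Y (D v) \<in> H i"
      using YH[OF True] by simp
    from Hadd[OF DY[OF v] Hscale[OF this, of \<epsilon>]] have "D (Y v) - v \<in> H i" by simp
    moreover have "T j (Y v) \<in> H (i + d - \<delta> j)" if "j \<in> K" for j
      using TY'[OF v that] Tv[OF that, of 0] by simp
    ultimately show ?thesis using v by blast
  next
    case False
    then have \<epsilon>: "\<epsilon> = 1" and N: "(D ^^ N) v \<in> H (i - int N * d)"
      using fin by auto
    \<comment> \<open>The rule for differentiating a power of the coordinate. For
      \<open>n = 0\<close> the truncated exponent \<open>n - 1\<close> carries the coefficient
      0.\<close>
    have DYn: "D ((Y ^^ n) z) - (Y ^^ n) (D z) - of_nat n *\<^sub>C (Y ^^ (n - 1)) z \<in> H (i + (int n - 1) * d)"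
      if "z \<in> G i" for n z i
    proof (induction n)
      case 0
      show ?case by (simp add: H0)
    next
      case (Suc n)
      have 1: "D (Y ((Y ^^ n) z)) - Y (D ((Y ^^ n) z)) - (Y ^^ n) z \<in> H (i + int n * d)"
        using DY[OF YnG[OF that], of n] \<epsilon> by simp
      have 2: "of_nat n *\<^sub>C Y ((Y ^^ (n - 1)) z) = of_nat n *\<^sub>C (Y ^^ n) z"
        by (cases n) simp_all
      have "Y (D ((Y ^^ n) z)) - Y ((Y ^^ n) (D z)) - of_nat n *\<^sub>C (Y ^^ n) z \<in> H (i + int n * d)"
        using YH[OF Suc] unfolding lin 2 by (simp add: algebra_simps)
      from Hadd[OF 1 this] show ?case
        by (simp add: scaleC_add_left algebra_simps)
    qed
    \<comment> \<open>Integration by parts: an antiderivative of \<open>Y^m z\<close> is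
      \<open>Y^(m+1) z\<close> minus an antiderivative of \<open>Y^(m+1) (D z)\<close>, divided by
      \<open>m + 1\<close>. It ends when the derivatives of \<open>z\<close> reach
      \<open>H\<close>.\<close>
    have "\<exists>w\<in>G (i + int m * d). D (Y w) - (Y ^^ m) z \<in> H (i + int m * d) \<and>
        (\<forall>j\<in>K. T j (Y w) \<in> H (i + int (Suc m) * d - \<delta> j))"
      if "z \<in> G i" "(D ^^ N) z \<in> H (i - int N * d)"
        "\<And>n j. j \<in> K \<Longrightarrow> T j ((D ^^ n) z) \<in> H (i - int n * d - \<delta> j)" for N m z i
      using that
    proof (induction N arbitrary: m z i)
      case 0
      have "D (Y 0) - (Y ^^ m) z \<in> H (i + int m * d)"
        using YnH[of z i m] 0(2) by (simp add: lin cvec.subspace_neg[OF H])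
      moreover have "0 \<in> G (i + int m * d)" by (rule cvec.subspace_0[OF G])
      moreover have "T j (Y 0) \<in> H k" if "j \<in> K" for j k
        using that by (simp add: lin module_hom.zero[OF T] H0)
      ultimately show ?case by blast
    next
      case (Suc N)
      have "(D ^^ N) (D z) \<in> H (i - d - int N * d)"
        using Suc.prems(2) by (simp add: funpow_swap1 algebra_simps)
      moreover have "T j ((D ^^ n) (D z)) \<in> H (i - d - int n * d - \<delta> j)" if "j \<in> K" for n j
        using Suc.prems(3)[OF that, of "Suc n"] by (simp add: funpow_swap1 algebra_simps)
      ultimately obtain w where w: "w \<in> G (i - d + int (Suc m) * d)"
        "D (Y w) - (Y ^^ Suc m) (D z) \<in> H (i - d + int (Suc m) * d)"
        "\<And>j. j \<in> K \<Longrightarrow> T j (Y w) \<in> H (i - d + int (Suc (Suc m)) * d - \<delta> j)"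
        using Suc.IH[OF DG[OF Suc.prems(1)], of "Suc m"] by blast
      have eq: "i - d + int (Suc m) * d = i + int m * d"
        "i - d + int (Suc (Suc m)) * d = i + int (Suc m) * d"
        by (simp_all add: algebra_simps)
      define c :: complex where "c = inverse (of_nat (Suc m))"
      have c: "c * of_nat (Suc m) = 1"
        unfolding c_def by (rule left_inverse) (rule of_nat_neq_0)
      define w' where "w' = c *\<^sub>C ((Y ^^ m) z - w)"
      have "w' \<in> G (i + int m * d)"
        unfolding w'_def using YnG[OF Suc.prems(1)] w(1) unfolding eq
        by (intro cvec.subspace_scale[OF G] cvec.subspace_diff[OF G])
      moreover have "D (Y w') - (Y ^^ m) z \<in> H (i + int m * d)"
      proof -
        have "D ((Y ^^ Suc m) z) - (Y ^^ Suc m) (D z) - of_nat (Suc m) *\<^sub>C (Y ^^ m) z \<in> H (i + int m * d)"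
          using DYn[OF Suc.prems(1), of "Suc m"] by simp
        from Hdiff[OF this w(2)[unfolded eq]]
        have "D ((Y ^^ Suc m) z) - D (Y w) - of_nat (Suc m) *\<^sub>C (Y ^^ m) z \<in> H (i + int m * d)"
          by (simp add: algebra_simps)
        from Hscale[OF this, of c]
        have "c *\<^sub>C (D ((Y ^^ Suc m) z) - D (Y w)) - (c * of_nat (Suc m)) *\<^sub>C (Y ^^ m) z \<in> H (i + int m * d)"
          by (simp only: cvec.scale_right_diff_distrib scaleC_scaleC)
        then show ?thesis
          unfolding c by (simp add: w'_def lin)
      qed
      moreover have "T j (Y w') \<in> H (i + int (Suc m) * d - \<delta> j)" if "j \<in> K" for j
      proof -
        have "T j ((Y ^^ Suc m) z) \<in> H (i + int (Suc m) * d - \<delta> j)"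
          using Suc.prems(3)[OF that, of 0] by (intro TYn Suc.prems that) simp
        from Hscale[OF Hdiff[OF this w(3)[OF that, unfolded eq]], of c] show ?thesis
          by (simp add: w'_def lin module_hom.scale[OF T[OF that]] module_hom.diff[OF T[OF that]])
      qed
      ultimately show ?case by blast
    qed
    from this[OF v N Tv, of 0] show ?thesis by simp
  qed
qed

text \<open>\<open>T x\<close> models \<open>ad x\<close>, \<open>Y x\<close> left multiplication by
  the partner of \<open>x\<close>, \<open>d x\<close> the negated degree and \<open>\<eta>\<close>
  the Koszul sign. The subspace \<open>A\<close> in \<open>TT\<close> expresses that a commutator of
  derivatives is a combination of the \<open>T l\<close> with \<open>d l = d x + d k\<close>,
  without naming coefficients. The restriction \<open>d k \<le> d x\<close> in \<open>TY\<close>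
  keeps the bracket of \<open>x\<close> with the partner of \<open>k\<close> in degrees at most
  -2.\<close>

locale filtered_derivations =
  fixes T Y :: "'i \<Rightarrow> 'a::cvector \<Rightarrow> 'a" and G :: "int \<Rightarrow> 'a set" and d :: "'i \<Rightarrow> nat"
    and X :: "'i set" and \<eta> :: "'i \<Rightarrow> 'i \<Rightarrow> complex"
  assumes X: "finite X" and T: "\<And>x. x \<in> X \<Longrightarrow> clinear (T x)" and Y: "\<And>x. x \<in> X \<Longrightarrow> clinear (Y x)"
    and G: "\<And>i. csubspace (G i)" and Gmono: "\<And>i j. i \<le> j \<Longrightarrow> G i \<subseteq> G j"
    and Gneg: "\<And>i. i < 0 \<Longrightarrow> G i = G (- 1)"
    and TG: "\<And>x i z. x \<in> X \<Longrightarrow> z \<in> G i \<Longrightarrow> T x z \<in> G (i - int (d x))"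
    and YG: "\<And>x i z. x \<in> X \<Longrightarrow> z \<in> G i \<Longrightarrow> Y x z \<in> G (i + int (d x))"
    and dpos: "\<And>x. x \<in> X \<Longrightarrow> d x > 0"
    and TY: "\<And>x k i z. x \<in> X \<Longrightarrow> k \<in> X \<Longrightarrow> d k \<le> d x \<Longrightarrow> z \<in> G i \<Longrightarrow>
      T x (Y k z) - \<eta> x k *\<^sub>C Y k (T x z) - (if x = k then z else 0) \<in> G (i + int (d k) - int (d x) - 1)"
    and TT: "\<And>x k q A. x \<in> X \<Longrightarrow> k \<in> X \<Longrightarrow> csubspace A \<Longrightarrow>
      (\<And>l. l \<in> X \<Longrightarrow> d l = d x + d k \<Longrightarrow> T l q \<in> A) \<Longrightarrow> T x (T k q) - \<eta> x k *\<^sub>C T k (T x q) \<in> A"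
    and \<eta>: "\<And>x. x \<in> X \<Longrightarrow> \<eta> x x = 1 \<or> \<eta> x x = - 1"
begin

text \<open>A primitive for the leading terms. Coordinates enter \<open>K\<close> by decreasing
  \<open>d\<close>; hence commutators of derivatives only involve indices already in
  \<open>K\<close>, and \<open>TY\<close> applies to each pair of an old coordinate and the new
  one.\<close>

lemma exact_step:
  assumes q: "\<And>x. x \<in> X \<Longrightarrow> T x q \<in> G (i - int (d x))"
  shows "\<exists>w\<in>G i. \<forall>x\<in>X. T x (q - w) \<in> G (i - int (d x) - 1)"
proof -
  have "\<exists>K. K \<subseteq> X \<and> card K = n \<and> (\<forall>x\<in>X. \<forall>k\<in>K. d x > d k \<longrightarrow> x \<in> K) \<and>
      (\<exists>w\<in>G i. \<forall>x\<in>K. T x (q - w) \<in> G (i - int (d x) - 1))" if "n \<le> card X" for n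
    using that
  proof (induction n)
    case 0
    show ?case by (intro exI[of _ "{}"]) (use cvec.subspace_0[OF G] in auto)
  next
    case (Suc n)
    from Suc.IH[OF Suc_leD[OF Suc.prems]] obtain K where K12: "K \<subseteq> X" "card K = n"
      and K3: "\<forall>x\<in>X. \<forall>k\<in>K. d x > d k \<longrightarrow> x \<in> K"
      and ex: "\<exists>w\<in>G i. \<forall>x\<in>K. T x (q - w) \<in> G (i - int (d x) - 1)"
      by blast
    from K3 have K: "K \<subseteq> X" "card K = n" "\<And>x k. x \<in> X \<Longrightarrow> k \<in> K \<Longrightarrow> d x > d k \<Longrightarrow> x \<in> K"
      using K12 by blast+
    from ex obtain w where w: "w \<in> G i" "\<And>x. x \<in> K \<Longrightarrow> T x (q - w) \<in> G (i - int (d x) - 1)"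
      by blast
    have "K \<noteq> X" using K(2) Suc.prems by auto
    then have XK: "finite (X - K)" "X - K \<noteq> {}" using K(1) X by auto
    obtain k where k: "k \<in> X - K" "\<And>x. x \<in> X - K \<Longrightarrow> d x \<le> d k"
    proof -
      have "Max (d ` (X - K)) \<in> d ` (X - K)" using XK by (intro Max_in) auto
      then obtain k where "k \<in> X - K" "d k = Max (d ` (X - K))" by force
      then show thesis using that XK by (metis Max_ge finite_imageI imageI)
    qed
    then have kX: "k \<in> X" by simp
    have above: "x \<in> K" if "x \<in> X" "d x > d k" for x
      using k(2)[of x] that by auto
    define q1 where "q1 = q - w"
    have Tq1: "T x q1 \<in> G (i - int (d x))" if "x \<in> X" for x
      unfolding q1_def module_hom.diff[OF T[OF that]]
      by (intro cvec.subspace_diff[OF G] q TG w that)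
    \<comment> \<open>Conditions already achieved survive differentiation along \<open>k\<close>:
      the commutator terms have \<open>d l = d j + d k\<close>, and \<open>K\<close> is closed
      upwards in \<open>d\<close>.\<close>
    have Kq1: "T j ((T k ^^ n) q1) \<in> G (i - int n * int (d k) - int (d j) - 1)" if "j \<in> K" for n j
      using that
    proof (induction n arbitrary: j)
      case 0
      then show ?case using w(2) by (simp add: q1_def)
    next
      case (Suc n)
      let ?A = "G (i - int (Suc n) * int (d k) - int (d j) - 1)"
      have jX: "j \<in> X" using Suc.prems K(1) by blast
      have "T l ((T k ^^ n) q1) \<in> ?A" if "l \<in> X" "d l = d j + d k" for l
      proof -
        have "l \<in> K" using K(3)[OF that(1) Suc.prems] that(2) dpos[OF kX] by simp
        from Suc.IH[OF this] show ?thesis using that(2) by (simp add: algebra_simps)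
      qed
      from TT[OF jX kX G this]
      have 1: "T j (T k ((T k ^^ n) q1)) - \<eta> j k *\<^sub>C T k (T j ((T k ^^ n) q1)) \<in> ?A"
        by blast
      have "T k (T j ((T k ^^ n) q1)) \<in> ?A"
        using TG[OF kX Suc.IH[OF Suc.prems]] by (simp add: algebra_simps)
      from cvec.subspace_add[OF G 1 cvec.subspace_scale[OF G this, of "\<eta> j k"]]
      show ?case by simp
    qed
    define v where "v = T k q1"
    define m where "m = i - int (d k)"
    have vG: "v \<in> G m" unfolding v_def m_def by (rule Tq1[OF kX])
    \<comment> \<open>For an even coordinate, \<open>nat (i + 1)\<close> further derivatives reach a
      negative level, where \<open>G\<close> is constant. For an odd one, \<open>T k\<close> applied
      twice is half a commutator, controlled by coordinates with \<open>d l = 2 * d k\<close> in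
      \<open>K\<close>.\<close>
    have fin: "(\<eta> k k = 1 \<and> (T k ^^ nat (i + 1)) v \<in> G (m - int (nat (i + 1)) * int (d k) - 1)) \<or>
        T k v \<in> G (m - int (d k) - 1)"
    proof (cases "\<eta> k k = 1")
      case True
      have "(T k ^^ n) v \<in> G (m - int n * int (d k))" for n
      proof (induction n)
        case (Suc n)
        from TG[OF kX Suc] show ?case by (simp add: algebra_simps)
      qed (simp add: vG)
      from this[of "nat (i + 1)"]
      have "(T k ^^ nat (i + 1)) v \<in> G (m - int (nat (i + 1)) * int (d k))" .
      moreover have "int (nat (i + 1)) * 1 \<le> int (nat (i + 1)) * int (d k)"
        using dpos[OF kX] by (intro mult_left_mono) auto
      then have "i + 1 \<le> int (nat (i + 1)) * int (d k)" by linarith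
      then have neg: "m - int (nat (i + 1)) * int (d k) < 0"
        using dpos[OF kX] unfolding m_def by linarith
      have "G (m - int (nat (i + 1)) * int (d k)) = G (m - int (nat (i + 1)) * int (d k) - 1)"
        using Gneg[OF neg] Gneg[of "m - int (nat (i + 1)) * int (d k) - 1"] neg by simp
      ultimately show ?thesis using True by simp
    next
      case False
      then have \<eta>1: "\<eta> k k = - 1" using \<eta>[OF kX] by blast
      let ?A = "G (m - int (d k) - 1)"
      have "T l q1 \<in> ?A" if "l \<in> X" "d l = d k + d k" for l
        using w(2)[OF above[OF that(1)]] that(2) dpos[OF kX] by (simp add: q1_def m_def algebra_simps)
      from TT[OF kX kX G this] have "T k (T k q1) - \<eta> k k *\<^sub>C T k (T k q1) \<in> ?A" by blast
      then have "T k v + T k v \<in> ?A" by (simp add: \<eta>1 v_def)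
      then have "(1 / 2) *\<^sub>C (T k v + T k v) \<in> ?A" by (rule cvec.subspace_scale[OF G])
      then show ?thesis by (simp flip: scaleC_add_left add: scaleC_add_right)
    qed
    have "\<exists>w'\<in>G m. T k (Y k w') - v \<in> G (m - 1) \<and>
        (\<forall>j\<in>K. T j (Y k w') \<in> G (m + int (d k) - int (d j) - 1))"
    \<comment> \<open>Small means one level lower in the filtration.\<close>
    proof (rule antiderivative[where H = "\<lambda>i. G (i - 1)" and \<epsilon> = "\<eta> k k" and \<eta> = "\<lambda>j. \<eta> j k" and
          \<delta> = "\<lambda>j. int (d j)" and N = "nat (i + 1)" and D = "T k" and Y = "Y k" and K = K and T = T])
      show "T k (Y k z) - \<eta> k k *\<^sub>C Y k (T k z) - z \<in> G (i - 1)" if "z \<in> G i" for i z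
        using TY[OF kX kX _ that] by simp
      show "T j (Y k z) - \<eta> j k *\<^sub>C Y k (T j z) \<in> G (i + int (d k) - int (d j) - 1)"
        if "z \<in> G i" "j \<in> K" for i j z
      proof -
        have "d k \<le> d j" using K(3)[OF kX that(2)] k(1) by force
        moreover have "j \<in> X" "j \<noteq> k" using that(2) K(1) k(1) by auto
        ultimately show ?thesis using TY[of j k z i] kX that(1) by simp
      qed
      show "T j ((T k ^^ n) v) \<in> G (m - int n * int (d k) - int (d j) - 1)" if "j \<in> K" for n j
        using Kq1[OF that, of "Suc n"] by (simp add: v_def m_def funpow_swap1 algebra_simps)
      show "Y k z \<in> G (i + int (d k) - 1)" if "z \<in> G (i - 1)" for i z
        using YG[OF kX that] by (simp add: algebra_simps)
    qed (use T Y kX K(1) G TG YG vG fin Gmono in auto)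
    then obtain w' where w': "w' \<in> G m" "T k (Y k w') - v \<in> G (m - 1)"
      "\<And>j. j \<in> K \<Longrightarrow> T j (Y k w') \<in> G (m + int (d k) - int (d j) - 1)"
      by blast
    have Yw': "Y k w' \<in> G i" using YG[OF kX w'(1)] by (simp add: m_def)
    have "T x (q - (w + Y k w')) \<in> G (i - int (d x) - 1)" if "x \<in> insert k K" for x
    proof -
      have xX: "x \<in> X" using that kX K(1) by blast
      have eq: "T x (q - (w + Y k w')) = T x q1 - T x (Y k w')"
        by (simp add: q1_def module_hom.diff[OF T[OF xX]] module_hom.add[OF T[OF xX]])
      show ?thesis
      proof (cases "x = k")
        case True
        then show ?thesis
          using cvec.subspace_neg[OF G w'(2)] unfolding eq by (simp add: v_def m_def)
      next
        case False
        then have "x \<in> K" using that by simp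
        then show ?thesis
          using cvec.subspace_diff[OF G w(2)[OF \<open>x \<in> K\<close>]] w'(3)[OF \<open>x \<in> K\<close>]
          unfolding eq by (simp add: q1_def m_def)
      qed
    qed
    moreover have "w + Y k w' \<in> G i" by (rule cvec.subspace_add[OF G w(1) Yw'])
    moreover have "card (insert k K) = Suc n"
      using k(1) K(1,2) X by (simp add: finite_subset)
    moreover have "\<forall>x\<in>X. \<forall>k'\<in>insert k K. d x > d k' \<longrightarrow> x \<in> insert k K"
      using above K(3) by blast
    ultimately show ?case
      using K(1) kX by (intro exI[of _ "insert k K"]) blast
  qed
  from this[of "card X"] obtain K w where "K \<subseteq> X" "card K = card X" "w \<in> G i"
    "\<And>x. x \<in> K \<Longrightarrow> T x (q - w) \<in> G (i - int (d x) - 1)"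
    by auto
  then show ?thesis using card_subset_eq[OF X] by blast
qed

text \<open>Each use of \<open>exact_step\<close> gains one level. From level 0 downwards the
  targets \<open>i - d x\<close> are negative, where \<open>G\<close> is constant, so
  \<open>w = 0\<close> will do.\<close>

lemma exact:
  assumes q: "\<And>x. x \<in> X \<Longrightarrow> T x q \<in> G (i - int (d x))"
  shows "\<exists>w\<in>G i. \<forall>x\<in>X. T x (q - w) \<in> G (- 1)"
proof -
  have nonpos: "\<exists>w\<in>G i. \<forall>x\<in>X. T x (q - w) \<in> G (- 1)"
    if "i \<le> 0" "\<And>x. x \<in> X \<Longrightarrow> T x q \<in> G (i - int (d x))" for i q
  proof (intro bexI[of _ 0] ballI)
    fix x assume x: "x \<in> X"
    have "i - int (d x) < 0" using that(1) dpos[OF x] by simp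
    from Gneg[OF this] show "T x (q - 0) \<in> G (- 1)" using that(2)[OF x] by simp
  qed (rule cvec.subspace_0[OF G])
  have nat: "\<exists>w\<in>G (int n). \<forall>x\<in>X. T x (q - w) \<in> G (- 1)"
    if "\<And>x. x \<in> X \<Longrightarrow> T x q \<in> G (int n - int (d x))" for n q
    using that
  proof (induction n arbitrary: q)
    case 0
    then show ?case using nonpos[of 0 q] by simp
  next
    case (Suc n)
    have eq: "int (Suc n) - int (d x) - 1 = int n - int (d x)" for x by simp
    from exact_step[OF Suc.prems] obtain w where w: "w \<in> G (int (Suc n))"
      "\<And>x. x \<in> X \<Longrightarrow> T x (q - w) \<in> G (int n - int (d x))"
      unfolding eq by blast
    from Suc.IH[OF w(2)] obtain w' where w': "w' \<in> G (int n)" "\<And>x. x \<in> X \<Longrightarrow> T x (q - w - w') \<in> G (- 1)"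
      by blast
    have "w' \<in> G (int (Suc n))" using w'(1) Gmono[of "int n" "int (Suc n)"] by auto
    then have "w + w' \<in> G (int (Suc n))" by (rule cvec.subspace_add[OF G w(1)])
    then show ?case using w'(2) by (intro bexI[of _ "w + w'"]) (simp_all add: diff_diff_eq)
  qed
  show ?thesis
  proof (cases "i \<le> 0")
    case True
    then show ?thesis using nonpos q by blast
  next
    case False
    then show ?thesis using nat[of q "nat i"] q by simp
  qed
qed

end

section \<open>Homogeneous parts and superderivations of the enveloping algebra\<close>

lemma homogeneous_part_gr: "homogeneous_part p x \<in> gr p"
  and diff_homogeneous_part_gr: "x - homogeneous_part p x \<in> gr (p + 1)"
  using theI'[OF homogeneous_part_unique[of p x]] unfolding homogeneous_part_def by auto

lemma homogeneous_part_1: "homogeneous_part 1 x = x - homogeneous_part 0 x"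
  using diff_homogeneous_part_gr[of x 0] homogeneous_part_gr[of 0 x]
  by (intro homogeneous_part_eq) simp_all

lemma homogeneous_part_sum: "homogeneous_part 0 x + homogeneous_part 1 x = x"
  by (simp add: homogeneous_part_1)

lemma csubspace_gr: "csubspace (gr p)"
  by (simp add: cvec.subspace_def gr_zero gr_add gr_scaleC)

lemma homogeneous_part_add: "homogeneous_part p (x + y) = homogeneous_part p x + homogeneous_part p y"
proof (rule homogeneous_part_eq)
  have "x + y - (homogeneous_part p x + homogeneous_part p y)
      = (x - homogeneous_part p x) + (y - homogeneous_part p y)"
    by simp
  then show "x + y - (homogeneous_part p x + homogeneous_part p y) \<in> gr (p + 1)"
    by (metis gr_add diff_homogeneous_part_gr)
qed (simp add: gr_add homogeneous_part_gr)

lemma homogeneous_part_scaleC: "homogeneous_part p (c *\<^sub>C x) = c *\<^sub>C homogeneous_part p x"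
proof (rule homogeneous_part_eq)
  show "c *\<^sub>C x - c *\<^sub>C homogeneous_part p x \<in> gr (p + 1)"
    unfolding cvec.scale_right_diff_distrib[symmetric] by (intro gr_scaleC diff_homogeneous_part_gr)
qed (intro gr_scaleC homogeneous_part_gr)

lemma gr_disjoint: "x \<in> gr 0 \<Longrightarrow> x \<in> gr 1 \<Longrightarrow> x = 0"
  using gr_direct by blast

lemma homogeneous_part_same: "x \<in> gr p \<Longrightarrow> homogeneous_part p x = x"
  by (rule homogeneous_part_eq) (simp_all add: gr_zero)

lemma homogeneous_part_other: "x \<in> gr q \<Longrightarrow> p \<noteq> q \<Longrightarrow> homogeneous_part p x = 0"
  by (rule homogeneous_part_eq) (cases p; cases q; simp add: gr_zero)+

lemma ksign_ksign [simp]: "ksign p q * ksign p q = 1"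
  by (simp add: ksign_def)

lemma ksign_0 [simp]: "ksign 0 q = 1" "ksign p 0 = 1"
  by (simp_all add: ksign_def)

lemma ksign_commute: "ksign p q = ksign q p"
  by (auto simp: ksign_def)

lemma emb_zero: "emb 0 = 0"
  using emb_scaleC[of 0] by (metis cvec.scale_zero_left)

lemma emb_gr: "x \<in> gr p \<Longrightarrow> emb x \<in> gr p"
  unfolding gr_uea_def by (intro cvec.span_base CollectI exI[of _ "[x]"] exI[of _ "[p]"]) auto

lemma uea_parity_inv_gr: "x \<in> gr p \<Longrightarrow> uea_parity_inv x = ksign p p *\<^sub>C x"
  unfolding gr_uea_def
proof (induction rule: cvec.span_induct)
  case base
  show ?case unfolding cvec.subspace_def
    by (auto simp: uea_parity_inv_zero uea_parity_inv_add uea_parity_inv_scaleC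
        scaleC_add_right mult.commute)
next
  case (step x)
  then obtain xs ps where "x = prod_list (map emb xs)" "list_all2 (\<lambda>x q. x \<in> gr q) xs ps" "sum_list ps = p"
    by blast
  from this(2) have "uea_parity_inv (prod_list (map emb xs)) =
      ksign (sum_list ps) (sum_list ps) *\<^sub>C prod_list (map emb xs)"
  proof (induction rule: list_all2_induct)
    case Nil
    show ?case by (simp add: uea_parity_inv_one)
  next
    case (Cons x xs q ps)
    have "ksign (q + r) (q + r) = ksign q q * ksign r r" for r
      by (cases q; cases r) (simp_all add: ksign_def)
    then show ?case
      using Cons by (simp add: uea_parity_inv_mult uea_parity_inv_emb parity_inv_homogeneous
          emb_scaleC scaleC_mult_left scaleC_mult_right)
  qed
  then show ?case
    using \<open>x = _\<close> \<open>sum_list ps = p\<close> by simp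
qed

lemma uea_parity_inv_eq: "uea_parity_inv y = homogeneous_part 0 y - homogeneous_part 1 y"
  using uea_parity_inv_add[of "homogeneous_part 0 y" "homogeneous_part 1 y"]
  by (simp add: homogeneous_part_sum uea_parity_inv_gr[OF homogeneous_part_gr] ksign_def)

lemma uea_parity_inv_uea_parity_inv: "uea_parity_inv (uea_parity_inv y) = y"
proof (induction y rule: uea_induct)
  case (1 c xs)
  have "uea_parity_inv (uea_parity_inv (prod_list (map emb xs))) = prod_list (map emb xs)" for xs :: "'a list"
    by (induction xs) (simp_all add: uea_parity_inv_one uea_parity_inv_mult uea_parity_inv_emb parity_inv_parity_inv)
  then show ?case by (simp add: uea_parity_inv_scaleC)
qed (simp add: uea_parity_inv_add)

text \<open>A power of the parity automorphism with exponent in the two-element group, well defined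
  because the automorphism is an involution.\<close>

definition parity_pow :: "bit \<Rightarrow> 'g::lie_superalgebra uea \<Rightarrow> 'g uea"
  where "parity_pow p y = (if p = 1 then uea_parity_inv y else y)"

lemma parity_pow_0 [simp]: "parity_pow 0 y = y"
  by (simp add: parity_pow_def)

lemma parity_pow_zero [simp]: "parity_pow p 0 = 0"
  and parity_pow_one [simp]: "parity_pow p 1 = 1"
  and parity_pow_add: "parity_pow p (x + y) = parity_pow p x + parity_pow p y"
  and parity_pow_scaleC: "parity_pow p (c *\<^sub>C x) = c *\<^sub>C parity_pow p x"
  and parity_pow_mult: "parity_pow p (x * y) = parity_pow p x * parity_pow p y"
  by (simp_all add: parity_pow_def uea_parity_inv_zero uea_parity_inv_one uea_parity_inv_add
      uea_parity_inv_scaleC uea_parity_inv_mult)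

lemma parity_pow_diff: "parity_pow p (x - y) = parity_pow p x - parity_pow p y"
  using parity_pow_add[of p "x - y" y] by simp

lemma parity_pow_parity_pow: "parity_pow p (parity_pow q x) = parity_pow (p + q) x"
  by (cases p; cases q) (simp_all add: parity_pow_def uea_parity_inv_uea_parity_inv)

lemma parity_pow_emb: "a \<in> gr q \<Longrightarrow> parity_pow p (emb a) = ksign p q *\<^sub>C emb a"
  by (cases p; cases q)
     (simp_all add: parity_pow_def uea_parity_inv_gr[OF emb_gr] ksign_def)

text \<open>For \<open>a\<close> of parity \<open>p\<close> this is the adjoint action of \<open>a\<close> on the enveloping algebra, with the Koszul
  signs absorbed in the parity automorphism, so that \<open>y\<close> need not be homogeneous.\<close>

definition ad_op :: "bit \<Rightarrow> 'g::lie_superalgebra \<Rightarrow> 'g uea \<Rightarrow> 'g uea"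
  where "ad_op p a y = emb a * y - parity_pow p y * emb a"

lemma ad_op_add: "ad_op p a (x + y) = ad_op p a x + ad_op p a y"
  by (simp add: ad_op_def parity_pow_add algebra_simps)

lemma ad_op_scaleC: "ad_op p a (c *\<^sub>C x) = c *\<^sub>C ad_op p a x"
  by (simp add: ad_op_def parity_pow_scaleC scaleC_mult_left scaleC_mult_right cvec.scale_right_diff_distrib)

lemma clinear_ad_op: "clinear (ad_op p a)"
  by (rule clinearI) (simp_all add: ad_op_add ad_op_scaleC)

lemma ad_op_diff: "ad_op p a (x - y) = ad_op p a x - ad_op p a y"
  and ad_op_zero [simp]: "ad_op p a 0 = 0"
  by (simp_all add: module_hom.diff[OF clinear_ad_op] module_hom.zero[OF clinear_ad_op])

lemma ad_op_one [simp]: "ad_op p a 1 = 0"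
  by (simp add: ad_op_def)

lemma ad_op_add_left: "ad_op p (a + b) y = ad_op p a y + ad_op p b y"
  by (simp add: ad_op_def emb_add algebra_simps)

lemma ad_op_scaleC_left: "ad_op p (c *\<^sub>C a) y = c *\<^sub>C ad_op p a y"
  by (simp add: ad_op_def emb_scaleC scaleC_mult_left scaleC_mult_right cvec.scale_right_diff_distrib)

lemma ad_op_zero_left [simp]: "ad_op p 0 y = 0"
  by (simp add: ad_op_def emb_zero)

lemma ad_op_mult: "ad_op p a (x * y) = ad_op p a x * y + parity_pow p x * ad_op p a y"
  by (simp add: ad_op_def parity_pow_mult algebra_simps)

lemma bracket_zero [simp]: "bracket x 0 = 0" "bracket 0 x = 0"
  using bracket_scaleC_right[of x 0 0] bracket_scaleC_left[of 0 0 x] by (metis cvec.scale_zero_left)+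

lemma ad_op_emb:
  assumes "a \<in> gr p"
  shows "ad_op p a (emb b) = emb (bracket a b)"
proof -
  have "ad_op p a (emb b) = emb (bracket a b)" if "b \<in> gr q" for q b
    using emb_supercommutes[OF assms that]
    by (simp add: ad_op_def parity_pow_emb[OF that] scaleC_mult_left)
  from this[OF homogeneous_part_gr[of 0 b]] this[OF homogeneous_part_gr[of 1 b]]
  show ?thesis
    by (metis ad_op_add bracket_add_right emb_add homogeneous_part_sum)
qed

lemma parity_pow_ad_op:
  assumes "a \<in> gr p"
  shows "parity_pow q (ad_op p a y) = ksign p q *\<^sub>C ad_op p a (parity_pow q y)"
proof -
  have "parity_pow q (ad_op p a y)
      = ksign q p *\<^sub>C (emb a * parity_pow q y - parity_pow (q + p) y * emb a)"
    by (simp only: ad_op_def parity_pow_diff parity_pow_mult parity_pow_emb[OF assms] scaleC_mult_left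
      scaleC_mult_right cvec.scale_right_diff_distrib parity_pow_parity_pow)
  then show ?thesis
    by (simp only: ad_op_def parity_pow_parity_pow add.commute ksign_commute)
qed

text \<open>Only the inner operator is written out as two products. The twisted Leibniz rule yields
  \<open>bracket a b\<close> once from each, and these two terms form its adjoint action.\<close>

lemma ad_op_ad_op:
  assumes a: "a \<in> gr p" and b: "b \<in> gr q"
  shows "ad_op p a (ad_op q b y) = ad_op (p + q) (bracket a b) y + ksign p q *\<^sub>C ad_op q b (ad_op p a y)"
proof -
  have "ad_op p a (ad_op q b y) = emb (bracket a b) * y + parity_pow p (emb b) * ad_op p a y
      - (ad_op p a (parity_pow q y) * emb b + parity_pow p (parity_pow q y) * emb (bracket a b))"
    unfolding ad_op_def[of q b y] ad_op_diff ad_op_mult ad_op_emb[OF a] ..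
  also have "parity_pow p (emb b) = ksign p q *\<^sub>C emb b" by (rule parity_pow_emb[OF b])
  also have "ad_op p a (parity_pow q y) = ksign p q *\<^sub>C parity_pow q (ad_op p a y)"
    using parity_pow_ad_op[OF a] by simp
  finally have "ad_op p a (ad_op q b y) = (emb (bracket a b) * y - parity_pow (p + q) y * emb (bracket a b))
      + ksign p q *\<^sub>C (emb b * ad_op p a y - parity_pow q (ad_op p a y) * emb b)"
    unfolding parity_pow_parity_pow scaleC_mult_left cvec.scale_right_diff_distrib
    by (simp only: diff_conv_add_uminus minus_add_distrib ac_simps)
  then show ?thesis unfolding ad_op_def[symmetric] .
qed

lemma supercommutator_homogeneous:
  assumes "a \<in> gr p"
  shows "supercommutator (emb a) y = ad_op p a y"
proof -
  define y0 y1 where "y0 = homogeneous_part 0 y" and "y1 = homogeneous_part 1 y"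
  have y: "y = y0 + y1" "uea_parity_inv y = y0 - y1"
    by (simp_all add: y0_def y1_def homogeneous_part_sum uea_parity_inv_eq)
  have "homogeneous_part q (emb a) = (if q = p then emb a else 0)" for q
    using homogeneous_part_same[OF emb_gr[OF assms]] homogeneous_part_other[OF emb_gr[OF assms]] by auto
  then have "supercommutator (emb a) y = emb a * y0 + emb a * y1 - (y0 * emb a + ksign p 1 *\<^sub>C (y1 * emb a))"
    by (cases p) (simp_all add: supercommutator_def algebra_simps flip: y0_def y1_def)
  also have "\<dots> = emb a * y - parity_pow p y * emb a"
  proof -
    have "emb a * y = emb a * y0 + emb a * y1" by (simp add: y(1) distrib_left)
    moreover have "parity_pow p y * emb a = y0 * emb a + ksign p 1 *\<^sub>C (y1 * emb a)"
      by (cases p) (simp add: y(1) distrib_right, simp add: parity_pow_def y(2) ksign_def left_diff_distrib)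
    ultimately show ?thesis by simp
  qed
  finally show ?thesis by (simp add: ad_op_def)
qed

lemma supercommutator_add_left:
  "supercommutator (x + x') y = supercommutator x y + supercommutator x' y" for x :: "'g::lie_superalgebra uea"
  by (simp add: supercommutator_def homogeneous_part_add algebra_simps scaleC_add_right)

lemma supercommutator_scaleC_left:
  "supercommutator (c *\<^sub>C x) y = c *\<^sub>C supercommutator x y" for x :: "'g::lie_superalgebra uea"
  by (simp add: supercommutator_def homogeneous_part_scaleC scaleC_mult_left scaleC_mult_right
      scaleC_add_right cvec.scale_right_diff_distrib mult.commute)

section \<open>Gradings and character ideals\<close>

lemma left_ideal_character_ideal: "left_ideal (character_ideal \<chi> T)"
  unfolding character_ideal_def by (rule hull_in) (auto simp: left_ideal_def)

lemma character_ideal_zero: "0 \<in> character_ideal \<chi> T"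
  and character_ideal_add:
    "x \<in> character_ideal \<chi> T \<Longrightarrow> y \<in> character_ideal \<chi> T \<Longrightarrow> x + y \<in> character_ideal \<chi> T"
  and character_ideal_mult: "x \<in> character_ideal \<chi> T \<Longrightarrow> r * x \<in> character_ideal \<chi> T"
  using left_ideal_character_ideal[of \<chi> T] unfolding left_ideal_def by blast+

lemma character_ideal_scaleC: "x \<in> character_ideal \<chi> T \<Longrightarrow> c *\<^sub>C x \<in> character_ideal \<chi> T"
  using character_ideal_mult[of x \<chi> T "c *\<^sub>C 1"] by (simp add: scaleC_mult_left)

lemma csubspace_character_ideal: "csubspace (character_ideal \<chi> T)"
  by (simp add: cvec.subspace_def character_ideal_zero character_ideal_add character_ideal_scaleC)

lemmas character_ideal_diff = cvec.subspace_diff[OF csubspace_character_ideal]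
  and character_ideal_neg = cvec.subspace_neg[OF csubspace_character_ideal]

lemma character_ideal_gen: "x \<in> T \<Longrightarrow> emb x - \<chi> x *\<^sub>C 1 \<in> character_ideal \<chi> T"
  unfolding character_ideal_def by (rule hull_inc) blast

lemma character_ideal_minimal:
  assumes "left_ideal L" "\<And>x. x \<in> T \<Longrightarrow> emb x - \<chi> x *\<^sub>C 1 \<in> L"
  shows "character_ideal \<chi> T \<subseteq> L"
  unfolding character_ideal_def by (rule hull_minimal) (use assms in auto)

lemma character_ideal_mono: "T \<subseteq> T' \<Longrightarrow> character_ideal \<chi> T \<subseteq> character_ideal \<chi> T'"
  by (intro character_ideal_minimal left_ideal_character_ideal character_ideal_gen) auto

text \<open>Allows subspaces such as m to be replaced by sets of homogeneous generators, for which
  degrees and signs are available.\<close>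

lemma character_ideal_eqI:
  assumes "\<And>c x. \<chi> (c *\<^sub>C x) = c * \<chi> x" "\<And>x y. \<chi> (x + y) = \<chi> x + \<chi> y"
    and "cspan T = cspan T'"
  shows "character_ideal \<chi> T = character_ideal \<chi> T'"
proof -
  have "character_ideal \<chi> T \<subseteq> character_ideal \<chi> T'" if "T \<subseteq> cspan T'" for T T' :: "'a set"
  proof (intro character_ideal_minimal left_ideal_character_ideal)
    fix x assume "x \<in> T"
    then have "x \<in> cspan T'" using that by blast
    then show "emb x - \<chi> x *\<^sub>C 1 \<in> character_ideal \<chi> T'"
    proof (induction rule: cvec.span_induct_alt)
      case base
      have "\<chi> 0 = 0" using assms(1)[of 0 0] by simp
      then show ?case by (simp add: emb_zero character_ideal_zero)
    next
      case (step c x y)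
      have "emb (c *\<^sub>C x + y) - \<chi> (c *\<^sub>C x + y) *\<^sub>C 1
          = c *\<^sub>C (emb x - \<chi> x *\<^sub>C 1) + (emb y - \<chi> y *\<^sub>C 1)"
        by (simp add: emb_add emb_scaleC assms scaleC_add_left cvec.scale_right_diff_distrib)
      then show ?case
        using character_ideal_add[OF character_ideal_scaleC[OF character_ideal_gen[of x T' \<chi>]] step(2)] step(1)
        by simp
    qed
  qed
  moreover have "T \<subseteq> cspan T'" "T' \<subseteq> cspan T"
    using assms(3) cvec.span_superset by blast+
  ultimately show ?thesis by blast
qed

text \<open>On a generator the constant disappears and \<open>bracket a x\<close> remains; the
  Leibniz rule extends this to left multiples.\<close>

lemma ad_op_character_ideal:
  assumes "y \<in> character_ideal \<chi> T" "a \<in> gr p" "\<And>x. x \<in> T \<Longrightarrow> emb (bracket a x) \<in> character_ideal \<chi> T"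
  shows "ad_op p a y \<in> character_ideal \<chi> T"
proof -
  have "character_ideal \<chi> T \<subseteq> {y \<in> character_ideal \<chi> T. ad_op p a y \<in> character_ideal \<chi> T}"
  proof (rule character_ideal_minimal)
    show "left_ideal {y \<in> character_ideal \<chi> T. ad_op p a y \<in> character_ideal \<chi> T}"
      by (auto simp: left_ideal_def ad_op_add ad_op_mult character_ideal_zero
          intro: character_ideal_add character_ideal_mult)
    fix x assume "x \<in> T"
    then show "emb x - \<chi> x *\<^sub>C 1 \<in> {y \<in> character_ideal \<chi> T. ad_op p a y \<in> character_ideal \<chi> T}"
      using assms by (simp add: character_ideal_gen ad_op_diff ad_op_scaleC ad_op_emb)
  qed
  then show ?thesis using assms(1) by blast
qed

lemma parity_pow_character_ideal:
  assumes "y \<in> character_ideal \<chi> T"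
    and "\<And>x. x \<in> T \<Longrightarrow> x \<in> gr 0 \<or> (x \<in> gr 1 \<and> \<chi> x = 0)"
  shows "parity_pow p y \<in> character_ideal \<chi> T"
proof -
  have "character_ideal \<chi> T \<subseteq> {y. parity_pow p y \<in> character_ideal \<chi> T}"
  proof (rule character_ideal_minimal)
    show "left_ideal {y. parity_pow p y \<in> character_ideal \<chi> T}"
      by (auto simp: left_ideal_def parity_pow_add parity_pow_mult character_ideal_zero
          intro: character_ideal_add character_ideal_mult)
    fix x assume x: "x \<in> T"
    from assms(2)[OF x] show "emb x - \<chi> x *\<^sub>C 1 \<in> {y. parity_pow p y \<in> character_ideal \<chi> T}"
    proof
      assume "x \<in> gr 0"
      then show ?thesis
        using character_ideal_gen[OF x]
        by (simp add: parity_pow_diff parity_pow_emb parity_pow_scaleC)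
    next
      assume "x \<in> gr 1 \<and> \<chi> x = 0"
      then show ?thesis
        using character_ideal_gen[OF x, of \<chi>]
        by (auto simp: parity_pow_emb intro: character_ideal_scaleC)
    qed
  qed
  then show ?thesis using assms(1) by blast
qed

text \<open>Right multiplication by \<open>a\<close> is left multiplication minus the adjoint
  action, both applied to the parity twist of \<open>y\<close>.\<close>

lemma mult_emb_character_ideal:
  assumes "y \<in> character_ideal \<chi> T" "a \<in> gr p" "\<And>x. x \<in> T \<Longrightarrow> emb (bracket a x) \<in> character_ideal \<chi> T"
    and "\<And>x. x \<in> T \<Longrightarrow> x \<in> gr 0 \<or> (x \<in> gr 1 \<and> \<chi> x = 0)"
  shows "y * emb a \<in> character_ideal \<chi> T"
proof -
  have y: "parity_pow p y \<in> character_ideal \<chi> T"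
    using parity_pow_character_ideal assms by blast
  have "p + p = 0" by (cases p) simp_all
  then have "y * emb a = emb a * parity_pow p y - ad_op p a (parity_pow p y)"
    by (simp only: ad_op_def parity_pow_parity_pow parity_pow_0) simp
  then show ?thesis
    using character_ideal_diff character_ideal_mult[OF y] ad_op_character_ideal[OF y assms(2,3)] by metis
qed

text \<open>\<open>e\<close> has degree 2, \<open>ad h\<close> is diagonalizable over the integers, and \<open>ad e\<close> is injective on
  negative degrees: all that is used of the \<open>sl\<^sub>2\<close>-triple.\<close>

locale graded_form =
  fixes form :: "'g::lie_superalgebra \<Rightarrow> 'g \<Rightarrow> complex" and e h :: 'g
  assumes form: "basic_form form"
    and e_even: "e \<in> gr 0" and h_even: "h \<in> gr 0" and he: "bracket h e = 2 *\<^sub>C e"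
    and finite_dimensional: "\<exists>B :: 'g set. finite B \<and> cspan B = UNIV"
    and decomposition: "cspan (\<Union>i. eigenspace h i) = UNIV"
    and ad_e_injective: "x \<in> eigenspace h i \<Longrightarrow> i < 0 \<Longrightarrow> bracket e x = 0 \<Longrightarrow> x = 0"
    and degrees_bounded: "\<exists>D::nat. \<forall>i x. i < - int D \<longrightarrow> x \<in> eigenspace h i \<longrightarrow> x = 0"
begin

lemma form_add: "form (x + y) z = form x z + form y z" "form x (y + z) = form x y + form x z"
  and form_scaleC: "form (c *\<^sub>C x) y = c * form x y" "form x (c *\<^sub>C y) = c * form x y"
  and form_invariant: "form (bracket x y) z = form x (bracket y z)"
  and form_parity: "x \<in> gr p \<Longrightarrow> y \<in> gr q \<Longrightarrow> p \<noteq> q \<Longrightarrow> form x y = 0"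
  and form_nondegenerate: "(\<And>y. form x y = 0) \<Longrightarrow> x = 0"
  using form unfolding basic_form_def by blast+

lemma form_zero [simp]: "form 0 y = 0" "form x 0 = 0"
  using form_scaleC(1)[of 0 0 y] form_scaleC(2)[of x 0 0] by simp_all

lemma form_diff: "form (x - y) z = form x z - form y z" "form x (y - z) = form x y - form x z"
  using form_add(1)[of "x - y" y z] form_add(2)[of x "y - z" z] by simp_all

lemma form_minus: "form (- x) y = - form x y" "form x (- y) = - form x y"
  using form_diff(1)[of 0 x y] form_diff(2)[of x 0 y] by simp_all

section \<open>Weight spaces of fixed parity and their pairing under the form\<close>

definition wt :: "int \<Rightarrow> bit \<Rightarrow> 'g set"
  where "wt i p = eigenspace h i \<inter> gr p"

lemma csubspace_eigenspace: "csubspace (eigenspace h i)"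
  by (simp add: cvec.subspace_def eigenspace_def bracket_add_right bracket_scaleC_right scaleC_add_right mult.commute)

lemma csubspace_wt: "csubspace (wt i p)"
  unfolding wt_def by (rule cvec.subspace_inter[OF csubspace_eigenspace csubspace_gr])

lemma bracket_h_gr: "x \<in> gr p \<Longrightarrow> bracket h x \<in> gr p"
  using bracket_gr[OF h_even, of x p] by (simp only: add_0)

lemma bracket_diff_right: "bracket x (y - z) = bracket x y - bracket x z"
  using bracket_add_right[of x "y - z" z] by simp

lemma homogeneous_part_wt:
  assumes "x \<in> eigenspace h i"
  shows "homogeneous_part p x \<in> wt i p"
proof -
  have "bracket h (homogeneous_part p x) = homogeneous_part p (bracket h x)"
  proof (rule homogeneous_part_eq[symmetric])
    show "bracket h x - bracket h (homogeneous_part p x) \<in> gr (p + 1)"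
      unfolding bracket_diff_right[symmetric] by (intro bracket_h_gr diff_homogeneous_part_gr)
  qed (intro bracket_h_gr homogeneous_part_gr)
  also have "\<dots> = of_int i *\<^sub>C homogeneous_part p x"
    using assms by (simp add: eigenspace_def homogeneous_part_scaleC)
  finally show ?thesis by (simp add: wt_def eigenspace_def homogeneous_part_gr)
qed

lemma parity_inv_eigenspace: "x \<in> eigenspace h i \<Longrightarrow> parity_inv x \<in> eigenspace h i"
  unfolding parity_inv_def
  by (rule cvec.subspace_diff[OF csubspace_eigenspace]) (use homogeneous_part_wt in \<open>auto simp: wt_def\<close>)

lemma bracket_h_derivation: "bracket h (bracket x y) = bracket (bracket h x) y + bracket x (bracket h y)"
proof -
  have "bracket h (bracket x y) = bracket (bracket h x) y + bracket x (bracket h y)" if "x \<in> gr p" for x p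
    using bracket_super_Jacobi[OF h_even that] by simp
  from this[OF homogeneous_part_gr[of 0 x]] this[OF homogeneous_part_gr[of 1 x]]
  have "bracket h (bracket (homogeneous_part 0 x + homogeneous_part 1 x) y)
    = bracket (bracket h (homogeneous_part 0 x + homogeneous_part 1 x)) y
      + bracket (homogeneous_part 0 x + homogeneous_part 1 x) (bracket h y)"
    by (simp add: bracket_add_left bracket_add_right)
  then show ?thesis by (simp only: homogeneous_part_sum)
qed

lemma bracket_eigenspace:
  "x \<in> eigenspace h i \<Longrightarrow> y \<in> eigenspace h j \<Longrightarrow> bracket x y \<in> eigenspace h (i + j)"
  by (simp add: eigenspace_def bracket_h_derivation bracket_scaleC_left bracket_scaleC_right scaleC_add_left)

lemma bracket_wt: "x \<in> wt i p \<Longrightarrow> y \<in> wt j q \<Longrightarrow> bracket x y \<in> wt (i + j) (p + q)"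
  by (simp add: wt_def bracket_eigenspace bracket_gr del: add_bit_eq_xor)

lemma e_wt: "e \<in> wt 2 0"
  using e_even he by (simp add: wt_def eigenspace_def)

lemma bracket_h_skew: "bracket x h = - bracket h x"
proof -
  have "bracket x h = - bracket h x" if "x \<in> gr p" for x p
    using bracket_super_skew[OF that h_even] by simp
  from this[OF homogeneous_part_gr[of 0 x]] this[OF homogeneous_part_gr[of 1 x]]
  have "bracket (homogeneous_part 0 x + homogeneous_part 1 x) h
    = - bracket h (homogeneous_part 0 x + homogeneous_part 1 x)"
    by (simp add: bracket_add_left bracket_add_right)
  then show ?thesis by (simp only: homogeneous_part_sum)
qed

lemma form_orthogonal:
  assumes "x \<in> eigenspace h i" "y \<in> eigenspace h j" "i + j \<noteq> 0"
  shows "form x y = 0"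
proof -
  have "form (bracket h x) y = - form x (bracket h y)"
    using form_invariant[of x h y] by (simp add: bracket_h_skew form_minus) (metis minus_minus)
  then have "of_int (i + j) * form x y = 0"
    using assms(1,2) by (simp add: eigenspace_def form_scaleC algebra_simps)
  moreover have "(of_int (i + j) :: complex) \<noteq> 0" using assms(3) by (simp only: of_int_eq_0_iff) simp
  ultimately show ?thesis by simp
qed

lemma chi_degree: "x \<in> eigenspace h i \<Longrightarrow> i \<noteq> - 2 \<Longrightarrow> form e x = 0"
  using form_orthogonal[of e 2 x i] e_wt by (auto simp: wt_def)

lemma chi_odd: "x \<in> gr 1 \<Longrightarrow> form e x = 0"
  using form_parity[OF e_even] by simp

text \<open>The component of \<open>y\<close> of degree \<open>i\<close> and parity
  \<open>p\<close>, recorded through its pairings alone; it is assembled along a linear combination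
  of eigenvectors, since all other components are orthogonal to \<open>wt (- i) p\<close>.\<close>

lemma weight_projection:
  "\<exists>y'\<in>wt i p. \<forall>z\<in>wt (- i) p. form z (y - y') = 0"
proof -
  have "y \<in> cspan (\<Union>i. eigenspace h i)" by (simp add: decomposition)
  then show ?thesis
  proof (induction rule: cvec.span_induct_alt)
    case base
    show ?case by (intro bexI[of _ 0]) (simp_all add: cvec.subspace_0[OF csubspace_wt])
  next
    case (step c x y)
    then obtain j y' where x: "x \<in> eigenspace h j" and y': "y' \<in> wt i p"
      and y: "\<And>z. z \<in> wt (- i) p \<Longrightarrow> form z (y - y') = 0"
      by auto
    show ?case
    proof (cases "j = i")
      case True
      show ?thesis
      proof (intro bexI ballI)
        show "c *\<^sub>C homogeneous_part p x + y' \<in> wt i p"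
          using homogeneous_part_wt[OF x, of p] True y'
          by (intro cvec.subspace_add[OF csubspace_wt] cvec.subspace_scale[OF csubspace_wt]) auto
        fix z assume z: "z \<in> wt (- i) p"
        have "c *\<^sub>C x + y - (c *\<^sub>C homogeneous_part p x + y')
            = c *\<^sub>C (x - homogeneous_part p x) + (y - y')"
          by (simp add: cvec.scale_right_diff_distrib)
        moreover have "form z (x - homogeneous_part p x) = 0"
          using z diff_homogeneous_part_gr[of x p] by (intro form_parity[of _ p _ "p + 1"]) (auto simp: wt_def)
        ultimately show "form z (c *\<^sub>C x + y - (c *\<^sub>C homogeneous_part p x + y')) = 0"
          using y[OF z] by (simp only: form_add form_scaleC) simp
      qed
    next
      case False
      show ?thesis
      proof (intro bexI[OF _ y'] ballI)
        fix z assume z: "z \<in> wt (- i) p"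
        have "form z x = 0" using form_orthogonal[of z "- i" x j] z x False by (auto simp: wt_def)
        moreover have "c *\<^sub>C x + y - y' = c *\<^sub>C x + (y - y')" by simp
        ultimately show "form z (c *\<^sub>C x + y - y') = 0"
          using y[OF z] by (simp only: form_add form_scaleC) simp
      qed
    qed
  qed
qed

text \<open>If some \<open>y0\<close> annihilates \<open>Z\<close> but not \<open>z\<close>,
  subtract the multiple of \<open>z\<close> that agrees with \<open>x\<close> on \<open>y0\<close>;
  otherwise \<open>z\<close> imposes no new condition on annihilators of \<open>Z\<close>.\<close>

lemma span_if_annihilators:
  assumes "finite Z" "\<And>y. (\<And>z. z \<in> Z \<Longrightarrow> form z y = 0) \<Longrightarrow> form x y = 0"
  shows "x \<in> cspan Z"
  using assms
proof (induction Z arbitrary: x)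
  case empty
  have "x = 0" by (rule form_nondegenerate) (use empty in blast)
  then show ?case by (simp add: cvec.span_zero)
next
  case (insert z Z)
  show ?case
  proof (cases "\<exists>y. (\<forall>w\<in>Z. form w y = 0) \<and> form z y \<noteq> 0")
    case True
    then obtain y0 where y0: "\<And>w. w \<in> Z \<Longrightarrow> form w y0 = 0" "form z y0 \<noteq> 0" by blast
    define k where "k = form x y0 / form z y0"
    have "x - k *\<^sub>C z \<in> cspan Z"
    proof (rule insert.IH)
      fix y assume y: "\<And>w. w \<in> Z \<Longrightarrow> form w y = 0"
      define y' where "y' = y - (form z y / form z y0) *\<^sub>C y0"
      have "form w y' = 0" if "w \<in> insert z Z" for w
        using that y0 y by (auto simp: y'_def form_diff form_scaleC)
      then have "form x y' = 0" by (rule insert.prems)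
      then show "form (x - k *\<^sub>C z) y = 0"
        by (simp add: y'_def k_def form_diff form_scaleC)
    qed
    then have "(x - k *\<^sub>C z) + k *\<^sub>C z \<in> cspan (insert z Z)"
      using cvec.span_mono[of Z "insert z Z"]
      by (intro cvec.span_add cvec.span_scale cvec.span_base[of z]) auto
    then show ?thesis by simp
  next
    case False
    have "x \<in> cspan Z"
      by (rule insert.IH) (rule insert.prems, use False in blast)
    then show ?thesis using cvec.span_mono[of Z "insert z Z"] by blast
  qed
qed

text \<open>Since \<open>ad e\<close> is injective on \<open>wt (- d) p\<close>, the functionals \<open>y \<mapsto> \<chi>([x, y])\<close> for \<open>x\<close> in \<open>B\<close> are
  linearly independent.\<close>

lemma dual_element:
  assumes B: "finite B" "cindependent B" "B \<subseteq> wt (- int d) p" and d: "d > 0" and x: "x \<in> B"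
  shows "\<exists>y\<in>wt (int d - 2) p. \<forall>x'\<in>B. form e (bracket x' y) = (if x' = x then 1 else 0)"
proof -
  have inj: "x = 0" if "bracket e x = 0" "x \<in> cspan B" for x
  proof -
    have "cspan B \<subseteq> wt (- int d) p"
      by (rule cvec.span_minimal[OF B(3) csubspace_wt])
    then have "x \<in> eigenspace h (- int d)" using that(2) by (auto simp: wt_def)
    from ad_e_injective[OF this _ that(1)] d show ?thesis by simp
  qed
  \<comment> \<open>Otherwise \<open>bracket e x\<close> lies in the span of the other
    \<open>bracket e x'\<close>, and injectivity of \<open>ad e\<close> on the span of
    \<open>B\<close> contradicts independence.\<close>
  have "\<exists>y. (\<forall>x'\<in>B - {x}. form (bracket e x') y = 0) \<and> form (bracket e x) y \<noteq> 0"
  proof (rule ccontr)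
    assume *: "\<not> ?thesis"
    have "bracket e x \<in> cspan (bracket e ` (B - {x}))"
    proof (rule span_if_annihilators)
      fix y assume y: "\<And>z. z \<in> bracket e ` (B - {x}) \<Longrightarrow> form z y = 0"
      then have "\<forall>x'\<in>B - {x}. form (bracket e x') y = 0" by blast
      with * show "form (bracket e x) y = 0" by blast
    qed (use B(1) in simp)
    moreover have lin: "clinear (bracket e)"
      by (rule clinearI) (simp_all add: bracket_add_right bracket_scaleC_right)
    ultimately obtain x' where x': "x' \<in> cspan (B - {x})" "bracket e x = bracket e x'"
      unfolding module_hom.span_image[OF lin] by blast
    have "x' \<in> cspan B" using x'(1) cvec.span_mono[of "B - {x}" B] by blast
    then have "x - x' \<in> cspan B" using x by (intro cvec.span_diff cvec.span_base[of x])
    moreover have "bracket e (x - x') = 0" using x'(2) by (simp add: bracket_diff_right)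
    ultimately have "x = x'" using inj[of "x - x'"] by simp
    then show False using x'(1) x B(2) unfolding cvec.dependent_def by blast
  qed
  then obtain y where y: "\<And>x'. x' \<in> B \<Longrightarrow> x' \<noteq> x \<Longrightarrow> form (bracket e x') y = 0" "form (bracket e x) y \<noteq> 0"
    by blast
  \<comment> \<open>Projecting to degree \<open>d - 2\<close> keeps the pairings, since each
    \<open>bracket e x'\<close> has degree \<open>2 - d\<close> and parity \<open>p\<close>.\<close>
  obtain y' where y': "y' \<in> wt (int d - 2) p" "\<And>z. z \<in> wt (- (int d - 2)) p \<Longrightarrow> form z (y - y') = 0"
    using weight_projection by blast
  have form_y': "form e (bracket x' y') = form (bracket e x') y" if "x' \<in> B" for x'
  proof -
    have "bracket e x' \<in> wt (2 + - int d) (0 + p)"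
      using that B(3) by (intro bracket_wt e_wt) auto
    then have "form (bracket e x') (y - y') = 0"
      by (intro y'(2)) simp
    then show ?thesis by (simp add: form_invariant form_diff)
  qed
  show ?thesis
  proof (intro bexI ballI)
    show "(1 / form (bracket e x) y) *\<^sub>C y' \<in> wt (int d - 2) p"
      by (rule cvec.subspace_scale[OF csubspace_wt y'(1)])
    fix x' assume "x' \<in> B"
    then show "form e (bracket x' ((1 / form (bracket e x) y) *\<^sub>C y')) = (if x' = x then 1 else 0)"
      using y by (simp add: bracket_scaleC_right form_scaleC form_y')
  qed
qed

end

section \<open>The Kazhdan filtration\<close>

lemma clinear_span:
  assumes "clinear T" "csubspace A" "\<And>x. x \<in> S \<Longrightarrow> T x \<in> A" "y \<in> cspan S"
  shows "T y \<in> A"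
proof -
  have "csubspace {y. T y \<in> A}"
    using assms(1,2) by (auto simp: cvec.subspace_def module_hom.zero[OF assms(1)]
      module_hom.add[OF assms(1)] module_hom.scale[OF assms(1)])
  then have "cspan S \<subseteq> {y. T y \<in> A}"
    using assms(3) by (intro cvec.span_minimal) auto
  then show ?thesis using assms(4) by blast
qed

lemma clinear_times: "clinear (\<lambda>y. z * y)" "clinear (\<lambda>y. y * z)"
  for z :: "'g::lie_superalgebra uea"
  by (auto intro!: clinearI simp: distrib_left distrib_right scaleC_mult_left scaleC_mult_right)

lemma clinear_parity_pow: "clinear (parity_pow p)"
  by (rule clinearI) (simp_all add: parity_pow_add parity_pow_scaleC)

text \<open>The number \<open>n\<close> of letters, which the Kazhdan filtration forgets, drives the
  induction in \<open>words_negative\<close>.\<close>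

definition words :: "'g::lie_superalgebra \<Rightarrow> nat \<Rightarrow> int \<Rightarrow> 'g uea set"
  where "words h n i = {prod_list (map emb xs) |xs js. length xs = n \<and>
    list_all2 (\<lambda>x j. x \<in> eigenspace h j) xs js \<and> sum_list (map (\<lambda>j. j + 2) js) \<le> i}"

lemma kazhdan_words: "kazhdan h i = cspan (\<Union>n. words h n i)"
  unfolding kazhdan_def words_def by (rule arg_cong[where f = cspan]) blast

lemma wordsE:
  assumes "y \<in> words h n i"
  obtains xs js where "y = prod_list (map emb xs)" "length xs = n"
    "list_all2 (\<lambda>x j. x \<in> eigenspace h j) xs js" "sum_list (map (\<lambda>j. j + 2) js) \<le> i"
  using assms unfolding words_def by blast

lemma wordsI:
  "list_all2 (\<lambda>x j. x \<in> eigenspace h j) xs js \<Longrightarrow> sum_list (map (\<lambda>j. j + 2) js) \<le> i \<Longrightarrow>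
    prod_list (map emb xs) \<in> words h (length xs) i"
  unfolding words_def by blast

lemma span_words_Cons:
  assumes "x \<in> eigenspace h j" "y \<in> cspan (words h n i)"
  shows "emb x * y \<in> cspan (words h (Suc n) (i + j + 2))"
  using clinear_times(1) cvec.subspace_span _ assms(2)
proof (rule clinear_span)
  fix y assume "y \<in> words h n i"
  then obtain xs js where y: "y = prod_list (map emb xs)" "length xs = n"
    "list_all2 (\<lambda>x j. x \<in> eigenspace h j) xs js" "sum_list (map (\<lambda>j. j + 2) js) \<le> i"
    by (rule wordsE)
  then have "prod_list (map emb (x # xs)) \<in> words h (length (x # xs)) (i + j + 2)"
    using assms(1) by (intro wordsI[of _ _ "j # js"]) simp_all
  then show "emb x * y \<in> cspan (words h (Suc n) (i + j + 2))"
    using y by (intro cvec.span_base) simp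
qed

lemma span_words_snoc:
  assumes "x \<in> eigenspace h j" "y \<in> cspan (words h n i)"
  shows "y * emb x \<in> cspan (words h (Suc n) (i + j + 2))"
  using clinear_times(2) cvec.subspace_span _ assms(2)
proof (rule clinear_span)
  fix y assume "y \<in> words h n i"
  then obtain xs js where y: "y = prod_list (map emb xs)" "length xs = n"
    "list_all2 (\<lambda>x j. x \<in> eigenspace h j) xs js" "sum_list (map (\<lambda>j. j + 2) js) \<le> i"
    by (rule wordsE)
  then have "prod_list (map emb (xs @ [x])) \<in> words h (length (xs @ [x])) (i + j + 2)"
    using assms(1) by (intro wordsI[of _ _ "js @ [j]"]) (simp_all add: list_all2_appendI)
  then show "y * emb x \<in> cspan (words h (Suc n) (i + j + 2))"
    using y by (intro cvec.span_base) simp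
qed

lemma span_words_append:
  assumes "list_all2 (\<lambda>x j. x \<in> eigenspace h j) xs js" "y \<in> cspan (words h n i)"
  shows "prod_list (map emb xs) * y \<in> cspan (words h (length xs + n) (sum_list (map (\<lambda>j. j + 2) js) + i))"
  using assms(1)
proof (induction rule: list_all2_induct)
  case Nil
  show ?case using assms(2) by simp
next
  case (Cons x xs j js)
  from span_words_Cons[OF Cons(1) Cons.IH] show ?case by (simp add: mult.assoc algebra_simps)
qed

context graded_form
begin

text \<open>Letters of a word are weight vectors of possibly mixed parity, so the automorphism may
  change the letter, but not its degree.\<close>

lemma parity_pow_emb_eigenspace:
  assumes "x \<in> eigenspace h j"
  obtains x' where "parity_pow p (emb x) = emb x'" "x' \<in> eigenspace h j"
  using that[of x] that[of "parity_inv x"] assms parity_inv_eigenspace[OF assms]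
  by (cases "p = 1") (simp_all add: parity_pow_def uea_parity_inv_emb)

lemma parity_pow_words:
  assumes "list_all2 (\<lambda>x j. x \<in> eigenspace h j) xs js" "sum_list (map (\<lambda>j. j + 2) js) \<le> i"
  shows "parity_pow p (prod_list (map emb xs)) \<in> cspan (words h (length xs) i)"
  using assms
proof (induction arbitrary: i rule: list_all2_induct)
  case Nil
  have "prod_list (map emb []) \<in> words h (length ([] :: 'g list)) i"
    using Nil by (intro wordsI[of _ _ "[]"]) simp_all
  then show ?case by (auto intro: cvec.span_base)
next
  case (Cons x xs j js)
  obtain x' where x': "parity_pow p (emb x) = emb x'" "x' \<in> eigenspace h j"
    using parity_pow_emb_eigenspace[OF Cons(1)] .
  have "parity_pow p (prod_list (map emb xs)) \<in> cspan (words h (length xs) (i - j - 2))"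
    using Cons.prems by (intro Cons.IH) simp
  from span_words_Cons[OF x'(2) this] show ?case
    by (simp add: parity_pow_mult x'(1))
qed

lemma ad_op_words:
  assumes a: "a \<in> wt d p"
    and "list_all2 (\<lambda>x j. x \<in> eigenspace h j) xs js" "sum_list (map (\<lambda>j. j + 2) js) \<le> i"
  shows "ad_op p a (prod_list (map emb xs)) \<in> cspan (words h (length xs) (i + d))"
  using assms(2,3)
proof (induction arbitrary: i rule: list_all2_induct)
  case Nil
  show ?case by (simp add: cvec.span_zero)
next
  case (Cons x xs j js)
  have a': "a \<in> gr p" "a \<in> eigenspace h d" using a by (auto simp: wt_def)
  obtain x' where x': "parity_pow p (emb x) = emb x'" "x' \<in> eigenspace h j"
    using parity_pow_emb_eigenspace[OF Cons(1)] .
  have le: "sum_list (map (\<lambda>j. j + 2) js) \<le> i - j - 2" using Cons.prems by simp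
  have "prod_list (map emb xs) \<in> cspan (words h (length xs) (i - j - 2))"
    using wordsI[OF Cons(2) le] by (rule cvec.span_base)
  from span_words_Cons[OF bracket_eigenspace[OF a'(2) Cons(1)] this]
  have "emb (bracket a x) * prod_list (map emb xs) \<in> cspan (words h (Suc (length xs)) (i + d))"
    by (simp add: algebra_simps)
  moreover from span_words_Cons[OF x'(2) Cons.IH[OF le]]
  have "emb x' * ad_op p a (prod_list (map emb xs)) \<in> cspan (words h (Suc (length xs)) (i + d))"
    by (simp add: algebra_simps)
  ultimately show ?case
    by (simp add: ad_op_mult ad_op_emb[OF a'(1)] x'(1) cvec.span_add)
qed

lemma ad_op_span_words:
  assumes a: "a \<in> wt d p" and "y \<in> cspan (words h n i)"
  shows "ad_op p a y \<in> cspan (words h n (i + d))"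
  using clinear_ad_op cvec.subspace_span _ assms(2)
  by (rule clinear_span) (use ad_op_words[OF a] in \<open>auto elim!: wordsE\<close>)

text \<open>Homogeneous vectors only, to have degrees and parities of generators at hand; by
  \<open>span_low\<close> they span the intended subspace.\<close>

definition low :: "'g set"
  where "low = (\<Union>i\<in>{..- 2}. \<Union>p. wt i p)"

abbreviation chi_ideal :: "'g set \<Rightarrow> 'g uea set"
  where "chi_ideal \<equiv> character_ideal (form e)"

lemma lowI: "x \<in> wt i p \<Longrightarrow> i \<le> - 2 \<Longrightarrow> x \<in> low"
  unfolding low_def by blast

lemma parity_or_chi_zero: "x \<in> wt i p \<Longrightarrow> x \<in> gr 0 \<or> (x \<in> gr 1 \<and> form e x = 0)"
  using chi_odd by (cases p) (auto simp: wt_def)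

lemma low_parity: "x \<in> low \<Longrightarrow> x \<in> gr 0 \<or> (x \<in> gr 1 \<and> form e x = 0)"
  unfolding low_def using parity_or_chi_zero by blast

lemma chi_ideal_emb: "x \<in> T \<Longrightarrow> form e x = 0 \<Longrightarrow> emb x \<in> chi_ideal T"
  using character_ideal_gen[of x T "form e"] by simp

lemma bracket_low:
  assumes "a \<in> wt i p" "x \<in> wt j q" "i + j \<le> - 3"
  shows "emb (bracket a x) \<in> chi_ideal low"
proof (rule chi_ideal_emb)
  have *: "bracket a x \<in> wt (i + j) (p + q)" by (rule bracket_wt[OF assms(1,2)])
  then show "bracket a x \<in> low" using assms(3) by (intro lowI) auto
  show "form e (bracket a x) = 0" using * assms(3) by (intro chi_degree[of _ "i + j"]) (auto simp: wt_def)
qed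

lemma bracket_low': "a \<in> wt i p \<Longrightarrow> i \<le> - 1 \<Longrightarrow> x \<in> low \<Longrightarrow> emb (bracket a x) \<in> chi_ideal low"
proof -
  assume a: "a \<in> wt i p" "i \<le> - 1" and "x \<in> low"
  then obtain j q where "x \<in> wt j q" "j \<le> - 2" unfolding low_def by blast
  with a show ?thesis by (intro bracket_low) auto
qed

lemma ad_op_low: "a \<in> wt i p \<Longrightarrow> i \<le> - 1 \<Longrightarrow> y \<in> chi_ideal low \<Longrightarrow> ad_op p a y \<in> chi_ideal low"
  by (rule ad_op_character_ideal) (auto simp: wt_def bracket_low'[unfolded wt_def])

lemma parity_pow_low: "y \<in> chi_ideal low \<Longrightarrow> parity_pow p y \<in> chi_ideal low"
  by (rule parity_pow_character_ideal) (auto dest: low_parity)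

lemma mult_emb_low:
  assumes "a \<in> wt i p" "i \<le> - 1" "y \<in> chi_ideal low"
  shows "y * emb a \<in> chi_ideal low"
  by (rule mult_emb_character_ideal[of _ _ _ _ p]) (use assms low_parity bracket_low' in \<open>auto simp: wt_def\<close>)

text \<open>For odd \<open>z\<close> both the sign twist and the scalar are harmless, because chi
  vanishes on odd elements and \<open>emb z\<close> is in the ideal.\<close>

lemma mult_emb_mod_low:
  assumes "z \<in> wt j q" "j \<le> - 2"
  shows "parity_pow q v * emb z - form e z *\<^sub>C v \<in> chi_ideal low"
proof -
  have zl: "z \<in> low" using assms by (rule lowI)
  show ?thesis
  proof (cases "q = 0")
    case True
    then show ?thesis
      using character_ideal_mult[OF character_ideal_gen[OF zl, of "form e"], of v]
      by (simp add: right_diff_distrib scaleC_mult_right)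
  next
    case False
    then have "q = 1" by (cases q) simp_all
    then have "form e z = 0" using assms chi_odd by (auto simp: wt_def)
    then show ?thesis
      using character_ideal_mult[OF chi_ideal_emb[OF zl]] by simp
  qed
qed

lemma emb_mult_mod_low:
  assumes "z \<in> wt j q" "j \<le> - 2"
  shows "emb z * v - (form e z *\<^sub>C v + ad_op q z v) \<in> chi_ideal low"
  using mult_emb_mod_low[OF assms, of v] by (simp add: ad_op_def algebra_simps)

lemma letter_of_low_degree:
  assumes "(\<Sum>j\<leftarrow>js. j + 2) < (0::int)"
  shows "\<exists>j\<in>set js. j \<le> - 3"
proof (rule ccontr)
  assume "\<not> ?thesis"
  then have "0 \<le> (\<Sum>j\<leftarrow>js. j + 2)" by (intro sum_list_nonneg) force
  then show False using assms by simp
qed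

text \<open>A word of negative degree has a letter of degree at most \<open>-3\<close>; moving it to the right end
  puts it into the ideal, up to shorter words of negative degree.\<close>

lemma words_negative: "i < 0 \<Longrightarrow> cspan (words h n i) \<subseteq> chi_ideal low"
proof (induction n arbitrary: i)
  case 0
  have "words h 0 i = {}" using 0 by (auto simp: words_def)
  then show ?case by (simp add: character_ideal_zero)
next
  case (Suc n)
  show ?case
  proof (rule cvec.span_minimal[OF _ csubspace_character_ideal], rule subsetI)
    fix y assume "y \<in> words h (Suc n) i"
    then obtain xs js where y: "y = prod_list (map emb xs)" and len: "length xs = Suc n"
      and xs: "list_all2 (\<lambda>x j. x \<in> eigenspace h j) xs js" and le: "sum_list (map (\<lambda>j. j + 2) js) \<le> i"
      by (rule wordsE)
    obtain j where "j \<in> set js" "j \<le> - 3"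
      using letter_of_low_degree[of js] le Suc.prems by auto
    then obtain js1 js2 where js: "js = js1 @ j # js2" by (meson split_list)
    obtain xs1 x xs2 where xs': "xs = xs1 @ x # xs2" "list_all2 (\<lambda>x j. x \<in> eigenspace h j) xs1 js1"
      "x \<in> eigenspace h j" "list_all2 (\<lambda>x j. x \<in> eigenspace h j) xs2 js2"
      using xs unfolding js list_all2_append2 list_all2_Cons2 by blast
    let ?d = "\<lambda>js. sum_list (map (\<lambda>j. j + 2) js) :: int"
    have part: "prod_list (map emb xs1) * (emb x' * prod_list (map emb xs2)) \<in> chi_ideal low"
      if x': "x' \<in> wt j p" for x' p
    proof -
      have "ad_op p x' (prod_list (map emb xs2)) \<in> cspan (words h (length xs2) (?d js2 + j))"
        by (rule ad_op_words[OF x' xs'(4)]) simp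
      from span_words_append[OF xs'(2) this]
      have "prod_list (map emb xs1) * ad_op p x' (prod_list (map emb xs2))
          \<in> cspan (words h n (?d js1 + (?d js2 + j)))"
        using len xs'(1) by simp
      \<comment> \<open>The whole word has sum \<open>?d js1 + (j + 2) + ?d js2\<close>; absorbing
        the letter by a bracket lowers it by 2 and shortens the word by one.\<close>
      moreover have "?d js1 + (?d js2 + j) < 0" using le Suc.prems js by simp
      ultimately have 1: "prod_list (map emb xs1) * ad_op p x' (prod_list (map emb xs2)) \<in> chi_ideal low"
        using Suc.IH by blast
      have "emb x' \<in> chi_ideal low"
      proof (rule chi_ideal_emb)
        show "x' \<in> low" using x' \<open>j \<le> - 3\<close> by (intro lowI) auto
        show "form e x' = 0" using x' \<open>j \<le> - 3\<close> by (intro chi_degree[of _ j]) (auto simp: wt_def)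
      qed
      then have "prod_list (map emb xs1) * (parity_pow p (prod_list (map emb xs2)) * emb x') \<in> chi_ideal low"
        by (intro character_ideal_mult)
      from character_ideal_add[OF 1 this] show ?thesis
        by (simp add: ad_op_def algebra_simps)
    qed
    have "emb x = emb (homogeneous_part 0 x) + emb (homogeneous_part 1 x)"
      by (simp flip: emb_add add: homogeneous_part_sum)
    then have "y = prod_list (map emb xs1) * (emb (homogeneous_part 0 x) * prod_list (map emb xs2))
        + prod_list (map emb xs1) * (emb (homogeneous_part 1 x) * prod_list (map emb xs2))"
      using y xs'(1) by (simp add: distrib_left distrib_right mult.assoc)
    then show "y \<in> chi_ideal low"
      using part[OF homogeneous_part_wt[OF xs'(3)]] by (simp add: character_ideal_add)
  qed
qed

section \<open>The Kazhdan filtration, on the enveloping algebra and modulo the ideal of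
  \<open>low\<close>\<close>

lemma csubspace_kazhdan: "csubspace (kazhdan h i)"
  unfolding kazhdan_def by (rule cvec.subspace_span)

lemma span_words_kazhdan: "cspan (words h n i) \<subseteq> kazhdan h i"
  unfolding kazhdan_words by (rule cvec.span_mono) blast

lemma kazhdan_image:
  assumes "clinear T" "\<And>n y. y \<in> cspan (words h n i) \<Longrightarrow> T y \<in> cspan (words h (f n) i')" "y \<in> kazhdan h i"
  shows "T y \<in> kazhdan h i'"
  using assms(1) csubspace_kazhdan _ assms(3)[unfolded kazhdan_words]
  by (rule clinear_span) (use assms(2) span_words_kazhdan cvec.span_base in blast)

lemma kazhdan_mono: "i \<le> i' \<Longrightarrow> kazhdan h i \<subseteq> kazhdan h i'"
  unfolding kazhdan_def by (rule cvec.span_mono) (auto intro: order_trans)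

lemma ad_op_kazhdan: "a \<in> wt d p \<Longrightarrow> y \<in> kazhdan h i \<Longrightarrow> ad_op p a y \<in> kazhdan h (i + d)"
  using clinear_ad_op ad_op_span_words by (rule kazhdan_image)

lemma emb_mult_kazhdan: "x \<in> eigenspace h j \<Longrightarrow> y \<in> kazhdan h i \<Longrightarrow> emb x * y \<in> kazhdan h (i + j + 2)"
  using clinear_times(1) span_words_Cons by (rule kazhdan_image)

lemma mult_emb_kazhdan: "x \<in> eigenspace h j \<Longrightarrow> y \<in> kazhdan h i \<Longrightarrow> y * emb x \<in> kazhdan h (i + j + 2)"
  using clinear_times(2) span_words_snoc by (rule kazhdan_image)

lemma parity_pow_kazhdan:
  assumes "y \<in> kazhdan h i"
  shows "parity_pow p y \<in> kazhdan h i"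
proof (rule kazhdan_image[OF clinear_parity_pow _ assms])
  fix n y assume "y \<in> cspan (words h n i)"
  with clinear_parity_pow cvec.subspace_span _ show "parity_pow p y \<in> cspan (words h n i)"
    by (rule clinear_span) (use parity_pow_words in \<open>auto elim!: wordsE\<close>)
qed

lemma kazhdan_negative: "i < 0 \<Longrightarrow> kazhdan h i \<subseteq> chi_ideal low"
  unfolding kazhdan_words
  by (rule cvec.span_minimal[OF _ csubspace_character_ideal])
     (use words_negative cvec.span_superset in blast)

lemma kazhdan_exhaustive: "\<exists>i. y \<in> kazhdan h i"
proof (induction y rule: uea_induct)
  case (1 c xs)
  have "\<exists>i. prod_list (map emb xs) \<in> kazhdan h i" for xs :: "'g list"
  proof (induction xs)
    case Nil
    have "prod_list (map emb []) \<in> words h (length ([] :: 'g list)) 0"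
      by (intro wordsI[of _ _ "[]"]) simp_all
    then show ?case using span_words_kazhdan cvec.span_base by blast
  next
    case (Cons x xs)
    then obtain i where i: "prod_list (map emb xs) \<in> kazhdan h i" by blast
    have "x \<in> cspan (\<Union>i. eigenspace h i)" by (simp add: decomposition)
    then have "\<exists>k. emb x * prod_list (map emb xs) \<in> kazhdan h k"
    proof (induction rule: cvec.span_induct_alt)
      case base
      show ?case using cvec.subspace_0[OF csubspace_kazhdan] by (simp add: emb_zero)
    next
      case (step c x y)
      then obtain j k where "emb x * prod_list (map emb xs) \<in> kazhdan h j"
        "emb y * prod_list (map emb xs) \<in> kazhdan h k"
        using emb_mult_kazhdan i by blast
      then have "emb x * prod_list (map emb xs) \<in> kazhdan h (max j k)"
        "emb y * prod_list (map emb xs) \<in> kazhdan h (max j k)"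
        using kazhdan_mono[of j "max j k"] kazhdan_mono[of k "max j k"] by auto
      then have "c *\<^sub>C (emb x * prod_list (map emb xs)) + emb y * prod_list (map emb xs) \<in> kazhdan h (max j k)"
        by (intro cvec.subspace_add[OF csubspace_kazhdan] cvec.subspace_scale[OF csubspace_kazhdan])
      then show ?case
        by (auto simp: emb_add emb_scaleC distrib_right scaleC_mult_left)
    qed
    then show ?case by simp
  qed
  then show ?case using cvec.subspace_scale[OF csubspace_kazhdan] by blast
next
  case (2 x y)
  then obtain j k where "x \<in> kazhdan h j" "y \<in> kazhdan h k" by blast
  then have "x \<in> kazhdan h (max j k)" "y \<in> kazhdan h (max j k)"
    using kazhdan_mono[of j "max j k"] kazhdan_mono[of k "max j k"] by auto
  then show ?case using cvec.subspace_add[OF csubspace_kazhdan] by blast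
qed

text \<open>The filtration of the quotient, pulled back to the enveloping algebra so that operators
  keep acting there.\<close>

definition kazhdan_mod :: "int \<Rightarrow> 'g uea set"
  where "kazhdan_mod i = {y. \<exists>z\<in>kazhdan h i. y - z \<in> chi_ideal low}"

lemma kazhdan_modI: "z \<in> kazhdan h i \<Longrightarrow> y - z \<in> chi_ideal low \<Longrightarrow> y \<in> kazhdan_mod i"
  unfolding kazhdan_mod_def by blast

lemma csubspace_kazhdan_mod: "csubspace (kazhdan_mod i)"
proof (rule cvec.subspaceI)
  show "0 \<in> kazhdan_mod i"
    by (rule kazhdan_modI[of 0]) (simp_all add: cvec.subspace_0[OF csubspace_kazhdan] character_ideal_zero)
  fix x y assume "x \<in> kazhdan_mod i" "y \<in> kazhdan_mod i"
  then obtain x' y' where "x' \<in> kazhdan h i" "y' \<in> kazhdan h i"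
    "x - x' \<in> chi_ideal low" "y - y' \<in> chi_ideal low"
    unfolding kazhdan_mod_def by blast
  then show "x + y \<in> kazhdan_mod i"
    using cvec.subspace_add[OF csubspace_kazhdan] character_ideal_add
    by (intro kazhdan_modI[of "x' + y'"]) (simp_all add: add_diff_add)
next
  fix c x assume "x \<in> kazhdan_mod i"
  then obtain x' where "x' \<in> kazhdan h i" "x - x' \<in> chi_ideal low"
    unfolding kazhdan_mod_def by blast
  then show "c *\<^sub>C x \<in> kazhdan_mod i"
    using cvec.subspace_scale[OF csubspace_kazhdan] character_ideal_scaleC
    by (intro kazhdan_modI[of "c *\<^sub>C x'"]) (simp_all flip: cvec.scale_right_diff_distrib)
qed

lemma kazhdan_mod_image:
  assumes "clinear T" "\<And>y. y \<in> kazhdan h i \<Longrightarrow> T y \<in> kazhdan h i'"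
    "\<And>y. y \<in> chi_ideal low \<Longrightarrow> T y \<in> chi_ideal low" "y \<in> kazhdan_mod i"
  shows "T y \<in> kazhdan_mod i'"
proof -
  obtain z where z: "z \<in> kazhdan h i" "y - z \<in> chi_ideal low"
    using assms(4) unfolding kazhdan_mod_def by blast
  show ?thesis
    using assms(2)[OF z(1)] assms(3)[OF z(2)]
    by (intro kazhdan_modI[of "T z"]) (simp_all add: module_hom.diff[OF assms(1)])
qed

lemma kazhdan_mod_mono: "i \<le> i' \<Longrightarrow> kazhdan_mod i \<subseteq> kazhdan_mod i'"
  unfolding kazhdan_mod_def using kazhdan_mono by blast

lemma low_kazhdan_mod: "chi_ideal low \<subseteq> kazhdan_mod i"
  using kazhdan_modI[of 0] cvec.subspace_0[OF csubspace_kazhdan] by fastforce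

lemma kazhdan_mod_negative: "i < 0 \<Longrightarrow> kazhdan_mod i = chi_ideal low"
  using low_kazhdan_mod[of i] character_ideal_add kazhdan_negative[of i]
  unfolding kazhdan_mod_def by (fastforce dest: subsetD)

lemma ad_op_kazhdan_mod: "a \<in> wt d p \<Longrightarrow> d \<le> - 1 \<Longrightarrow> y \<in> kazhdan_mod i \<Longrightarrow> ad_op p a y \<in> kazhdan_mod (i + d)"
  using clinear_ad_op ad_op_kazhdan ad_op_low by (rule kazhdan_mod_image)

lemma emb_mult_kazhdan_mod: "x \<in> wt j p \<Longrightarrow> y \<in> kazhdan_mod i \<Longrightarrow> emb x * y \<in> kazhdan_mod (i + j + 2)"
  by (rule kazhdan_mod_image[OF clinear_times(1)])
     (auto simp: wt_def intro: emb_mult_kazhdan character_ideal_mult)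

end

section \<open>Invariants of the two quotients\<close>

text \<open>\<open>b\<close> spans the Lagrangian part of \<open>\<gg>(-1)'\<close>, \<open>a\<close> its dual, and \<open>mid\<close> is empty or the middle
  basis vector of the odd part, which belongs to \<open>\<mm>'\<close> but not to \<open>\<mm>\<close>.\<close>

locale lagrangian = graded_form form e h
  for form :: "'g::lie_superalgebra \<Rightarrow> 'g \<Rightarrow> complex" and e h +
  fixes L :: "'i set" and a b :: "'i \<Rightarrow> 'g" and \<pi> :: "'i \<Rightarrow> bit" and mid :: "'g set"
  assumes finite_L: "finite L"
    and a_wt: "k \<in> L \<Longrightarrow> a k \<in> wt (- 1) (\<pi> k)"
    and b_wt: "k \<in> L \<Longrightarrow> b k \<in> wt (- 1) (\<pi> k)"
    and mid_wt: "z \<in> mid \<Longrightarrow> z \<in> wt (- 1) 1"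
    and chi_ab: "k \<in> L \<Longrightarrow> form e (bracket (a k) (b k)) \<noteq> 0"
      "j \<in> L \<Longrightarrow> k \<in> L \<Longrightarrow> j \<noteq> k \<Longrightarrow> form e (bracket (a j) (b k)) = 0"
    and chi_bb: "j \<in> L \<Longrightarrow> k \<in> L \<Longrightarrow> form e (bracket (b j) (b k)) = 0"
    and chi_mid: "z \<in> mid \<Longrightarrow> k \<in> L \<Longrightarrow> form e (bracket z (b k)) = 0"
begin

text \<open>Intended for sets \<open>S\<close> of homogeneous elements;
  \<open>invariant_mod_span\<close> passes to spans. Quantifying over all parities of
  \<open>x\<close> is harmless, as only 0 has two and it acts as 0.\<close>

definition invariant_mod :: "'g uea set \<Rightarrow> 'g set \<Rightarrow> 'g uea \<Rightarrow> bool"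
  where "invariant_mod A S y \<longleftrightarrow> (\<forall>x\<in>S. \<forall>p. x \<in> gr p \<longrightarrow> ad_op p x y \<in> A)"

text \<open>Interpolates between the ideal of \<open>low\<close> for empty \<open>K\<close> and
  I_chi for \<open>K = L\<close>; inductions adjoin one \<open>b k\<close> at a time.\<close>

abbreviation J_upto :: "'i set \<Rightarrow> 'g uea set"
  where "J_upto K \<equiv> chi_ideal (low \<union> b ` K)"

lemma low_J_upto: "chi_ideal low \<subseteq> J_upto K"
  by (rule character_ideal_mono) blast

lemma chi_b: "k \<in> L \<Longrightarrow> form e (b k) = 0"
  using b_wt[of k] by (intro chi_degree[of _ "- 1"]) (auto simp: wt_def)

lemma emb_b_J: "k \<in> K \<Longrightarrow> K \<subseteq> L \<Longrightarrow> emb (b k) \<in> J_upto K"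
  using chi_b by (intro chi_ideal_emb) auto

text \<open>The bracket of \<open>x\<close> with \<open>b k\<close> has degree at most -2, so once
  chi kills it, it is itself a generator.\<close>

lemma bracket_J_upto:
  assumes x: "x \<in> wt i p" and i: "i \<le> - 1" and K: "K \<subseteq> L"
    and chi: "\<And>k. k \<in> K \<Longrightarrow> form e (bracket x (b k)) = 0" and t: "t \<in> low \<union> b ` K"
  shows "emb (bracket x t) \<in> J_upto K"
  using t
proof
  assume "t \<in> low"
  then show ?thesis using bracket_low'[OF x i] low_J_upto by blast
next
  assume "t \<in> b ` K"
  then obtain k where k: "k \<in> K" "t = b k" by blast
  have "bracket x t \<in> wt (i + - 1) (p + \<pi> k)"
    using bracket_wt[OF x b_wt] k K by auto
  then have "bracket x t \<in> low" using i by (intro lowI) auto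
  then show ?thesis using chi[OF k(1)] k(2) by (intro chi_ideal_emb) auto
qed

lemma J_upto_parity: "K \<subseteq> L \<Longrightarrow> x \<in> low \<union> b ` K \<Longrightarrow> x \<in> gr 0 \<or> (x \<in> gr 1 \<and> form e x = 0)"
  using low_parity parity_or_chi_zero b_wt by blast

lemma J_upto_ad_op:
  assumes "x \<in> wt i p" "i \<le> - 1" "K \<subseteq> L" "\<And>k. k \<in> K \<Longrightarrow> form e (bracket x (b k)) = 0" "y \<in> J_upto K"
  shows "ad_op p x y \<in> J_upto K"
  using assms(1) by (intro ad_op_character_ideal[OF assms(5)] bracket_J_upto[OF assms(1-4)]) (auto simp: wt_def)

lemma J_upto_parity_pow: "K \<subseteq> L \<Longrightarrow> y \<in> J_upto K \<Longrightarrow> parity_pow p y \<in> J_upto K"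
  by (rule parity_pow_character_ideal) (use J_upto_parity in blast)+

lemma J_upto_mult_emb:
  assumes "x \<in> wt i p" "i \<le> - 1" "K \<subseteq> L" "\<And>k. k \<in> K \<Longrightarrow> form e (bracket x (b k)) = 0" "y \<in> J_upto K"
  shows "y * emb x \<in> J_upto K"
  using assms(1) by (intro mult_emb_character_ideal[OF assms(5), of x p] bracket_J_upto[OF assms(1-4)]
    J_upto_parity[OF assms(3)]) (auto simp: wt_def)

definition m'_gens :: "'g set"
  where "m'_gens = low \<union> b ` L \<union> mid"

lemma m'_gens_wt:
  assumes "x \<in> m'_gens"
  obtains i p where "x \<in> wt i p" "i \<le> - 1"
proof -
  consider "x \<in> low" | k where "k \<in> L" "x = b k" | "x \<in> mid"
    using assms unfolding m'_gens_def by blast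
  then show thesis
  proof cases
    case 1
    then obtain i p where "x \<in> wt i p" "i \<le> - 2" unfolding low_def by blast
    then show thesis by (intro that[of i p]) auto
  next
    case 2
    then show thesis using b_wt by (intro that[of "- 1"]) auto
  next
    case 3
    then show thesis using mid_wt by (intro that[of "- 1"]) auto
  qed
qed

lemma chi_m'_gens:
  assumes "x \<in> m'_gens" "k \<in> L"
  shows "form e (bracket x (b k)) = 0"
proof (cases "x \<in> low")
  case True
  then obtain i p where x: "x \<in> wt i p" "i \<le> - 2" unfolding low_def by blast
  from bracket_wt[OF x(1) b_wt[OF assms(2)]] x(2) show ?thesis
    by (intro chi_degree[of _ "i + - 1"]) (auto simp: wt_def)
next
  case False
  then show ?thesis using assms chi_bb chi_mid unfolding m'_gens_def by blast
qed

subsection \<open>Lifting along \<open>\<mm>'\<close>\<close>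

text \<open>Among the negative degrees only -1 can see m' smaller than the weight space, whence the
  case distinction.\<close>

definition gens :: "nat \<Rightarrow> bit \<Rightarrow> 'g set"
  where "gens d p = (if d = 1 then (b ` L \<union> mid) \<inter> gr p else wt (- int d) p)"

lemma gens_wt:
  assumes "x \<in> gens d p"
  shows "x \<in> wt (- int d) p"
proof (cases "d = 1")
  case True
  then have x: "x \<in> b ` L \<union> mid" "x \<in> gr p" using assms by (auto simp: gens_def)
  then have "x \<in> eigenspace h (- 1)" using b_wt mid_wt by (auto simp: wt_def)
  then show ?thesis using x True by (simp add: wt_def)
qed (use assms in \<open>simp add: gens_def\<close>)

lemma gens_m'_gens: "x \<in> gens d p \<Longrightarrow> d \<ge> 1 \<Longrightarrow> x \<in> m'_gens"
  unfolding gens_def m'_gens_def by (auto intro: lowI split: if_splits)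

lemma gr_unique: "x \<in> gr p \<Longrightarrow> x \<in> gr q \<Longrightarrow> p \<noteq> q \<Longrightarrow> x = (0::'g)"
  using gr_disjoint by (cases p; cases q) auto

text \<open>The cocycle of \<open>q\<close> takes values in J because \<open>q\<close> is invariant
  modulo I_chi. Hence \<open>exact\<close> is used with the filtration of J, although
  \<open>q\<close> itself may lie outside J, and the primitive \<open>w\<close> comes out in
  J.\<close>

lemma lift_along_m':
  assumes q: "q \<in> kazhdan_mod i" and inv: "invariant_mod (J_upto L) m'_gens q"
  shows "\<exists>w\<in>kazhdan_mod i \<inter> J_upto L. invariant_mod (chi_ideal low) m'_gens (q - w)"
proof -
  obtain B0 where B0: "finite B0" "cspan B0 = (UNIV :: 'g set)" using finite_dimensional by blast
  obtain D :: nat where D: "\<And>i x. i < - int D \<Longrightarrow> x \<in> eigenspace h i \<Longrightarrow> x = 0"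
    using degrees_bounded by blast
  \<comment> \<open>The basis is picked from \<open>gens\<close> itself, which in degree -1 need not
    be a subspace; so its members are generators of m'.\<close>
  define Bs where "Bs d p = (SOME B. B \<subseteq> gens d p \<and> cindependent B \<and> gens d p \<subseteq> cspan B)" for d p
  have "Bs d p \<subseteq> gens d p \<and> cindependent (Bs d p) \<and> gens d p \<subseteq> cspan (Bs d p)" for d p
  proof -
    obtain B where "B \<subseteq> gens d p" "cindependent B" "gens d p \<subseteq> cspan B"
      by (rule cvec.maximal_independent_subset)
    then have "\<exists>B. B \<subseteq> gens d p \<and> cindependent B \<and> gens d p \<subseteq> cspan B" by blast
    then show ?thesis unfolding Bs_def by (rule someI_ex)
  qed
  then have Bs: "\<And>d p. Bs d p \<subseteq> gens d p" "\<And>d p. cindependent (Bs d p)"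
    "\<And>d p. gens d p \<subseteq> cspan (Bs d p)"
    by simp_all
  have fin: "finite (Bs d p)" for d p
    using cvec.independent_span_bound[OF B0(1) Bs(2)] B0(2) by blast
  have Bs_wt: "Bs d p \<subseteq> wt (- int d) p" for d p
    using Bs(1) gens_wt by blast
  define dual where "dual d p x = (SOME y. y \<in> wt (int d - 2) p \<and>
      (\<forall>x'\<in>Bs d p. form e (bracket x' y) = (if x' = x then 1 else 0)))" for d p x
  have dual_ex: "dual d p x \<in> wt (int d - 2) p \<and>
      (\<forall>x'\<in>Bs d p. form e (bracket x' (dual d p x)) = (if x' = x then 1 else 0))"
    if "d > 0" "x \<in> Bs d p" for d p x
  proof -
    have "\<exists>y. y \<in> wt (int d - 2) p \<and> (\<forall>x'\<in>Bs d p. form e (bracket x' y) = (if x' = x then 1 else 0))"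
      using dual_element[OF fin Bs(2) Bs_wt that] by (simp add: Bex_def)
    then show ?thesis unfolding dual_def by (rule someI_ex)
  qed
  have dual: "\<And>d p x. d > 0 \<Longrightarrow> x \<in> Bs d p \<Longrightarrow> dual d p x \<in> wt (int d - 2) p"
    "\<And>d p x x'. d > 0 \<Longrightarrow> x \<in> Bs d p \<Longrightarrow> x' \<in> Bs d p \<Longrightarrow>
      form e (bracket x' (dual d p x)) = (if x' = x then 1 else 0)"
    using dual_ex by blast+
  \<comment> \<open>Degree and parity are attached to each basis vector. Nonzero weight vectors have
    degree at least \<open>- D\<close>, so these finitely many coordinates capture all of
    m'.\<close>
  define X where "X = (\<Union>d\<in>{1..Suc D}. \<Union>p\<in>{0, 1 :: bit}. (\<lambda>x. (x, d, p)) ` Bs d p)"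
  have in_X: "(x, d, p) \<in> X \<longleftrightarrow> 1 \<le> d \<and> d \<le> Suc D \<and> x \<in> Bs d p" for x d p
    unfolding X_def by (cases p) auto
  define T where "T = (\<lambda>(x :: 'g, d :: nat, p). ad_op p x)"
  define Y where "Y = (\<lambda>(x, d, p) z. emb (dual d p x) * z)"
  define dg where "dg = (\<lambda>(x :: 'g, d :: nat, p :: bit). d)"
  define \<eta> where "\<eta> = (\<lambda>(x :: 'g, d :: nat, p) (x' :: 'g, d' :: nat, p'). ksign p p')"
  define G where "G = (\<lambda>i. kazhdan_mod i \<inter> J_upto L)"
  have Bs_m': "x \<in> m'_gens" if "(x, d, p) \<in> X" for x d p
    using that Bs(1) gens_m'_gens unfolding in_X by blast
  have chi_Bs: "form e (bracket x (b k)) = 0" if "(x, d, p) \<in> X" "k \<in> L" for x d p k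
    using chi_m'_gens Bs_m' that by blast
  have G_ad: "ad_op p x z \<in> G (i + j)"
    if "x \<in> wt j p" "j \<le> - 1" "\<And>k. k \<in> L \<Longrightarrow> form e (bracket x (b k)) = 0" "z \<in> G i" for x j p z i
    using that ad_op_kazhdan_mod J_upto_ad_op unfolding G_def by blast
  have low_G: "chi_ideal low \<subseteq> G i" for i
    using low_kazhdan_mod low_J_upto unfolding G_def by blast
  have csubspace_G: "csubspace (G i)" for i
    unfolding G_def by (intro cvec.subspace_inter csubspace_kazhdan_mod csubspace_character_ideal)
  interpret filtered_derivations T Y G dg X \<eta>
  proof (rule filtered_derivations.intro)
    show "finite X" unfolding X_def using fin by auto
    show "clinear (T x)" for x
      by (cases x) (simp add: T_def clinear_ad_op)
    show "clinear (Y x)" for x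
      by (cases x) (simp add: Y_def clinear_times)
    show "csubspace (G i)" for i by (rule csubspace_G)
    show "G i \<subseteq> G j" if "i \<le> j" for i j
      using kazhdan_mod_mono[OF that] unfolding G_def by blast
    show "G i = G (- 1)" if "i < 0" for i
      using kazhdan_mod_negative[OF that] kazhdan_mod_negative[of "- 1"] unfolding G_def by simp
    show "T x z \<in> G (i - int (dg x))" if "x \<in> X" "z \<in> G i" for x i z
    proof -
      obtain x' d p where x: "x = (x', d, p)" by (cases x)
      have "x' \<in> wt (- int d) p" "- int d \<le> - 1" using that(1) Bs_wt unfolding x in_X by auto
      from G_ad[OF this chi_Bs that(2)] that(1) show ?thesis by (simp add: T_def dg_def x)
    qed
    show "Y x z \<in> G (i + int (dg x))" if "x \<in> X" "z \<in> G i" for x i z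
    proof -
      obtain x' d p where x: "x = (x', d, p)" by (cases x)
      have "dual d p x' \<in> wt (int d - 2) p" using that(1) dual(1) unfolding x in_X by auto
      from emb_mult_kazhdan_mod[OF this] that(2)
      have "emb (dual d p x') * z \<in> kazhdan_mod (i + (int d - 2) + 2)" unfolding G_def by blast
      moreover have "emb (dual d p x') * z \<in> J_upto L"
        using that(2) unfolding G_def by (blast intro: character_ideal_mult)
      ultimately show ?thesis by (simp add: Y_def dg_def x G_def)
    qed
    show "dg x > 0" if "x \<in> X" for x
      using that by (cases x) (auto simp: dg_def in_X)
    show "\<eta> x x = 1 \<or> \<eta> x x = - 1" for x
      by (cases x) (auto simp: \<eta>_def ksign_def)
    show "T x (Y k z) - \<eta> x k *\<^sub>C Y k (T x z) - (if x = k then z else 0) \<in> G (i + int (dg k) - int (dg x) - 1)"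
      if xX: "x \<in> X" and kX: "k \<in> X" and le: "dg k \<le> dg x" and z: "z \<in> G i" for x k i z
    proof -
      obtain x' d p where x: "x = (x', d, p)" by (cases x)
      obtain k' d' p' where k: "k = (k', d', p')" by (cases k)
      define w where "w = bracket x' (dual d' p' k')"
      have x': "x' \<in> wt (- int d) p" "x' \<in> gr p" using xX Bs_wt unfolding x in_X by (auto simp: wt_def)
      have y: "dual d' p' k' \<in> wt (int d' - 2) p'" "dual d' p' k' \<in> gr p'"
        using kX dual(1)[of d' k' p'] unfolding k in_X by (auto simp: wt_def)
      have w: "w \<in> wt (- int d + (int d' - 2)) (p + p')"
        unfolding w_def by (rule bracket_wt[OF x'(1) y(1)])
      have dd: "d' \<le> d" using le by (simp add: x k dg_def)
      \<comment> \<open>For distinct degrees \<open>w\<close> is not in degree -2, for distinct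
        parities it is odd; chi vanishes either way, and otherwise duality decides.\<close>
      have chi_w: "form e w = (if x = k then 1 else 0)"
      proof (cases "d = d' \<and> p = p'")
        case True
        then show ?thesis
          using xX kX dual(2)[of d' k' p' x'] unfolding w_def x k in_X by auto
      next
        case False
        have "form e w = 0"
        proof (cases "d = d'")
          case True
          then have "p + p' = 1" using False by (cases p; cases p') auto
          then show ?thesis using w chi_odd by (auto simp: wt_def)
        next
          case False
          then show ?thesis using w by (intro chi_degree[of w "- int d + (int d' - 2)"]) (auto simp: wt_def)
        qed
        then show ?thesis using False x k by auto
      qed
      have chi_wb: "form e (bracket w (b j)) = 0" if "j \<in> L" for j
        using w dd that by (intro chi_m'_gens) (auto simp: m'_gens_def intro: lowI)
      \<comment> \<open>As \<open>d' \<le> d\<close>, left multiplication by \<open>w\<close> is the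
        scalar \<open>form e w\<close> plus \<open>ad_op\<close> modulo the ideal, and the
        \<open>ad_op\<close> part is absorbed in the error term.\<close>
      have "ad_op (p + p') w z \<in> G (i + (- int d + (int d' - 2)))"
        using dd by (intro G_ad[OF w _ chi_wb z]) auto
      also have "G (i + (- int d + (int d' - 2))) \<subseteq> G (i + int d' - int d - 1)"
        unfolding G_def using kazhdan_mod_mono[of "i + (- int d + (int d' - 2))" "i + int d' - int d - 1"] by auto
      finally have 1: "ad_op (p + p') w z \<in> G (i + int d' - int d - 1)" .
      have "emb w * z - (form e w *\<^sub>C z + ad_op (p + p') w z) \<in> G (i + int d' - int d - 1)"
        using emb_mult_mod_low[OF w] dd low_G by auto
      from cvec.subspace_add[OF csubspace_G this 1]
      have 2: "emb w * z - form e w *\<^sub>C z \<in> G (i + int d' - int d - 1)" by simp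
      have "T x (Y k z) = emb w * z + ksign p p' *\<^sub>C Y k (T x z)"
        by (simp add: T_def Y_def x k ad_op_mult ad_op_emb[OF x'(2)] parity_pow_emb[OF y(2)] w_def scaleC_mult_left)
      then show ?thesis
        using 2 chi_w by (auto simp: \<eta>_def dg_def x k)
    qed
    show "T x (T k q) - \<eta> x k *\<^sub>C T k (T x q) \<in> A"
      if xX: "x \<in> X" and kX: "k \<in> X" and A: "csubspace A"
        and l: "\<And>l. l \<in> X \<Longrightarrow> dg l = dg x + dg k \<Longrightarrow> T l q \<in> A" for x k q A
    proof -
      obtain x' d p where x: "x = (x', d, p)" by (cases x)
      obtain k' d' p' where k: "k = (k', d', p')" by (cases k)
      define w where "w = bracket x' k'"
      have x': "x' \<in> wt (- int d) p" "x' \<in> gr p" using xX Bs_wt unfolding x in_X by (auto simp: wt_def)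
      have k': "k' \<in> wt (- int d') p'" "k' \<in> gr p'" using kX Bs_wt unfolding k in_X by (auto simp: wt_def)
      have w: "w \<in> wt (- int (d + d')) (p + p')"
        using bracket_wt[OF x'(1) k'(1)] by (simp add: w_def)
      have "T x (T k q) - \<eta> x k *\<^sub>C T k (T x q) = ad_op (p + p') w q"
        using ad_op_ad_op[OF x'(2) k'(2)] by (simp add: T_def \<eta>_def x k w_def)
      also have "\<dots> \<in> A"
      proof (cases "d + d' \<le> Suc D")
        case True
        \<comment> \<open>In this degree \<open>gens\<close> is a full weight space, so the bracket
          expands in the chosen basis.\<close>
        have "d + d' \<noteq> 1" using xX kX unfolding x k in_X by auto
        then have "w \<in> gens (d + d') (p + p')" using w by (simp add: gens_def)
        then have "w \<in> cspan (Bs (d + d') (p + p'))" using Bs(3) by blast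
        then show ?thesis
        proof (rule clinear_span[where T = "\<lambda>w. ad_op (p + p') w q", OF _ A, rotated 2])
          show "clinear (\<lambda>w. ad_op (p + p') w q)"
            by (rule clinearI) (simp_all add: ad_op_add_left ad_op_scaleC_left)
          fix w assume "w \<in> Bs (d + d') (p + p')"
          then have "(w, d + d', p + p') \<in> X" using True xX unfolding x in_X by auto
          from l[OF this] show "ad_op (p + p') w q \<in> A" by (simp add: T_def dg_def x k)
        qed
      next
        case False
        then have "w = 0" using D[of "- int (d + d')" w] w by (auto simp: wt_def)
        then show ?thesis using cvec.subspace_0[OF A] by simp
      qed
      finally show ?thesis .
    qed
  qed
  have "T x q \<in> G (i - int (dg x))" if "x \<in> X" for x
  proof -
    obtain x' d p where x: "x = (x', d, p)" by (cases x)
    have x': "x' \<in> wt (- int d) p" "d \<ge> 1" using that Bs_wt unfolding x in_X by auto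
    then have "ad_op p x' q \<in> kazhdan_mod (i + - int d)"
      using q by (intro ad_op_kazhdan_mod) auto
    moreover have "ad_op p x' q \<in> J_upto L"
      using inv Bs_m'[of x' d p] that x' unfolding x invariant_mod_def by (auto simp: wt_def)
    ultimately show ?thesis by (simp add: T_def dg_def x G_def)
  qed
  from exact[OF this] obtain w where w: "w \<in> G i" "\<And>x. x \<in> X \<Longrightarrow> T x (q - w) \<in> G (- 1)"
    by blast
  have G1: "G (- 1) \<subseteq> chi_ideal low" using kazhdan_mod_negative[of "- 1"] unfolding G_def by auto
  have Bs_inv: "ad_op p x (q - w) \<in> chi_ideal low" if "x \<in> gens d p" "d \<ge> 1" for x d p
  proof (cases "d \<le> Suc D")
    case True
    have "x \<in> cspan (Bs d p)" using that Bs(3) by blast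
    then show ?thesis
    proof (rule clinear_span[where T = "\<lambda>x. ad_op p x (q - w)", OF _ csubspace_character_ideal, rotated 2])
      show "clinear (\<lambda>x. ad_op p x (q - w))"
        by (rule clinearI) (simp_all add: ad_op_add_left ad_op_scaleC_left)
      fix x assume "x \<in> Bs d p"
      then have "(x, d, p) \<in> X" using True that in_X by auto
      from w(2)[OF this] G1 show "ad_op p x (q - w) \<in> chi_ideal low" by (auto simp: T_def)
    qed
  next
    case False
    then have "x = 0" using D[of "- int d" x] gens_wt[OF that(1)] by (auto simp: wt_def)
    then show ?thesis by (simp add: character_ideal_zero)
  qed
  have "ad_op p x (q - w) \<in> chi_ideal low" if x: "x \<in> m'_gens" "x \<in> gr p" for x p
  proof (cases "x \<in> low")
    case True
    then obtain j p' where j: "x \<in> wt j p'" "j \<le> - 2" unfolding low_def by blast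
    then have "x \<in> gens (nat (- j)) p" using x(2) by (auto simp: gens_def wt_def)
    then show ?thesis using j(2) by (intro Bs_inv) auto
  next
    case False
    then have "x \<in> gens 1 p" using x by (auto simp: gens_def m'_gens_def)
    then show ?thesis by (rule Bs_inv) simp
  qed
  then show ?thesis using w(1) unfolding G_def invariant_mod_def by blast
qed

subsection \<open>Lifting along the dual Lagrangian, and injectivity\<close>

text \<open>The coordinate \<open>b k\<close>, multiplied from the right so that the result lies in
  J for every \<open>y\<close>. The twist lets it supercommute with \<open>ad_op\<close> up to a
  scalar.\<close>

definition right_mult :: "'i \<Rightarrow> 'g uea \<Rightarrow> 'g uea"
  where "right_mult k y = parity_pow (\<pi> k) y * emb (b k)"

lemma clinear_right_mult: "clinear (right_mult k)"
  by (rule clinearI) (simp_all add: right_mult_def parity_pow_add parity_pow_scaleC distrib_right scaleC_mult_left)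

lemma right_mult_kazhdan_mod:
  assumes "k \<in> L" "y \<in> kazhdan_mod i"
  shows "right_mult k y \<in> kazhdan_mod (i + 1)"
proof (rule kazhdan_mod_image[OF clinear_right_mult _ _ assms(2)])
  fix y assume "y \<in> kazhdan h i"
  from mult_emb_kazhdan[OF _ parity_pow_kazhdan[OF this], of "b k" "- 1" "\<pi> k"] b_wt[OF assms(1)]
  show "right_mult k y \<in> kazhdan h (i + 1)"
    by (simp add: right_mult_def wt_def add.commute)
next
  fix y assume "y \<in> chi_ideal low"
  then show "right_mult k y \<in> chi_ideal low"
    unfolding right_mult_def by (intro mult_emb_low[OF b_wt[OF assms(1)]] parity_pow_low) auto
qed

lemma right_mult_low: "k \<in> L \<Longrightarrow> y \<in> chi_ideal low \<Longrightarrow> right_mult k y \<in> chi_ideal low"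
  unfolding right_mult_def by (intro mult_emb_low[OF b_wt] parity_pow_low) auto

lemma right_mult_J: "k \<in> L \<Longrightarrow> right_mult k y \<in> J_upto L"
  unfolding right_mult_def by (intro character_ideal_mult emb_b_J) auto

text \<open>The error is right multiplication by \<open>bracket x (b k)\<close>, of degree at most
  -2, which acts by the scalar chi modulo the ideal; hence no lower filtration terms arise.\<close>

lemma ad_op_right_mult:
  assumes x: "x \<in> wt i p" "i \<le> - 1" and k: "k \<in> L"
  shows "ad_op p x (right_mult k y) - ksign p (\<pi> k) *\<^sub>C right_mult k (ad_op p x y)
    - form e (bracket x (b k)) *\<^sub>C y \<in> chi_ideal low"
proof -
  have xp: "x \<in> gr p" using x by (simp add: wt_def)
  have w: "bracket x (b k) \<in> wt (i + - 1) (p + \<pi> k)" by (rule bracket_wt[OF x(1) b_wt[OF k]])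
  have sign: "ad_op p x (parity_pow (\<pi> k) y) = ksign p (\<pi> k) *\<^sub>C parity_pow (\<pi> k) (ad_op p x y)"
    using parity_pow_ad_op[OF xp] by simp
  have "ad_op p x (right_mult k y) = ksign p (\<pi> k) *\<^sub>C right_mult k (ad_op p x y)
      + parity_pow (p + \<pi> k) y * emb (bracket x (b k))"
    unfolding right_mult_def ad_op_mult ad_op_emb[OF xp] sign parity_pow_parity_pow scaleC_mult_left ..
  then show ?thesis
    using mult_emb_mod_low[OF w, of y] x(2) by (simp add: algebra_simps)
qed

text \<open>Each commutation leaves the action of \<open>bracket x a'\<close>, which is in
  \<open>low\<close> and so kills \<open>y\<close> modulo the ideal; the induction treats all such
  \<open>x\<close> at once.\<close>

lemma ad_op_funpow_low:
  assumes a: "a' \<in> wt (- 1) q" and x: "x \<in> wt i p" "i \<le> - 1"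
    and low: "invariant_mod (chi_ideal low) low y" and xy: "ad_op p x y \<in> chi_ideal low"
  shows "ad_op p x ((ad_op q a' ^^ n) y) \<in> chi_ideal low"
  using x xy
proof (induction n arbitrary: x i p)
  case (Suc n)
  have gr: "x \<in> gr p" "a' \<in> gr q" using Suc.prems a by (auto simp: wt_def)
  have w: "bracket x a' \<in> wt (i + - 1) (p + q)" by (rule bracket_wt[OF Suc.prems(1) a])
  then have "ad_op (p + q) (bracket x a') y \<in> chi_ideal low"
    using low Suc.prems(2) unfolding invariant_mod_def by (auto simp: wt_def intro!: lowI[of _ "i - 1" "p + q"])
  then have 1: "ad_op (p + q) (bracket x a') ((ad_op q a' ^^ n) y) \<in> chi_ideal low"
    using w Suc.prems(2) by (intro Suc.IH[of _ "i + - 1"]) auto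
  have "ad_op q a' (ad_op p x ((ad_op q a' ^^ n) y)) \<in> chi_ideal low"
    by (rule ad_op_low[OF a]) (simp_all add: Suc.IH[OF Suc.prems])
  then show ?case
    using 1 ad_op_ad_op[OF gr, of "(ad_op q a' ^^ n) y"]
    by (simp add: character_ideal_add character_ideal_scaleC)
qed simp

text \<open>Each application lowers the filtration by one, and negative levels lie in the
  ideal.\<close>

lemma ad_op_locally_nilpotent:
  assumes "a' \<in> wt (- 1) q"
  shows "\<exists>n. (ad_op q a' ^^ n) y \<in> chi_ideal low"
proof -
  obtain i where "y \<in> kazhdan h i" using kazhdan_exhaustive by blast
  then have "y \<in> kazhdan_mod i" by (rule kazhdan_modI) (simp add: character_ideal_zero)
  then have "(ad_op q a' ^^ n) y \<in> kazhdan_mod (i - int n)" for n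
  proof (induction n)
    case (Suc n)
    from ad_op_kazhdan_mod[OF assms _ Suc.IH[OF Suc.prems]] show ?case by (simp add: algebra_simps)
  qed simp
  from this[of "nat (i + 1)"] have "(ad_op q a' ^^ nat (i + 1)) y \<in> kazhdan_mod (i - int (nat (i + 1)))" .
  moreover have "i - int (nat (i + 1)) < 0" by linarith
  ultimately show ?thesis using kazhdan_mod_negative by blast
qed

lemma m'_gens_low: "invariant_mod A (m'_gens \<union> S) y \<Longrightarrow> invariant_mod A low y"
  unfolding invariant_mod_def m'_gens_def by blast

text \<open>The square of an odd derivation is half the action of \<open>bracket x x\<close>, which
  lies in \<open>low\<close>.\<close>

lemma ad_op_odd_square:
  assumes "x \<in> wt i 1" "i \<le> - 1" "invariant_mod (chi_ideal low) low y"
  shows "ad_op 1 x (ad_op 1 x y) \<in> chi_ideal low"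
proof -
  have gr: "x \<in> gr 1" using assms(1) by (simp add: wt_def)
  have w: "bracket x x \<in> wt (i + i) (1 + 1)" by (rule bracket_wt[OF assms(1,1)])
  then have "ad_op (1 + 1) (bracket x x) y \<in> chi_ideal low"
    using assms(2,3) unfolding invariant_mod_def by (auto simp: wt_def intro!: lowI[of _ "i + i" "1 + 1"])
  moreover have "ad_op 1 x (ad_op 1 x y) = ad_op (1 + 1) (bracket x x) y - ad_op 1 x (ad_op 1 x y)"
    using ad_op_ad_op[OF gr gr, of y] by (simp add: ksign_def)
  then have "ad_op (1 + 1) (bracket x x) y = ad_op 1 x (ad_op 1 x y) + ad_op 1 x (ad_op 1 x y)"
    by (metis diff_eq_eq)
  ultimately have "(1 / 2) *\<^sub>C (ad_op 1 x (ad_op 1 x y) + ad_op 1 x (ad_op 1 x y)) \<in> chi_ideal low"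
    by (simp only: character_ideal_scaleC)
  then show ?thesis by (simp flip: scaleC_add_left add: scaleC_add_right)
qed

text \<open>For each \<open>a k\<close>, the corrections are values of \<open>right_mult k\<close>
  and hence lie in J. They preserve the invariance reached before, since all vectors treated earlier
  pair to zero with \<open>b k\<close>.\<close>

lemma lift_along_dual:
  assumes "K \<subseteq> L" and q: "q \<in> kazhdan_mod i" and inv: "invariant_mod (chi_ideal low) m'_gens q"
  shows "\<exists>w\<in>kazhdan_mod i \<inter> J_upto L. invariant_mod (chi_ideal low) (m'_gens \<union> a ` K) (q - w)"
proof -
  have "finite K" using assms(1) finite_L finite_subset by blast
  then show ?thesis using assms(1)
  proof (induction K rule: finite_induct)
    case empty
    have "0 \<in> kazhdan_mod i \<inter> J_upto L"
      by (simp add: cvec.subspace_0[OF csubspace_kazhdan_mod] character_ideal_zero)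
    then show ?case using inv by (intro bexI[of _ 0]) simp_all
  next
    case (insert k K)
    then obtain w where w: "w \<in> kazhdan_mod i" "w \<in> J_upto L"
      and inv_w: "invariant_mod (chi_ideal low) (m'_gens \<union> a ` K) (q - w)"
      by blast
    have k: "k \<in> L" "k \<notin> K" "K \<subseteq> L" using insert by auto
    define q1 where "q1 = q - w"
    have q1: "q1 \<in> kazhdan_mod i" unfolding q1_def by (rule cvec.subspace_diff[OF csubspace_kazhdan_mod q w(1)])
    have low_q1: "invariant_mod (chi_ideal low) low q1"
      using m'_gens_low[OF inv_w] by (simp add: q1_def)
    define c where "c = form e (bracket (a k) (b k))"
    have c: "c \<noteq> 0" using chi_ab(1)[OF k(1)] by (simp add: c_def)
    define D where "D = ad_op (\<pi> k) (a k)"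
    define Y where "Y y = (1 / c) *\<^sub>C right_mult k y" for y
    define X where "X = {(x, p). x \<in> m'_gens \<union> a ` K \<and> x \<in> gr p}"
    define T where "T = (\<lambda>(x :: 'g, p). ad_op p x)"
    have Y: "clinear Y"
      unfolding Y_def using clinear_right_mult[of k]
      by (intro clinearI) (simp_all add: module_hom.add module_hom.scale[OF clinear_right_mult] module_hom.add[OF clinear_right_mult] scaleC_add_right mult.commute)
    have X: "\<exists>i. x \<in> wt i p \<and> i \<le> - 1 \<and> form e (bracket x (b k)) = 0" if "(x, p) \<in> X" for x p
    proof (cases "x \<in> m'_gens")
      case True
      then obtain i p' where "x \<in> wt i p'" "i \<le> - 1" by (rule m'_gens_wt)
      then show ?thesis
        using that chi_m'_gens[OF True k(1)] by (auto simp: wt_def X_def)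
    next
      case False
      moreover have "x \<in> m'_gens \<union> a ` K" using that by (simp add: X_def)
      ultimately obtain j where "j \<in> K" "x = a j" by blast
      then have "x \<in> eigenspace h (- 1)" "form e (bracket x (b k)) = 0"
        using a_wt[of j] chi_ab(2)[of j k] k by (auto simp: wt_def)
      then show ?thesis using that by (auto simp: wt_def X_def)
    qed
    have Y_low: "Y z \<in> chi_ideal low" if "z \<in> chi_ideal low" for z
      unfolding Y_def by (intro character_ideal_scaleC right_mult_low k that)
    have DY: "D (Y z) - ksign (\<pi> k) (\<pi> k) *\<^sub>C Y (D z) - z \<in> chi_ideal low" for z
    proof -
      from character_ideal_scaleC[OF ad_op_right_mult[OF a_wt[OF k(1)] _ k(1), of z], of "1 / c"]
      show ?thesis
        using c by (simp add: D_def Y_def ad_op_scaleC cvec.scale_right_diff_distrib c_def mult.commute)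
    qed
    have TY: "T x (Y z) - ksign (snd x) (\<pi> k) *\<^sub>C Y (T x z) \<in> chi_ideal low" if "x \<in> X" for x z
    proof -
      obtain x' p where x: "x = (x', p)" by (cases x)
      from X[of x' p] that[unfolded x]
      obtain j where "x' \<in> wt j p" "j \<le> - 1" "form e (bracket x' (b k)) = 0" by blast
      from character_ideal_scaleC[OF ad_op_right_mult[OF this(1,2) k(1), of z], of "1 / c"] this(3)
      show ?thesis
        by (simp add: T_def Y_def x ad_op_scaleC cvec.scale_right_diff_distrib mult.commute)
    qed
    have Dn: "(D ^^ n) z \<in> kazhdan_mod (j - int n)" if "z \<in> kazhdan_mod j" for n z j
    proof (induction n)
      case (Suc n)
      from ad_op_kazhdan_mod[OF a_wt[OF k(1)] _ Suc] show ?case by (simp add: D_def algebra_simps)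
    qed (use that in simp)
    have Tq1: "T x ((D ^^ n) q1) \<in> chi_ideal low" if "x \<in> X" for x n
    proof -
      obtain x' p where x: "x = (x', p)" by (cases x)
      from X[of x' p] that[unfolded x] obtain j where j: "x' \<in> wt j p" "j \<le> - 1" by blast
      have "ad_op p x' q1 \<in> chi_ideal low"
        using inv_w that unfolding x X_def q1_def invariant_mod_def by blast
      from ad_op_funpow_low[OF a_wt[OF k(1)] j low_q1 this] show ?thesis by (simp add: T_def D_def x)
    qed
    have v: "D q1 \<in> kazhdan_mod (i - 1)" using Dn[OF q1, of 1] by simp
    have fin: "(ksign (\<pi> k) (\<pi> k) = 1 \<and> (D ^^ nat (i + 1)) (D q1) \<in> chi_ideal low) \<or> D (D q1) \<in> chi_ideal low"
    proof (cases "\<pi> k = 1")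
      case True
      then show ?thesis
        using ad_op_odd_square[of "a k" "- 1" q1] a_wt[OF k(1)] low_q1 unfolding D_def by simp
    next
      case False
      have "(D ^^ nat (i + 1)) (D q1) \<in> kazhdan_mod (i - 1 - int (nat (i + 1)))" by (rule Dn[OF v])
      moreover have "i - 1 - int (nat (i + 1)) < 0" by linarith
      ultimately show ?thesis using False kazhdan_mod_negative by (auto simp: ksign_def)
    qed
    have "\<exists>w'\<in>kazhdan_mod (i - 1). D (Y w') - D q1 \<in> chi_ideal low \<and> (\<forall>x\<in>X. T x (Y w') \<in> chi_ideal low)"
    \<comment> \<open>\<open>H\<close> is constant: the relations are exact modulo the ideal, so one
      application settles \<open>a k\<close>.\<close>
    proof (rule antiderivative[where G = kazhdan_mod and H = "\<lambda>_. chi_ideal low" and K = X and d = 1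
          and \<epsilon> = "ksign (\<pi> k) (\<pi> k)" and \<eta> = "\<lambda>x. ksign (snd x) (\<pi> k)" and N = "nat (i + 1)"])
      show "clinear (T x)" for x by (cases x) (simp add: T_def clinear_ad_op)
      show "D z \<in> kazhdan_mod (j - 1)" if "z \<in> kazhdan_mod j" for z j
        using Dn[OF that, of 1] by simp
      show "Y z \<in> kazhdan_mod (j + 1)" if "z \<in> kazhdan_mod j" for z j
        unfolding Y_def by (intro cvec.subspace_scale[OF csubspace_kazhdan_mod] right_mult_kazhdan_mod k that)
      show "T x ((D ^^ n) (D q1)) \<in> chi_ideal low" if "x \<in> X" for x n
        using Tq1[OF that, of "Suc n"] by (simp add: funpow_swap1)
    qed (use Y Y_low DY TY v fin low_kazhdan_mod csubspace_kazhdan_mod csubspace_character_ideal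
        in \<open>simp_all add: D_def clinear_ad_op\<close>)
    then obtain w' where w': "w' \<in> kazhdan_mod (i - 1)" "D (Y w') - D q1 \<in> chi_ideal low"
      "\<And>x. x \<in> X \<Longrightarrow> T x (Y w') \<in> chi_ideal low"
      by blast
    have Yw': "Y w' \<in> kazhdan_mod i" "Y w' \<in> J_upto L"
      using right_mult_kazhdan_mod[OF k(1) w'(1)] right_mult_J[OF k(1)]
      by (simp_all add: Y_def cvec.subspace_scale[OF csubspace_kazhdan_mod] character_ideal_scaleC)
    have "invariant_mod (chi_ideal low) (m'_gens \<union> a ` insert k K) (q - (w + Y w'))"
      unfolding invariant_mod_def
    proof (intro ballI allI impI)
      fix x p assume x: "x \<in> m'_gens \<union> a ` insert k K" "x \<in> gr p"
      have eq: "ad_op p x (q - (w + Y w')) = ad_op p x q1 - ad_op p x (Y w')"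
        by (simp add: q1_def ad_op_diff ad_op_add)
      show "ad_op p x (q - (w + Y w')) \<in> chi_ideal low"
      proof (cases "x \<in> m'_gens \<union> a ` K")
        case True
        then have X: "(x, p) \<in> X" using x by (simp add: X_def)
        from character_ideal_diff[OF Tq1[OF X, of 0] w'(3)[OF X]]
        show ?thesis unfolding eq by (simp add: T_def)
      next
        case False
        then have xk: "x = a k" using x by auto
        show ?thesis
        proof (cases "p = \<pi> k")
          case True
          from character_ideal_neg[OF w'(2)] show ?thesis unfolding eq by (simp add: D_def xk True)
        next
          case False
          then have "x = 0" using x(2) a_wt[OF k(1)] gr_unique xk by (auto simp: wt_def)
          then show ?thesis by (simp add: character_ideal_zero)
        qed
      qed
    qed
    moreover have "w + Y w' \<in> kazhdan_mod i \<inter> J_upto L"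
      using w Yw' by (auto intro: cvec.subspace_add[OF csubspace_kazhdan_mod] character_ideal_add)
    ultimately show ?case by blast
  qed
qed

lemma lift_exists:
  assumes q: "q \<in> kazhdan_mod i" and inv: "invariant_mod (J_upto L) m'_gens q"
  shows "\<exists>w\<in>kazhdan_mod i \<inter> J_upto L. invariant_mod (chi_ideal low) (m'_gens \<union> a ` L) (q - w)"
proof -
  obtain w where w: "w \<in> kazhdan_mod i" "w \<in> J_upto L" "invariant_mod (chi_ideal low) m'_gens (q - w)"
    using lift_along_m'[OF assms] by blast
  have "q - w \<in> kazhdan_mod i" by (rule cvec.subspace_diff[OF csubspace_kazhdan_mod q w(1)])
  from lift_along_dual[OF order.refl this w(3)] obtain w'
    where w': "w' \<in> kazhdan_mod i" "w' \<in> J_upto L"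
      "invariant_mod (chi_ideal low) (m'_gens \<union> a ` L) (q - w - w')"
    by blast
  then show ?thesis
    using w by (intro bexI[of _ "w + w'"])
      (auto simp: diff_diff_eq intro: cvec.subspace_add[OF csubspace_kazhdan_mod] character_ideal_add)
qed

text \<open>The elements congruent to a left multiple of \<open>b k\<close> form a left ideal, and
  it contains \<open>b k\<close> because chi vanishes there.\<close>

lemma J_upto_insert:
  assumes "y \<in> J_upto (insert k K)" "k \<in> L"
  shows "\<exists>r. y - r * emb (b k) \<in> J_upto K"
proof -
  have "J_upto (insert k K) \<subseteq> {y. \<exists>r. y - r * emb (b k) \<in> J_upto K}"
  proof (rule character_ideal_minimal)
    show "left_ideal {y. \<exists>r. y - r * emb (b k) \<in> J_upto K}"
      unfolding left_ideal_def
    proof (intro conjI ballI allI; clarify)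
      show "\<exists>r. 0 - r * emb (b k) \<in> J_upto K"
        by (rule exI[of _ 0]) (simp add: character_ideal_zero)
    next
      fix x y r s assume "x - r * emb (b k) \<in> J_upto K" "y - s * emb (b k) \<in> J_upto K"
      from character_ideal_add[OF this] show "\<exists>r. x + y - r * emb (b k) \<in> J_upto K"
        by (intro exI[of _ "r + s"]) (simp add: distrib_right add_diff_add)
    next
      fix x y r assume "x - r * emb (b k) \<in> J_upto K"
      from character_ideal_mult[OF this, of y] show "\<exists>r. y * x - r * emb (b k) \<in> J_upto K"
        by (intro exI[of _ "y * r"]) (simp add: right_diff_distrib mult.assoc)
    qed
    fix x assume x: "x \<in> low \<union> b ` insert k K"
    show "emb x - form e x *\<^sub>C 1 \<in> {y. \<exists>r. y - r * emb (b k) \<in> J_upto K}"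
    proof (cases "x = b k")
      case True
      then show ?thesis
        using chi_b[OF assms(2)] by (auto intro!: exI[of _ 1] simp: character_ideal_zero)
    next
      case False
      then have "x \<in> low \<union> b ` K" using x by blast
      from character_ideal_gen[OF this, of "form e"] show ?thesis
        by (auto intro!: exI[of _ 0])
    qed
  qed
  then show ?thesis using assms(1) by blast
qed

lemma right_mult_J_upto:
  assumes "K \<subseteq> L" "k \<in> L" "y \<in> J_upto K"
  shows "right_mult k y \<in> J_upto K"
  unfolding right_mult_def using assms chi_bb b_wt
  by (intro J_upto_mult_emb[of _ "- 1" "\<pi> k"] J_upto_parity_pow) auto

text \<open>If the derivative \<open>D\<close> kills a multiple \<open>R y\<close> of the coordinate \<open>R\<close>, then \<open>R y = 0\<close>: evaluate at
  zero in the even case, and use \<open>R\<^sup>2 = 0\<close> in the odd case.\<close>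

lemma right_mult_injective:
  assumes K: "K \<subseteq> L" and k: "k \<in> L" "k \<notin> K"
    and DR: "ad_op (\<pi> k) (a k) (right_mult k y) \<in> J_upto K"
  shows "right_mult k y \<in> J_upto K"
proof -
  define D where "D = ad_op (\<pi> k) (a k)"
  define R where "R = right_mult k"
  define c where "c = form e (bracket (a k) (b k))"
  have c: "c \<noteq> 0" using chi_ab(1)[OF k(1)] by (simp add: c_def)
  have R: "clinear R" unfolding R_def by (rule clinear_right_mult)
  have D: "clinear D" unfolding D_def by (rule clinear_ad_op)
  have RJ: "R z \<in> J_upto K" if "z \<in> J_upto K" for z
    unfolding R_def by (rule right_mult_J_upto[OF K k(1) that])
  have DJ: "D z \<in> J_upto K" if "z \<in> J_upto K" for z
    unfolding D_def
  proof (rule J_upto_ad_op[OF a_wt[OF k(1)] _ K _ that])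
    fix j assume "j \<in> K"
    then show "form e (bracket (a k) (b j)) = 0" using k K by (intro chi_ab(2)) auto
  qed simp
  have rel: "D (R z) - ksign (\<pi> k) (\<pi> k) *\<^sub>C R (D z) - c *\<^sub>C z \<in> J_upto K" for z
    using ad_op_right_mult[OF a_wt[OF k(1)] _ k(1), of z] low_J_upto
    unfolding D_def R_def c_def by auto
  show ?thesis
  proof (cases "\<pi> k = 0")
    case True
    then have rel: "D (R z) - R (D z) - c *\<^sub>C z \<in> J_upto K" for z
      using rel[of z] by simp
    have rel_n: "(D ^^ Suc n) (R z) - R ((D ^^ Suc n) z) - (of_nat (Suc n) * c) *\<^sub>C (D ^^ n) z \<in> J_upto K" for n z
    proof (induction n)
      case 0
      show ?case using rel[of z] by simp
    next
      case (Suc n)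
      have "(of_nat (Suc (Suc n)) * c) *\<^sub>C (D ^^ Suc n) z
          = (of_nat (Suc n) * c) *\<^sub>C D ((D ^^ n) z) + c *\<^sub>C (D ^^ Suc n) z"
        by (simp add: distrib_right flip: scaleC_add_left)
      then have "(D ^^ Suc (Suc n)) (R z) - R ((D ^^ Suc (Suc n)) z)
            - (of_nat (Suc (Suc n)) * c) *\<^sub>C (D ^^ Suc n) z
          = D ((D ^^ Suc n) (R z) - R ((D ^^ Suc n) z) - (of_nat (Suc n) * c) *\<^sub>C (D ^^ n) z)
            + (D (R ((D ^^ Suc n) z)) - R (D ((D ^^ Suc n) z)) - c *\<^sub>C (D ^^ Suc n) z)"
        unfolding module_hom.diff[OF D] module_hom.scale[OF D] by simp
      then show ?case
        using character_ideal_add[OF DJ[OF Suc] rel[of "(D ^^ Suc n) z"]] by (simp only:)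
    qed
    have Dn: "(D ^^ n) z \<in> J_upto K" if "z \<in> J_upto K" for z n
      by (induction n) (simp_all add: that DJ)
    \<comment> \<open>Since \<open>D (R y)\<close> vanishes modulo \<open>J_upto K\<close>,
      \<open>rel_n\<close> turns \<open>D^(n+1) y = 0\<close> into \<open>D^n y = 0\<close>; local
      nilpotency starts this descent, which ends at \<open>y\<close>.\<close>
    have down: "y \<in> J_upto K" if "(D ^^ n) y \<in> J_upto K" for n
      using that
    proof (induction n)
      case (Suc n)
      have "(D ^^ Suc n) (R y) \<in> J_upto K"
        using Dn[OF DR, of n] by (simp add: D_def R_def funpow_swap1)
      from character_ideal_diff[OF character_ideal_diff[OF this RJ[OF Suc.prems]] rel_n[of n y]]
      have "(of_nat (Suc n) * c) *\<^sub>C (D ^^ n) y \<in> J_upto K" by simp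
      then have "(1 / (of_nat (Suc n) * c)) *\<^sub>C (of_nat (Suc n) * c) *\<^sub>C (D ^^ n) y \<in> J_upto K"
        by (rule character_ideal_scaleC)
      moreover have "of_nat (Suc n) * c \<noteq> 0" using c of_nat_neq_0 by (metis mult_eq_0_iff)
      ultimately have "(D ^^ n) y \<in> J_upto K" by simp
      then show ?case by (rule Suc.IH)
    qed simp
    obtain n where "(D ^^ n) y \<in> chi_ideal low"
      using ad_op_locally_nilpotent[OF a_wt[OF k(1)]] unfolding D_def by blast
    then show ?thesis using down[of n] low_J_upto RJ unfolding R_def by blast
  next
    case False
    then have \<pi>: "\<pi> k = 1" by (cases "\<pi> k") simp_all
    have bk: "b k \<in> wt (- 1) 1" "b k \<in> gr 1" using b_wt[OF k(1)] \<pi> by (auto simp: wt_def)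
    have "emb (bracket (b k) (b k)) \<in> chi_ideal low"
    proof (rule chi_ideal_emb)
      show "bracket (b k) (b k) \<in> low" using bracket_wt[OF bk(1) bk(1)] by (rule lowI) simp
      show "form e (bracket (b k) (b k)) = 0" by (rule chi_bb[OF k(1) k(1)])
    qed
    moreover have "emb (bracket (b k) (b k)) = emb (b k) * emb (b k) + emb (b k) * emb (b k)"
      using emb_supercommutes[OF bk(2) bk(2)] by (simp add: ksign_def)
    ultimately have "(1 / 2) *\<^sub>C (emb (b k) * emb (b k) + emb (b k) * emb (b k)) \<in> chi_ideal low"
      by (simp only: character_ideal_scaleC)
    then have sq: "emb (b k) * emb (b k) \<in> chi_ideal low"
      by (simp flip: scaleC_add_left add: scaleC_add_right)
    have RR: "R (R z) \<in> J_upto K" for z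
    proof -
      have "R (R z) = - (parity_pow 1 (parity_pow 1 z) * (emb (b k) * emb (b k)))"
        by (simp add: R_def right_mult_def \<pi> parity_pow_mult parity_pow_emb[OF bk(2)] ksign_def mult.assoc)
      also have "\<dots> \<in> chi_ideal low" by (intro character_ideal_neg character_ideal_mult sq)
      finally show ?thesis using low_J_upto by blast
    qed
    \<comment> \<open>Applying \<open>R\<close> to \<open>D R + R D = c\<close> leaves
      \<open>c R y\<close>: the first term vanishes by hypothesis, the second because
      \<open>R\<close> squares to zero.\<close>
    have "R (D (R y)) \<in> J_upto K" using RJ DR unfolding D_def R_def .
    from character_ideal_add[OF this RR[of "D y"]] have sum: "R (D (R y)) + R (R (D y)) \<in> J_upto K" .
    have "R (D (R y)) + R (R (D y)) - c *\<^sub>C R y \<in> J_upto K"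
      using RJ[OF rel[of y]] by (simp add: \<pi> ksign_def module_hom.diff[OF R] module_hom.add[OF R] module_hom.scale[OF R])
    from character_ideal_diff[OF sum this] have "c *\<^sub>C R y \<in> J_upto K"
      by (simp only: diff_diff_eq2 add_diff_cancel_left')
    then have "(1 / c) *\<^sub>C c *\<^sub>C R y \<in> J_upto K" by (rule character_ideal_scaleC)
    then show ?thesis using c by (simp add: R_def)
  qed
qed

text \<open>Modulo \<open>J_upto K\<close> the element is a multiple of \<open>b k\<close>, which
  invariance under \<open>a k\<close> and \<open>right_mult_injective\<close> remove;
  \<open>a k\<close> preserves \<open>J_upto K\<close> because it pairs to zero with the other
  \<open>b j\<close>.\<close>

lemma lift_unique:
  assumes "K \<subseteq> L" "y \<in> J_upto K" "invariant_mod (chi_ideal low) (a ` L) y"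
  shows "y \<in> chi_ideal low"
proof -
  have "finite K" using assms(1) finite_L finite_subset by blast
  then show ?thesis using assms(1,2)
  proof (induction K rule: finite_induct)
    case (insert k K)
    then have k: "k \<in> L" "k \<notin> K" "K \<subseteq> L" by auto
    obtain r where r: "y - r * emb (b k) \<in> J_upto K"
      using J_upto_insert[OF insert.prems(2) k(1)] by blast
    define s where "s = parity_pow (\<pi> k) r"
    have "\<pi> k + \<pi> k = 0" by (cases "\<pi> k") simp_all
    then have s: "r * emb (b k) = right_mult k s"
      by (simp add: s_def right_mult_def parity_pow_parity_pow)
    have "ad_op (\<pi> k) (a k) (y - right_mult k s) \<in> J_upto K"
      using k chi_ab(2) r unfolding s by (intro J_upto_ad_op[OF a_wt[OF k(1)]]) auto
    moreover have "ad_op (\<pi> k) (a k) y \<in> J_upto K"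
      using assms(3) k(1) a_wt[OF k(1)] low_J_upto unfolding invariant_mod_def by (auto simp: wt_def)
    ultimately have "ad_op (\<pi> k) (a k) y - ad_op (\<pi> k) (a k) (y - right_mult k s) \<in> J_upto K"
      by (intro character_ideal_diff)
    then have "ad_op (\<pi> k) (a k) (right_mult k s) \<in> J_upto K" by (simp add: ad_op_diff)
    from right_mult_injective[OF k(3,1,2) this] r[unfolded s]
    have "y - right_mult k s + right_mult k s \<in> J_upto K" by (intro character_ideal_add)
    then have "y \<in> J_upto K" by simp
    then show ?case by (rule insert.IH[OF k(3)])
  qed simp
qed

end

section \<open>The isomorphism\<close>

lemma coset_eq_iff:
  assumes "csubspace A"
  shows "x +o A = y +o A \<longleftrightarrow> x - y \<in> A"
proof
  assume "x +o A = y +o A"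
  moreover have "x \<in> x +o A"
    using cvec.subspace_0[OF assms] by (auto simp: elt_set_plus_def)
  ultimately obtain z where "z \<in> A" "x = y + z" by (auto simp: elt_set_plus_def)
  then show "x - y \<in> A" by simp
next
  have "x +o A \<subseteq> y +o A" if "x - y \<in> A" for x y
  proof
    fix w assume "w \<in> x +o A"
    then obtain z where z: "z \<in> A" "w = x + z" by (auto simp: elt_set_plus_def)
    have "x - y + z \<in> A" by (rule cvec.subspace_add[OF assms that z(1)])
    then show "w \<in> y +o A"
      unfolding elt_set_plus_def using z(2) by (intro CollectI bexI[of _ "x - y + z"]) simp_all
  qed
  note sub = this
  assume xy: "x - y \<in> A"
  from cvec.subspace_neg[OF assms this] have "y - x \<in> A" by simp
  with xy sub show "x +o A = y +o A" by blast
qed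

lemma coset_self: "csubspace A \<Longrightarrow> x \<in> x +o A"
  using cvec.subspace_0 by (auto simp: elt_set_plus_def)

lemma coset_memD: "w \<in> x +o A \<Longrightarrow> w - x \<in> A" for x :: "'a::cvector"
  by (auto simp: elt_set_plus_def)

text \<open>The even part is the average of \<open>y\<close> and its image under the parity
  automorphism.\<close>

lemma homogeneous_part_mem:
  fixes y :: "'g::lie_superalgebra uea"
  assumes A: "csubspace A" and y: "y \<in> A" "parity_pow 1 y \<in> A"
  shows "homogeneous_part p y \<in> A"
proof -
  have 0: "homogeneous_part 0 y = (1 / 2) *\<^sub>C (y + parity_pow 1 y)"
  proof -
    have "y + parity_pow 1 y = homogeneous_part 0 y + homogeneous_part 0 y"
      by (simp add: parity_pow_def uea_parity_inv_eq homogeneous_part_1)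
    then show ?thesis by (simp only: scaleC_add_right) (simp flip: scaleC_add_left)
  qed
  have "homogeneous_part 0 y \<in> A"
    unfolding 0 by (intro cvec.subspace_scale[OF A] cvec.subspace_add[OF A] y)
  then show ?thesis
    using cvec.subspace_diff[OF A y(1), of "homogeneous_part 0 y"]
    by (cases p) (simp_all add: homogeneous_part_1)
qed

lemma invariant_algebra_simps:
  "carrier (invariant_algebra A S) = {y +o A |y. \<forall>a\<in>S. supercommutator (emb a) y \<in> A}"
  "X \<otimes>\<^bsub>invariant_algebra A S\<^esub> Y = (\<Union>x\<in>X. \<Union>y\<in>Y. (x * y) +o A)"
  "X \<oplus>\<^bsub>invariant_algebra A S\<^esub> Y = (\<Union>x\<in>X. \<Union>y\<in>Y. (x + y) +o A)"
  "\<one>\<^bsub>invariant_algebra A S\<^esub> = 1 +o A"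
  "c \<odot>\<^bsub>invariant_algebra A S\<^esub> X = (\<Union>x\<in>X. (c *\<^sub>C x) +o A)"
  by (simp_all add: invariant_algebra_def)

lemma coset_plus:
  assumes A: "csubspace A"
  shows "(x +o A) \<oplus>\<^bsub>invariant_algebra A S\<^esub> (y +o A) = (x + y) +o A"
proof -
  have "(x' + y') +o A = (x + y) +o A" if "x' \<in> x +o A" "y' \<in> y +o A" for x' y'
    using cvec.subspace_add[OF A coset_memD[OF that(1)] coset_memD[OF that(2)]]
    unfolding coset_eq_iff[OF A] by (simp add: add_diff_add)
  then show ?thesis
    unfolding invariant_algebra_simps using coset_self[OF A] by blast
qed

lemma coset_scaleC:
  assumes A: "csubspace A"
  shows "c \<odot>\<^bsub>invariant_algebra A S\<^esub> (x +o A) = (c *\<^sub>C x) +o A"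
proof -
  have "(c *\<^sub>C x') +o A = (c *\<^sub>C x) +o A" if "x' \<in> x +o A" for x'
    using cvec.subspace_scale[OF A coset_memD[OF that], of c]
    unfolding coset_eq_iff[OF A] by (simp add: cvec.scale_right_diff_distrib)
  then show ?thesis
    unfolding invariant_algebra_simps using coset_self[OF A] by blast
qed

text \<open>Changing \<open>x\<close> within its coset alters the product by an element of
  \<open>A * y\<close>, which a left ideal need not absorb; invariance of \<open>y\<close> later
  supplies \<open>right\<close>.\<close>

lemma coset_times:
  assumes A: "csubspace A" and left: "\<And>z r. z \<in> A \<Longrightarrow> r * z \<in> A" and right: "\<And>z. z \<in> A \<Longrightarrow> z * y \<in> A"
  shows "(x +o A) \<otimes>\<^bsub>invariant_algebra A S\<^esub> (y +o A) = (x * y) +o A"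
proof -
  have "(x' * y') +o A = (x * y) +o A" if "x' \<in> x +o A" "y' \<in> y +o A" for x' y'
  proof -
    have "x' * (y' - y) + (x' - x) * y \<in> A"
      by (intro cvec.subspace_add[OF A] left right coset_memD that)
    then show ?thesis unfolding coset_eq_iff[OF A] by (simp add: algebra_simps)
  qed
  then show ?thesis
    unfolding invariant_algebra_simps using coset_self[OF A] by blast
qed

context lagrangian
begin

lemma invariant_mod_span:
  assumes A: "csubspace A" and S: "\<And>x. x \<in> S \<Longrightarrow> \<exists>p. x \<in> gr p"
  shows "(\<forall>x\<in>cspan S. supercommutator (emb x) y \<in> A) \<longleftrightarrow> invariant_mod A S y"
proof
  assume *: "\<forall>x\<in>cspan S. supercommutator (emb x) y \<in> A"
  show "invariant_mod A S y"
    unfolding invariant_mod_def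
  proof (intro ballI allI impI)
    fix x p assume "x \<in> S" "x \<in> gr p"
    with * show "ad_op p x y \<in> A"
      using supercommutator_homogeneous[of x p y] cvec.span_base[of x S] by auto
  qed
next
  assume inv: "invariant_mod A S y"
  show "\<forall>x\<in>cspan S. supercommutator (emb x) y \<in> A"
  proof
    fix x assume "x \<in> cspan S"
    then show "supercommutator (emb x) y \<in> A"
    proof (rule clinear_span[where T = "\<lambda>x. supercommutator (emb x) y", OF _ A, rotated 2])
      show "clinear (\<lambda>x. supercommutator (emb x) y)"
        by (rule clinearI) (simp_all add: emb_add emb_scaleC supercommutator_add_left supercommutator_scaleC_left)
      fix x assume x: "x \<in> S"
      then obtain p where "x \<in> gr p" using S by blast
      then show "supercommutator (emb x) y \<in> A"
        using inv x by (simp add: supercommutator_homogeneous invariant_mod_def)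
    qed
  qed
qed

lemma invariant_mod_mono:
  "invariant_mod A S y \<Longrightarrow> A \<subseteq> A' \<Longrightarrow> S' \<subseteq> S \<Longrightarrow> invariant_mod A' S' y"
  unfolding invariant_mod_def by blast

text \<open>For even \<open>x\<close>, \<open>(x - chi(x)) z = [x, z] + z (x - chi(x))\<close>; for
  odd \<open>x\<close>, chi vanishes and only a sign changes.\<close>

lemma character_ideal_mult_invariant:
  assumes T: "\<And>x. x \<in> T \<Longrightarrow> x \<in> gr 0 \<or> (x \<in> gr 1 \<and> form e x = 0)"
    and z: "invariant_mod (chi_ideal T) T z" and y: "y \<in> chi_ideal T"
  shows "y * z \<in> chi_ideal T"
proof -
  have "chi_ideal T \<subseteq> {y. y * z \<in> chi_ideal T}"
  proof (rule character_ideal_minimal)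
    show "left_ideal {y. y * z \<in> chi_ideal T}"
      by (auto simp: left_ideal_def distrib_right mult.assoc character_ideal_zero
          intro: character_ideal_add character_ideal_mult)
    fix x assume x: "x \<in> T"
    have "(emb x - form e x *\<^sub>C 1) * z \<in> chi_ideal T"
      using T[OF x]
    proof
      assume x0: "x \<in> gr 0"
      then have "ad_op 0 x z \<in> chi_ideal T" using z x by (auto simp: invariant_mod_def)
      from character_ideal_add[OF this character_ideal_mult[OF character_ideal_gen[OF x], of z]]
      show ?thesis by (simp add: ad_op_def algebra_simps scaleC_mult_left scaleC_mult_right)
    next
      assume x1: "x \<in> gr 1 \<and> form e x = 0"
      then have "ad_op 1 x z \<in> chi_ideal T" using z x by (auto simp: invariant_mod_def)
      from character_ideal_add[OF this character_ideal_mult[OF chi_ideal_emb[OF x], of "parity_pow 1 z"]] x1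
      show ?thesis by (simp add: ad_op_def)
    qed
    then show "emb x - form e x *\<^sub>C 1 \<in> {y. y * z \<in> chi_ideal T}" by simp
  qed
  then show ?thesis using y by blast
qed

section \<open>The two invariant algebras in terms of homogeneous generators\<close>

definition n_gens :: "'g set"
  where "n_gens = m'_gens \<union> a ` L"

lemma n_gens_wt:
  assumes "x \<in> n_gens"
  obtains i p where "x \<in> wt i p" "i \<le> - 1"
  using assms m'_gens_wt a_wt unfolding n_gens_def by (metis UnE imageE order_refl)

abbreviation invariant_n :: "'g uea \<Rightarrow> bool"
  where "invariant_n \<equiv> invariant_mod (chi_ideal low) n_gens"

abbreviation invariant_m' :: "'g uea \<Rightarrow> bool"
  where "invariant_m' \<equiv> invariant_mod (J_upto L) m'_gens"

lemma low_n_gens: "low \<subseteq> n_gens"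
  unfolding n_gens_def m'_gens_def by blast

lemma invariant_n_m': "invariant_n y \<Longrightarrow> invariant_m' y"
  by (erule invariant_mod_mono) (auto simp: n_gens_def low_J_upto)

lemma invariant_mod_diff:
  assumes "csubspace A" "invariant_mod A S x" "invariant_mod A S y"
  shows "invariant_mod A S (x - y)"
  using assms unfolding invariant_mod_def by (simp add: ad_op_diff cvec.subspace_diff)

lemma invariant_mod_add:
  assumes "csubspace A" "invariant_mod A S x" "invariant_mod A S y"
  shows "invariant_mod A S (x + y)"
  using assms unfolding invariant_mod_def by (simp add: ad_op_add cvec.subspace_add)

lemma invariant_n_low:
  assumes "y \<in> chi_ideal low"
  shows "invariant_n y"
  unfolding invariant_mod_def
proof (intro ballI allI impI)
  fix x p assume x: "x \<in> n_gens" "x \<in> gr p"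
  obtain i q where "x \<in> wt i q" "i \<le> - 1" using n_gens_wt[OF x(1)] .
  then show "ad_op p x y \<in> chi_ideal low"
    using x(2) assms by (intro ad_op_low[of x i p]) (auto simp: wt_def)
qed

lemma invariant_m'_J:
  assumes "y \<in> J_upto L"
  shows "invariant_m' y"
  unfolding invariant_mod_def
proof (intro ballI allI impI)
  fix x p assume x: "x \<in> m'_gens" "x \<in> gr p"
  obtain i q where "x \<in> wt i q" "i \<le> - 1" using m'_gens_wt[OF x(1)] .
  then show "ad_op p x y \<in> J_upto L"
    using x assms chi_m'_gens by (intro J_upto_ad_op[of x i p]) (auto simp: wt_def)
qed

lemma invariant_n_cong: "x - y \<in> chi_ideal low \<Longrightarrow> invariant_n y \<Longrightarrow> invariant_n x"
  using invariant_mod_add[OF csubspace_character_ideal invariant_n_low[of "x - y"], of y] by simp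

lemma invariant_m'_cong: "x - y \<in> J_upto L \<Longrightarrow> invariant_m' y \<Longrightarrow> invariant_m' x"
  using invariant_mod_add[OF csubspace_character_ideal invariant_m'_J[of "x - y"], of y] by simp

lemma low_mult: "invariant_n z \<Longrightarrow> y \<in> chi_ideal low \<Longrightarrow> y * z \<in> chi_ideal low"
  using low_n_gens low_parity by (intro character_ideal_mult_invariant) (auto elim: invariant_mod_mono)

lemma J_mult:
  assumes "invariant_m' z" "y \<in> J_upto L"
  shows "y * z \<in> J_upto L"
proof (rule character_ideal_mult_invariant[OF _ _ assms(2)])
  show "invariant_mod (J_upto L) (low \<union> b ` L) z"
    using assms(1) by (rule invariant_mod_mono) (auto simp: m'_gens_def)
qed (use J_upto_parity in blast)

lemma invariant_n_mult:
  assumes "invariant_n y" "invariant_n z"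
  shows "invariant_n (y * z)"
  unfolding invariant_mod_def
proof (intro ballI allI impI)
  fix x p assume x: "x \<in> n_gens" "x \<in> gr p"
  then have "ad_op p x y * z \<in> chi_ideal low"
    using assms low_mult unfolding invariant_mod_def by blast
  moreover have "parity_pow p y * ad_op p x z \<in> chi_ideal low"
    using x assms(2) unfolding invariant_mod_def by (blast intro: character_ideal_mult)
  ultimately show "ad_op p x (y * z) \<in> chi_ideal low"
    unfolding ad_op_mult by (rule character_ideal_add)
qed

lemma invariant_n_scaleC: "invariant_n y \<Longrightarrow> invariant_n (c *\<^sub>C y)"
  unfolding invariant_mod_def by (simp add: ad_op_scaleC character_ideal_scaleC)

lemma invariant_n_parity_pow: "invariant_n y \<Longrightarrow> invariant_n (parity_pow q y)"
  unfolding invariant_mod_def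
proof (intro ballI allI impI)
  fix x p assume *: "\<forall>x\<in>n_gens. \<forall>p. x \<in> gr p \<longrightarrow> ad_op p x y \<in> chi_ideal low" and x: "x \<in> n_gens" "x \<in> gr p"
  then have "ksign p q *\<^sub>C parity_pow q (ad_op p x y) \<in> chi_ideal low"
    by (intro character_ideal_scaleC parity_pow_low) blast
  then show "ad_op p x (parity_pow q y) \<in> chi_ideal low"
    by (simp add: parity_pow_ad_op[OF x(2)])
qed

abbreviation W' :: "(complex, 'g uea set) module"
  where "W' \<equiv> invariant_algebra (J_upto L) (cspan m'_gens)"

abbreviation Wfin :: "(complex, 'g uea set) module"
  where "Wfin \<equiv> invariant_algebra (chi_ideal low) (cspan n_gens)"

text \<open>The carrier asks for one invariant representative; elements of the ideal are themselves
  invariant, so every representative is.\<close>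

lemma coset_W': "y +o J_upto L \<in> carrier W' \<longleftrightarrow> invariant_m' y"
proof -
  have gr: "\<exists>p. x \<in> gr p" if "x \<in> m'_gens" for x
    using m'_gens_wt[OF that] by (auto simp: wt_def)
  have iff: "(\<forall>x\<in>cspan m'_gens. supercommutator (emb x) z \<in> J_upto L) \<longleftrightarrow> invariant_m' z" for z
    by (rule invariant_mod_span[OF csubspace_character_ideal gr])
  show ?thesis
    unfolding invariant_algebra_simps iff
    using invariant_m'_cong
    by (auto simp: coset_eq_iff[OF csubspace_character_ideal] character_ideal_zero intro: exI[of _ y])
qed

lemma coset_Wfin: "y +o chi_ideal low \<in> carrier Wfin \<longleftrightarrow> invariant_n y"
proof -
  have gr: "\<exists>p. x \<in> gr p" if "x \<in> n_gens" for x
    using n_gens_wt[OF that] by (auto simp: wt_def)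
  have iff: "(\<forall>x\<in>cspan n_gens. supercommutator (emb x) z \<in> chi_ideal low) \<longleftrightarrow> invariant_n z" for z
    by (rule invariant_mod_span[OF csubspace_character_ideal gr])
  show ?thesis
    unfolding invariant_algebra_simps iff
    using invariant_n_cong
    by (auto simp: coset_eq_iff[OF csubspace_character_ideal] character_ideal_zero intro: exI[of _ y])
qed

lemma carrier_W'_coset: "X \<in> carrier W' \<Longrightarrow> \<exists>y. X = y +o J_upto L"
  and carrier_Wfin_coset: "X \<in> carrier Wfin \<Longrightarrow> \<exists>y. X = y +o chi_ideal low"
  unfolding invariant_algebra_simps by blast+

text \<open>An n-invariant representative exists by \<open>lift_exists\<close>, and
  \<open>lift_unique\<close> makes its coset independent of the choice.\<close>

definition lift :: "'g uea set \<Rightarrow> 'g uea set"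
  where "lift X = (SOME y. y \<in> X \<and> invariant_n y) +o chi_ideal low"

lemma lift_coset:
  assumes "invariant_n y"
  shows "lift (y +o J_upto L) = y +o chi_ideal low"
proof -
  define z where "z = (SOME z. z \<in> y +o J_upto L \<and> invariant_n z)"
  have "z \<in> y +o J_upto L \<and> invariant_n z"
    unfolding z_def by (rule someI[of _ y]) (simp add: assms coset_self[OF csubspace_character_ideal])
  then have "z - y \<in> J_upto L" "invariant_n (z - y)"
    using coset_memD invariant_mod_diff[OF csubspace_character_ideal _ assms] by blast+
  then have "z - y \<in> chi_ideal low"
    by (intro lift_unique[of L]) (auto elim: invariant_mod_mono simp: n_gens_def)
  then show ?thesis
    by (simp add: lift_def coset_eq_iff[OF csubspace_character_ideal] flip: z_def)
qed

text \<open>The correction stays in the filtration only up to the ideal of \<open>low\<close>; a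
  change within that ideal, which respects n-invariance, gives a representative in
  \<open>kazhdan h i\<close> itself.\<close>

lemma lift_exists_kazhdan:
  assumes "y \<in> kazhdan h i" "invariant_m' y"
  shows "\<exists>z\<in>kazhdan h i. invariant_n z \<and> z - y \<in> J_upto L"
proof -
  have "y \<in> kazhdan_mod i" using assms(1) by (rule kazhdan_modI) (simp add: character_ideal_zero)
  from lift_exists[OF this assms(2)] obtain w where w: "w \<in> kazhdan_mod i" "w \<in> J_upto L" "invariant_n (y - w)"
    unfolding n_gens_def by blast
  have "y - w \<in> kazhdan_mod i"
    by (rule cvec.subspace_diff[OF csubspace_kazhdan_mod \<open>y \<in> kazhdan_mod i\<close> w(1)])
  then obtain z where z: "z \<in> kazhdan h i" "y - w - z \<in> chi_ideal low" unfolding kazhdan_mod_def by blast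
  from character_ideal_neg[OF z(2)] have z': "z - (y - w) \<in> chi_ideal low" by simp
  from character_ideal_diff[OF subsetD[OF low_J_upto z'] w(2)] have "z - y \<in> J_upto L" by simp
  then show ?thesis using z(1) invariant_n_cong[OF z' w(3)] by blast
qed

text \<open>A homogeneous part of a lift of \<open>y\<close> is again a lift, as the invariants and
  J are stable under the parity automorphism.\<close>

lemma lift_exists_gr:
  assumes "y \<in> gr p" "invariant_m' y"
  shows "\<exists>z\<in>gr p. invariant_n z \<and> z - y \<in> J_upto L"
proof -
  obtain i where "y \<in> kazhdan h i" using kazhdan_exhaustive by blast
  then obtain z where z: "invariant_n z" "z - y \<in> J_upto L" using lift_exists_kazhdan assms(2) by blast
  have inv: "csubspace (Collect invariant_n)"
    using invariant_n_low[OF character_ideal_zero] invariant_mod_add[OF csubspace_character_ideal] invariant_n_scaleC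
    by (auto simp: cvec.subspace_def)
  have "invariant_n (homogeneous_part p z)"
    using homogeneous_part_mem[OF inv, of z p] z(1) invariant_n_parity_pow by simp
  moreover have "homogeneous_part p (z - y) \<in> J_upto L"
    using z(2) J_upto_parity_pow[of L] by (intro homogeneous_part_mem csubspace_character_ideal) auto
  moreover have "homogeneous_part p (z - y) = homogeneous_part p z - y"
    using homogeneous_part_add[of p "z - y" y] homogeneous_part_same[OF assms(1)] by simp
  ultimately show ?thesis using homogeneous_part_gr by metis
qed

text \<open>Stated for any \<open>V\<close> to serve parity components, Kazhdan levels and, with
  \<open>UNIV\<close>, surjectivity.\<close>

lemma lift_coset_part:
  assumes "\<And>y. y \<in> V \<Longrightarrow> invariant_m' y \<Longrightarrow> \<exists>z\<in>V. invariant_n z \<and> z - y \<in> J_upto L"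
  shows "lift ` coset_part (J_upto L) (cspan m'_gens) V = coset_part (chi_ideal low) (cspan n_gens) V"
proof (intro equalityI subsetI)
  fix Z assume "Z \<in> lift ` coset_part (J_upto L) (cspan m'_gens) V"
  then obtain y where y: "y \<in> V" "invariant_m' y" "Z = lift (y +o J_upto L)"
    unfolding coset_part_def using coset_W' by auto
  from assms[OF y(1,2)] obtain z where z: "z \<in> V" "invariant_n z" "z - y \<in> J_upto L" by blast
  have "Z = z +o chi_ideal low"
    using y(3) z(3) lift_coset[OF z(2)] coset_eq_iff[OF csubspace_character_ideal, of z "form e" "low \<union> b ` L" y]
    by simp
  then show "Z \<in> coset_part (chi_ideal low) (cspan n_gens) V"
    unfolding coset_part_def using z coset_Wfin by blast
next
  fix Z assume "Z \<in> coset_part (chi_ideal low) (cspan n_gens) V"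
  then obtain y where y: "y \<in> V" "invariant_n y" "Z = y +o chi_ideal low"
    unfolding coset_part_def using coset_Wfin by auto
  then have "y +o J_upto L \<in> coset_part (J_upto L) (cspan m'_gens) V"
    unfolding coset_part_def using coset_W' invariant_n_m' by blast
  then show "Z \<in> lift ` coset_part (J_upto L) (cspan m'_gens) V"
    using lift_coset[OF y(2)] y(3) by (metis imageI)
qed

lemma W'_representative:
  assumes "X \<in> carrier W'"
  obtains y where "invariant_n y" "X = y +o J_upto L"
proof -
  obtain y where y: "X = y +o J_upto L" using carrier_W'_coset[OF assms] by blast
  then have "invariant_m' y" using assms coset_W' by simp
  moreover obtain i where "y \<in> kazhdan h i" using kazhdan_exhaustive by blast
  ultimately obtain z where "invariant_n z" "z - y \<in> J_upto L" using lift_exists_kazhdan by blast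
  then show thesis
    using that[of z] y coset_eq_iff[OF csubspace_character_ideal, of z "form e" "low \<union> b ` L" y] by simp
qed

text \<open>On n-invariant representatives \<open>lift\<close> only exchanges the ideal, so
  compatibility with the operations is inherited from U(g).\<close>

lemma kazhdan_isomorphism_lift:
  "kazhdan_isomorphism h (J_upto L) (cspan m'_gens) (chi_ideal low) (cspan n_gens) lift"
proof -
  note sub = csubspace_character_ideal
  have one: "invariant_n 1" unfolding invariant_mod_def by (simp add: character_ideal_zero)
  have closed: "lift X \<in> carrier Wfin" if "X \<in> carrier W'" for X
    using W'_representative[OF that] by (metis lift_coset coset_Wfin)
  have mult: "lift (X \<otimes>\<^bsub>W'\<^esub> Y) = lift X \<otimes>\<^bsub>Wfin\<^esub> lift Y"
    and plus: "lift (X \<oplus>\<^bsub>W'\<^esub> Y) = lift X \<oplus>\<^bsub>Wfin\<^esub> lift Y"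
    if XY: "X \<in> carrier W'" "Y \<in> carrier W'" for X Y
  proof -
    obtain x where x: "invariant_n x" "X = x +o J_upto L" using W'_representative[OF XY(1)] .
    obtain y where y: "invariant_n y" "Y = y +o J_upto L" using W'_representative[OF XY(2)] .
    have "X \<otimes>\<^bsub>W'\<^esub> Y = (x * y) +o J_upto L"
      unfolding x(2) y(2) by (rule coset_times[OF sub character_ideal_mult J_mult[OF invariant_n_m'[OF y(1)]]])
    moreover have "(x +o chi_ideal low) \<otimes>\<^bsub>Wfin\<^esub> (y +o chi_ideal low) = (x * y) +o chi_ideal low"
      by (rule coset_times[OF sub character_ideal_mult low_mult[OF y(1)]])
    ultimately show "lift (X \<otimes>\<^bsub>W'\<^esub> Y) = lift X \<otimes>\<^bsub>Wfin\<^esub> lift Y"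
      using lift_coset[OF invariant_n_mult[OF x(1) y(1)]] lift_coset[OF x(1)] lift_coset[OF y(1)] x(2) y(2)
      by simp
    show "lift (X \<oplus>\<^bsub>W'\<^esub> Y) = lift X \<oplus>\<^bsub>Wfin\<^esub> lift Y"
      using lift_coset[OF invariant_mod_add[OF sub x(1) y(1)]] lift_coset[OF x(1)] lift_coset[OF y(1)] x(2) y(2)
      by (simp add: coset_plus[OF sub])
  qed
  have "lift \<in> Ring.ring_hom W' Wfin"
    using closed mult plus lift_coset[OF one] by (intro ring_hom_memI) (simp_all add: invariant_algebra_simps(4))
  moreover have "bij_betw lift (carrier W') (carrier Wfin)"
  proof (rule bij_betw_imageI)
    show "inj_on lift (carrier W')"
    proof (rule inj_onI)
      fix X Y assume XY: "X \<in> carrier W'" "Y \<in> carrier W'" "lift X = lift Y"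
      obtain x where x: "invariant_n x" "X = x +o J_upto L" using W'_representative[OF XY(1)] .
      obtain y where y: "invariant_n y" "Y = y +o J_upto L" using W'_representative[OF XY(2)] .
      have "x - y \<in> chi_ideal low"
        using XY(3) lift_coset[OF x(1)] lift_coset[OF y(1)] x(2) y(2) coset_eq_iff[OF sub] by metis
      then show "X = Y" unfolding x(2) y(2) coset_eq_iff[OF sub] using low_J_upto by blast
    qed
    have "carrier W' = coset_part (J_upto L) (cspan m'_gens) UNIV"
      "carrier Wfin = coset_part (chi_ideal low) (cspan n_gens) UNIV"
      unfolding coset_part_def using carrier_W'_coset carrier_Wfin_coset by auto
    moreover have "\<exists>z\<in>UNIV. invariant_n z \<and> z - y \<in> J_upto L" if "invariant_m' y" for y
      using lift_exists_kazhdan[OF _ that] kazhdan_exhaustive by blast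
    ultimately show "lift ` carrier W' = carrier Wfin"
      using lift_coset_part[of UNIV] by simp
  qed
  moreover have "lift (c \<odot>\<^bsub>W'\<^esub> X) = c \<odot>\<^bsub>Wfin\<^esub> lift X" if "X \<in> carrier W'" for c X
  proof -
    obtain x where x: "invariant_n x" "X = x +o J_upto L" using \<open>X \<in> carrier W'\<close> by (rule W'_representative)
    then show ?thesis
      using lift_coset[OF invariant_n_scaleC[OF x(1)], of c] lift_coset[OF x(1)] by (simp add: coset_scaleC[OF sub])
  qed
  ultimately show ?thesis
    unfolding kazhdan_isomorphism_def ring_iso_def
    using lift_coset_part[OF lift_exists_gr] lift_coset_part[OF lift_exists_kazhdan] by simp
qed

end

section \<open>The basic Lie superalgebra case\<close>

lemma graded_form_sl2:
  assumes fd: "\<exists>B :: 'g::lie_superalgebra set. finite B \<and> cspan B = UNIV"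
    and form: "basic_form form" and nil: "ad_nilpotent e" and triple: "even_sl2_triple e h (f :: 'g)"
  shows "graded_form form e h"
proof -
  obtain B :: "'g set" where B: "finite B" "cspan B = UNIV" using fd by blast
  have gr: "e \<in> gr 0" "h \<in> gr 0" "f \<in> gr 0"
    and he: "bracket h e = 2 *\<^sub>C e" and hf: "bracket h f = - (2 *\<^sub>C f)" and ef: "bracket e f = h"
    using triple by (auto simp: even_sl2_triple_def)
  have lin: "clinear (bracket x)" for x :: 'g
    by (rule clinearI) (simp_all add: bracket_add_right bracket_scaleC_right)
  have Jacobi: "bracket x (bracket y z) = bracket (bracket x y) z + bracket y (bracket x z)"
    if "x \<in> gr 0" "y \<in> gr 0" for x y z :: 'g
    using bracket_super_Jacobi[OF that, of z] by simp
  have minus: "bracket (- x) y = - bracket x y" for x y :: 'g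
    using bracket_scaleC_left[of "- 1" x y] by simp
  interpret sl2_rep "bracket e" "bracket h" "bracket f" B
  proof (rule sl2_rep.intro)
    show "bracket h (bracket e x) = bracket e (bracket h x) + 2 *\<^sub>C bracket e x" for x
      using Jacobi[OF gr(2,1), of x] by (simp add: he bracket_scaleC_left)
    show "bracket h (bracket f x) = bracket f (bracket h x) - 2 *\<^sub>C bracket f x" for x
      using Jacobi[OF gr(2,3), of x] by (simp add: hf minus bracket_scaleC_left)
    show "bracket e (bracket f x) = bracket f (bracket e x) + bracket h x" for x
      using Jacobi[OF gr(1,3), of x] by (simp add: ef)
  qed (use lin B nil in \<open>auto simp: ad_nilpotent_def\<close>)
  show ?thesis
  proof (rule graded_form.intro)
    show "cspan (\<Union>i. eigenspace h i) = UNIV"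
      using weight_decomposition unfolding eigenspace_def .
    show "x = 0" if "x \<in> eigenspace h i" "i < 0" "bracket e x = 0" for x i
      using E_injective_negative[of x i] that by (simp add: eigenspace_def)
    show "\<exists>D. \<forall>i x. i < - int D \<longrightarrow> x \<in> eigenspace h i \<longrightarrow> x = 0"
      using negative_weights_bounded by (simp add: eigenspace_def)
  qed (use fd form gr he in simp_all)
qed

lemma span_span_Un: "cspan (cspan S \<union> T) = cspan (S \<union> T)"
proof (rule antisym)
  show "cspan (cspan S \<union> T) \<subseteq> cspan (S \<union> T)"
    by (rule cvec.span_minimal)
      (use cvec.span_mono[of S "S \<union> T"] cvec.span_superset[of "S \<union> T"] in auto)
  show "cspan (S \<union> T) \<subseteq> cspan (cspan S \<union> T)"
    by (rule cvec.span_mono) (use cvec.span_superset[of S] in auto)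
qed

section \<open>Spans of homogeneous generators and the dimension of the even part of g(-1)\<close>

context graded_form
begin

lemma eigenspace_subset_span: "(\<And>p. wt i p \<subseteq> cspan S) \<Longrightarrow> eigenspace h i \<subseteq> cspan S"
  using homogeneous_part_sum homogeneous_part_wt cvec.span_add by (metis subset_iff)

lemma span_low: "cspan low = eigenspaces_upto h (- 2)"
proof (rule antisym)
  show "cspan low \<subseteq> eigenspaces_upto h (- 2)"
    unfolding low_def eigenspaces_upto_def by (rule cvec.span_mono) (auto simp: wt_def)
  show "eigenspaces_upto h (- 2) \<subseteq> cspan low"
    unfolding eigenspaces_upto_def
  proof (rule cvec.span_minimal)
    show "(\<Union>i\<in>{..- 2}. eigenspace h i) \<subseteq> cspan low"
    proof (rule UN_least)
      fix i :: int assume "i \<in> {..- 2}"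
      then show "eigenspace h i \<subseteq> cspan low"
        by (intro eigenspace_subset_span) (auto intro: cvec.span_base lowI)
    qed
  qed (rule cvec.subspace_span)
qed

text \<open>In odd dimension the middle vector would pair with itself to 1, against the skew
  symmetry of the bracket on even elements.\<close>

lemma even_symplectic_dimension:
  assumes "basis_family u s (wt i 0)"
    and "\<And>i j. i \<in> {1..s} \<Longrightarrow> j \<in> {1..s} \<Longrightarrow>
      form e (bracket (u i) (u j)) = (if i + j = s + 1 then (if i \<le> s div 2 then - 1 else 1) else 0)"
  shows "even s"
proof (rule ccontr)
  assume "odd s"
  then obtain k where k: "s = 2 * k + 1" by (rule oddE)
  have "k + 1 \<in> {1..s}" "k + 1 + (k + 1) = s + 1" using k by auto
  then have 1: "form e (bracket (u (k + 1)) (u (k + 1))) = 1"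
    using assms(2)[of "k + 1" "k + 1"] k by simp
  have "u (k + 1) \<in> cspan (u ` {1..s})" using \<open>k + 1 \<in> {1..s}\<close> by (intro cvec.span_base) blast
  then have "u (k + 1) \<in> gr 0" using assms(1) by (simp add: basis_family_def wt_def)
  from bracket_super_skew[OF this this]
  have "bracket (u (k + 1)) (u (k + 1)) = - bracket (u (k + 1)) (u (k + 1))" by simp
  then have "form e (bracket (u (k + 1)) (u (k + 1))) = - form e (bracket (u (k + 1)) (u (k + 1)))"
    using form_minus(2) by metis
  then show False using 1 by simp
qed

end

theorem theorem4p11:
  fixes form :: "'g::lie_superalgebra \<Rightarrow> 'g \<Rightarrow> complex"
    and e h f :: 'g
    and s r :: nat
    and u v :: "nat \<Rightarrow> 'g"
  assumes "basic_lie_superalgebra TYPE('g)"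
    and "basic_form form"
    and "ad_nilpotent e"
    and "even_sl2_triple e h f"
    and "form e f = 1"
    and "s = cdim (eigenspace h (- 1) \<inter> gr 0)"
    and "r = cdim (eigenspace h (- 1) \<inter> gr 1)"
    and "basis_family u s (eigenspace h (- 1) \<inter> gr 0)"
    and "basis_family v r (eigenspace h (- 1) \<inter> gr 1)"
    and "\<And>i j. i \<in> {1..s} \<Longrightarrow> j \<in> {1..s} \<Longrightarrow>
      form e (bracket (u i) (u j)) = (if i + j = s + 1 then (if i \<le> s div 2 then - 1 else 1) else 0)"
    and "\<And>i j. i \<in> {1..r} \<Longrightarrow> j \<in> {1..r} \<Longrightarrow>
      form e (bracket (v i) (v j)) = (if i + j = r + 1 then 1 else 0)"
  shows "\<exists>\<phi>. kazhdan_isomorphism h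
      (character_ideal (form e) (m_space h u s v r)) (m'_space h u s v r)
      (character_ideal (form e) (eigenspaces_upto h (- 2))) (n_space h) \<phi>"
proof -
  interpret graded_form form e h
    using assms(1-4) unfolding basic_lie_superalgebra_def by (intro graded_form_sl2) auto
  note form_u = assms(10) and form_v = assms(11)
  have u_basis: "basis_family u s (wt (- 1) 0)" and v_basis: "basis_family v r (wt (- 1) 1)"
    using assms(8,9) by (simp_all add: wt_def)
  have span_u: "cspan (u ` {1..s}) = wt (- 1) 0" and span_v: "cspan (v ` {1..r}) = wt (- 1) 1"
    using u_basis v_basis by (simp_all add: basis_family_def)
  have u_wt: "u k \<in> wt (- 1) 0" if "k \<in> {1..s}" for k
    unfolding span_u[symmetric] using that by (intro cvec.span_base imageI)
  have v_wt: "v k \<in> wt (- 1) 1" if "k \<in> {1..r}" for k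
    unfolding span_v[symmetric] using that by (intro cvec.span_base imageI)
  have s: "even s" by (rule even_symplectic_dimension[OF u_basis form_u])
  define R where "R = (if even r then {r div 2 + 1..r} else {(r + 3) div 2..r})"
  have R: "k \<le> r" "2 * k \<ge> r + 2" if "k \<in> R" for k
    using that by (auto simp: R_def split: if_splits elim!: evenE oddE)
  \<comment> \<open>One description for both parities of \<open>r\<close>: the indices strictly
    beyond the middle, where \<open>2 * k = r + 1\<close>.\<close>
  have R_iff: "k \<in> R \<longleftrightarrow> k \<le> r \<and> 2 * k \<ge> r + 2" for k
    by (auto simp: R_def elim!: evenE oddE)
  define S where "S = {s div 2 + 1..s}"
  have S_iff: "k \<in> S \<longleftrightarrow> k \<le> s \<and> 2 * k \<ge> s + 2" for k
    using s by (auto simp: S_def elim!: evenE)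
  \<comment> \<open>The first component is the parity, so \<open>fst\<close> serves as
    \<open>\<pi>\<close>.\<close>
  define L where "L = {0} \<times> S \<union> {1 :: bit} \<times> R"
  define a where "a = (\<lambda>(p :: bit, k). if p = 0 then u (s + 1 - k) else v (r + 1 - k))"
  define b where "b = (\<lambda>(p :: bit, k). if p = 0 then u k else v k)"
  define mid where "mid = (if even r then {} else {v ((r + 1) div 2)})"
  have uv: "form e (bracket x y) = 0" if "x \<in> wt (- 1) p" "y \<in> wt (- 1) q" "p \<noteq> q" for x y p q
  proof -
    have "p + q = 1" using that(3) by (cases p; cases q) auto
    then show ?thesis using bracket_wt[OF that(1,2)] chi_odd by (simp add: wt_def)
  qed
  have a_wt: "a k \<in> wt (- 1) (fst k)" and b_wt: "b k \<in> wt (- 1) (fst k)" if "k \<in> L" for k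
    using that by (auto simp: L_def a_def b_def S_iff R_iff intro!: u_wt v_wt; arith)+
  \<comment> \<open>The mirror index \<open>s + 1 - j\<close> lies in the first half, hence the
    value -1.\<close>
  have chi_u: "form e (bracket (u (s + 1 - j)) (u k)) = (if j = k then - 1 else 0)"
    "form e (bracket (u j) (u k)) = 0" if "j \<in> S" "k \<in> S" for j k
  proof -
    have *: "j \<in> {1..s}" "k \<in> {1..s}" "s + 1 - j \<in> {1..s}" "s + 1 - j \<le> s div 2" "j + k \<noteq> s + 1"
      "s + 1 - j + k = s + 1 \<longleftrightarrow> j = k"
      using that s unfolding S_iff atLeastAtMost_iff by (auto elim!: evenE)
    show "form e (bracket (u (s + 1 - j)) (u k)) = (if j = k then - 1 else 0)"
      unfolding form_u[OF *(3,2)] *(6) by (simp only: *(4) if_True)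
    show "form e (bracket (u j) (u k)) = 0"
      unfolding form_u[OF *(1,2)] using *(5) by simp
  qed
  have chi_v: "form e (bracket (v (r + 1 - j)) (v k)) = (if j = k then 1 else 0)"
    "form e (bracket (v j) (v k)) = 0" if "j \<in> R" "k \<in> R" for j k
  proof -
    have *: "j \<in> {1..r}" "k \<in> {1..r}" "r + 1 - j \<in> {1..r}" "j + k \<noteq> r + 1"
      "r + 1 - j + k = r + 1 \<longleftrightarrow> j = k"
      using that unfolding R_iff atLeastAtMost_iff by auto
    show "form e (bracket (v (r + 1 - j)) (v k)) = (if j = k then 1 else 0)"
      unfolding form_v[OF *(3,2)] *(5) ..
    show "form e (bracket (v j) (v k)) = 0"
      unfolding form_v[OF *(1,2)] using *(4) by simp
  qed
  interpret lagrangian form e h L a b fst mid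
  proof (rule lagrangian.intro[OF graded_form_axioms], rule lagrangian_axioms.intro)
    show "finite L" by (simp add: L_def S_def R_def)
    show "a k \<in> wt (- 1) (fst k)" "b k \<in> wt (- 1) (fst k)" if "k \<in> L" for k
      using a_wt[OF that] b_wt[OF that] .
    show "z \<in> wt (- 1) 1" if "z \<in> mid" for z
      using that by (auto simp: mid_def intro!: v_wt split: if_splits elim!: oddE)
    show "form e (bracket (a k) (b k)) \<noteq> 0" if "k \<in> L" for k
      using that by (auto simp: L_def a_def b_def chi_u[simplified] chi_v[simplified] split: if_splits)
    show "form e (bracket (a j) (b k)) = 0" if "j \<in> L" "k \<in> L" "j \<noteq> k" for j k
    proof (cases "fst j = fst k")
      case True
      then show ?thesis using that by (auto simp: L_def a_def b_def chi_u[simplified] chi_v[simplified] split: if_splits)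
    next
      case False
      then show ?thesis by (rule uv[OF a_wt[OF that(1)] b_wt[OF that(2)]])
    qed
    show "form e (bracket (b j) (b k)) = 0" if "j \<in> L" "k \<in> L" for j k
    proof (cases "fst j = fst k")
      case True
      then show ?thesis using that by (auto simp: L_def b_def chi_u chi_v)
    next
      case False
      then show ?thesis by (rule uv[OF b_wt[OF that(1)] b_wt[OF that(2)]])
    qed
    show "form e (bracket z (b k)) = 0" if "z \<in> mid" "k \<in> L" for z k
    proof -
      have z: "odd r" "z = v ((r + 1) div 2)" using that(1) by (auto simp: mid_def split: if_splits)
      then have c: "(r + 1) div 2 \<in> {1..r}" "2 * ((r + 1) div 2) = r + 1" by (auto elim!: oddE)
      show ?thesis
      proof (cases "fst k = 0")
        case True
        then show ?thesis unfolding z(2) using c(1) that(2) by (intro uv[OF v_wt b_wt]) auto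
      next
        case False
        then have "b k = v (snd k)" "snd k \<in> R" using that(2) by (auto simp: L_def b_def)
        then show ?thesis unfolding z(2) using c R_iff[of "snd k"] by (auto simp: form_v)
      qed
    qed
  qed
  have b_image: "b ` L = u ` S \<union> v ` R"
    by (force simp: b_def L_def image_Un)
  have low_b: "cspan (low \<union> b ` L) = m_space h u s v r"
    unfolding m_space_def b_image span_low[symmetric] Un_assoc span_span_Un S_def R_def ..
  have m': "cspan m'_gens = m'_space h u s v r"
  proof (cases "even r")
    case True
    then have "mid = {}" by (simp add: mid_def)
    then have "m'_gens = low \<union> b ` L" unfolding m'_gens_def by blast
    then show ?thesis using True low_b by (simp add: m'_space_def)
  next
    case False
    then have "mid = {v ((r + 1) div 2)}" by (simp add: mid_def)
    then have "m'_gens = low \<union> b ` L \<union> {v ((r + 1) div 2)}" unfolding m'_gens_def by blast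
    then show ?thesis
      using False unfolding m'_space_def low_b[symmetric] span_span_Un by simp
  qed
  have n: "cspan n_gens = n_space h"
  proof (rule antisym)
    show "cspan n_gens \<subseteq> n_space h"
      unfolding n_space_def eigenspaces_upto_def
    proof (rule cvec.span_mono, rule subsetI)
      fix x assume "x \<in> n_gens"
      then obtain i p where "x \<in> wt i p" "i \<le> - 1" by (rule n_gens_wt)
      then show "x \<in> (\<Union>i\<in>{..- 1}. eigenspace h i)" by (auto simp: wt_def)
    qed
    have u_n: "u k \<in> n_gens" if "k \<in> {1..s}" for k
    proof (cases "k \<in> S")
      case True
      then show ?thesis by (auto simp: n_gens_def m'_gens_def b_image)
    next
      case False
      moreover obtain m where "s = 2 * m" using s by (rule evenE)
      ultimately have "s + 1 - k \<in> S" "s + 1 - (s + 1 - k) = k"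
        using that unfolding S_iff atLeastAtMost_iff by arith+
      then have "(0, s + 1 - k) \<in> L" "a (0, s + 1 - k) = u k"
        by (simp_all add: L_def a_def)
      then show ?thesis unfolding n_gens_def by (metis UnI2 imageI)
    qed
    have v_n: "v k \<in> n_gens" if "k \<in> {1..r}" for k
    proof (cases "k \<in> R")
      case True
      then show ?thesis by (auto simp: n_gens_def m'_gens_def b_image)
    next
      case False
      show ?thesis
      \<comment> \<open>The self-dual middle index of an odd \<open>r\<close> lies neither in
        \<open>R\<close> nor in its mirror image; \<open>mid\<close> supplies it.\<close>
      proof (cases "2 * k = r + 1")
        case True
        then have "odd r" "(r + 1) div 2 = k" by presburger+
        then have "v k \<in> mid" by (simp add: mid_def)
        then show ?thesis by (simp add: n_gens_def m'_gens_def)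
      next
        case False
        with \<open>k \<notin> R\<close> that have "r + 1 - k \<in> R" "r + 1 - (r + 1 - k) = k"
          unfolding R_iff atLeastAtMost_iff by arith+
        then have "(1, r + 1 - k) \<in> L" "a (1, r + 1 - k) = v k"
          by (simp_all add: L_def a_def)
        then show ?thesis unfolding n_gens_def by (metis UnI2 imageI)
      qed
    qed
    show "n_space h \<subseteq> cspan n_gens"
      unfolding n_space_def eigenspaces_upto_def
    proof (rule cvec.span_minimal[OF UN_least cvec.subspace_span])
      fix i :: int assume "i \<in> {..- 1}"
      then consider "i \<le> - 2" | "i = - 1" by fastforce
      then show "eigenspace h i \<subseteq> cspan n_gens"
      proof cases
        case 1
        then have "eigenspace h i \<subseteq> cspan low"
          unfolding span_low eigenspaces_upto_def by (auto intro: cvec.span_base)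
        also have "\<dots> \<subseteq> cspan n_gens" by (rule cvec.span_mono[OF low_n_gens])
        finally show ?thesis .
      next
        case 2
        have "cspan (u ` {1..s}) \<subseteq> cspan n_gens" "cspan (v ` {1..r}) \<subseteq> cspan n_gens"
          using u_n v_n by (intro cvec.span_mono image_subsetI; simp)+
        then have "wt i p \<subseteq> cspan n_gens" for p
          unfolding 2 using span_u span_v by (cases p) simp_all
        then show ?thesis by (rule eigenspace_subset_span)
      qed
    qed
  qed
  have "character_ideal (form e) (m_space h u s v r) = J_upto L"
    by (rule character_ideal_eqI) (simp_all add: form_add form_scaleC flip: low_b)
  moreover have "character_ideal (form e) (eigenspaces_upto h (- 2)) = chi_ideal low"
    by (rule character_ideal_eqI) (simp_all add: form_add form_scaleC flip: span_low)
  ultimately show ?thesis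
    using kazhdan_isomorphism_lift unfolding m' n by auto
qed

end
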